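(* Let $R$ be a commutative ring and let $r\geq 3$. Let $A$ be a dgmodule over $R$ such that $H(A)$ and $Z(A)$ are graded projective $R$-modules. Assume $A$ is an $A_r$-algebra, with structure maps $m_i\in \mathrm{End}^i_{i-2}(A)$ for $1\leq i\leq r$. Then the obstruction to lift the $A_{r-1}$-structure of $A$ to an $A_{r+1}$-structure lies in $HH^{r+1}_{r-2}(H(A))$.
   Context: A dgmodule over the commutative ring $R$ is a $\mathbb{Z}$-graded $R$-module $C=(C_i)_{i\in\mathbb{Z}}$ with a differential $\partial_C$ of degree $-1$. Put $Z_i(C)=\ker(\partial_C:C_i\to C_{i-1})$, $B_i(C)=\mathrm{im}(\partial_C:C_{i+1}\to C_i)$ and $H_i(C)=Z_i(C)/B_i(C)$. Tensor products are over $R$, with $(C\otimes D)_n=\bigoplus_{i+j=n}C_i\otimes_R D_j$ and $\partial(c\otimes d)=\partial_C c\otimes d+(-1)^i c\otimes\partial_D d$ for $c\in C_i$. The dgmodule $\mathrm{Hom}(C,D)$ is given by $\mathrm{Hom}_i(C,D)=\prod_n\mathrm{Hom}_R(C_n,D_{n+i})$ with differential $\partial f=\partial_D f-(-1)^i f\partial_C$ for $f\in\mathrm{Hom}_i(C,D)$. The Koszul sign rule is used: $(f\otimes g)(x\otimes y)=(-1)^{\deg(x)\deg(g)}f(x)\otimes g(y)$. For a graded $R$-module $V$, $\mathrm{End}^n_i(V)=\mathrm{Hom}_i(V^{\otimes n},V)$; an element $f\in\mathrm{End}^n_i(V)$ has arity $n$, degree $i$ and weight $|f|=i+n-1$. For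 $f\in\mathrm{End}^n_i(V)$ and $g\in\mathrm{End}^m_j(V)$ set $$f\circ g=(-1)^{|g|(n-1)}\sum_{k=1}^n(-1)^{(m-1)(k-1)} f(\mathrm{id}^{\otimes k-1}\otimes g\otimes\mathrm{id}^{\otimes n-k}),\qquad [f,g]=f\circ g-(-1)^{|f||g|}g\circ f.$$ For an integer $r>0$, a graded $R$-module $V$ is an $A_r$-algebra if there are elements $m_i\in\mathrm{Hom}_{i-2}(V^{\otimes i},V)$, $1\leq i\leq r$, such that $\sum_{i+j=n+1}m_i\circ m_j=0$ for all $1\leq n\leq r$ (with $i,j\geq 1$). An $A_1$-algebra is the same as a dgmodule with differential $m_1$; for an $A_r$-structure on a dgmodule $A$, $m_1$ is the differential of $A$. The $A_{r-1}$-structure of an $A_r$-algebra is the collection $(m_1,\dots,m_{r-1})$; lifting it to an $A_{r+1}$-structure means finding an $A_{r+1}$-structure on $A$ whose first $r-1$ structure maps are $m_1,\dots,m_{r-1}$. If $f\in\mathrm{End}^n_i(A)$ satisfies $\partial f=0$, it induces $\overline f\in\mathrm{End}^n_i(H(A))$ by applying $f$ to representing cycles. For $r\geq 3$, $\overline{m_2}$ makes $H(A)$ a graded associative algebra. For a graded associative algebra $(B,\mu)$ (that is, $\mu\in\mathrm{End}^2_0(B)$ with $\mu\circ\mu=0$), the map $\mathrm{d}=[\mu,-]:\mathrm{End}^n_i(B)\to\mathrm{End}^{n+1}_i(B)$ is a differential; the resulting complex is the Hochschild cochain complex of $B$, and its cohomology, the Hochschild cohomology of $B$, is bigraded: $HH^n_i(B)$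 is the cohomology at $\mathrm{End}^n_i(B)$. In the claim, $HH^{r+1}_{r-2}(H(A))$ is taken for the graded associative algebra $(H(A),\overline{m_2})$. *)

theory Defs
  imports "HOL-Algebra.Module" "HOL-Algebra.AbelCoset"
begin

section \<open>Modules over a commutative ring\<close>

text \<open>
  The record type of modules extends that of rings; the fields \<open>mult\<close> and \<open>one\<close> play no role for
  modules and are left \<open>undefined\<close> in the constructions below.
\<close>

definition lin_hom ::
  "('r, 'z) ring_scheme \<Rightarrow> ('r, 'm) module \<Rightarrow> ('r, 'n) module \<Rightarrow> ('m \<Rightarrow> 'n) set" where
  "lin_hom R M N =
     {f \<in> carrier M \<rightarrow>\<^sub>E carrier N.
        (\<forall>x\<in>carrier M. \<forall>y\<in>carrier M. f (x \<oplus>\<^bsub>M\<^esub> y) = f x \<oplus>\<^bsub>N\<^esub> f y) \<and>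
        (\<forall>a\<in>carrier R. \<forall>x\<in>carrier M. f (a \<odot>\<^bsub>M\<^esub> x) = a \<odot>\<^bsub>N\<^esub> f x)}"

definition quot_module :: "('r, 'm) module \<Rightarrow> 'm set \<Rightarrow> ('r, 'm set) module" where
  "quot_module M N =
     \<lparr>carrier = a_rcosets\<^bsub>M\<^esub> N, mult = undefined, one = undefined,
      zero = N, add = (\<lambda>X Y. X <+>\<^bsub>M\<^esub> Y),
      smult = (\<lambda>a X. \<Union>x\<in>X. N +>\<^bsub>M\<^esub> (a \<odot>\<^bsub>M\<^esub> x))\<rparr>"

definition generated_submodule ::
  "('r, 'z) ring_scheme \<Rightarrow> ('r, 'm) module \<Rightarrow> 'm set \<Rightarrow> 'm set" where
  "generated_submodule R M S = \<Inter>{N. submodule N R M \<and> S \<subseteq> N}"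

definition free_module :: "('r, 'z) ring_scheme \<Rightarrow> 's set \<Rightarrow> ('r, 's \<Rightarrow> 'r) module" where
  "free_module R S =
     \<lparr>carrier = {c. (\<forall>s\<in>S. c s \<in> carrier R) \<and> (\<forall>s. s \<notin> S \<longrightarrow> c s = \<zero>\<^bsub>R\<^esub>) \<and>
                    finite {s. c s \<noteq> \<zero>\<^bsub>R\<^esub>}},
      mult = undefined, one = undefined,
      zero = (\<lambda>s. \<zero>\<^bsub>R\<^esub>), add = (\<lambda>c d s. c s \<oplus>\<^bsub>R\<^esub> d s),
      smult = (\<lambda>a c s. a \<otimes>\<^bsub>R\<^esub> c s)\<rparr>"

definition free_gen :: "('r, 'z) ring_scheme \<Rightarrow> 's \<Rightarrow> 's \<Rightarrow> 'r" where
  "free_gen R s = (\<lambda>t. if t = s then \<one>\<^bsub>R\<^esub> else \<zero>\<^bsub>R\<^esub>)"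

text \<open>
  Projectivity is the lifting property against surjections.  HOL cannot quantify over types, so
  the test modules \<open>M\<close> and \<open>N\<close> live on the fixed types \<open>'p \<Rightarrow> 'r\<close> and \<open>'p\<close>.  These contain the free
  module on \<open>carrier P\<close> and \<open>P\<close> itself, so that the canonical surjection from the former to the
  latter is among the tests; hence nothing is lost: see lemma \<open>projective_lifting\<close> below, which
  gives the lifting property for test modules on arbitrary types.
\<close>

definition projective :: "('r, 'z) ring_scheme \<Rightarrow> ('r, 'p) module \<Rightarrow> bool" where
  "projective R P \<longleftrightarrow> module R P \<and>
     (\<forall>(M :: ('r, 'p \<Rightarrow> 'r) module) (N :: ('r, 'p) module) g f.
        module R M \<and> module R N \<and> g \<in> lin_hom R M N \<and> g ` carrier M = carrier N \<and>
        f \<in> lin_hom R P N \<longrightarrow>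
        (\<exists>h\<in>lin_hom R P M. \<forall>x\<in>carrier P. g (h x) = f x))"

text \<open>The element \<open>(-1)\<^sup>k x\<close>.\<close>

definition ksign :: "('r, 'm) module \<Rightarrow> int \<Rightarrow> 'm \<Rightarrow> 'm" where
  "ksign M k x = (if even k then x else \<ominus>\<^bsub>M\<^esub> x)"


subsection \<open>Universal properties of free and quotient modules\<close>

lemma generated_submodule_le:
  assumes "submodule N R M" "S \<subseteq> N"
  shows "generated_submodule R M S \<subseteq> N"
  using assms unfolding generated_submodule_def by auto

lemma generated_submodule_gen: "S \<subseteq> generated_submodule R M S"
  unfolding generated_submodule_def by auto

lemma generated_submodule_submodule:
  assumes "module R M" "S \<subseteq> carrier M"
  shows "submodule (generated_submodule R M S) R M"
proof -
  interpret module R M by fact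
  have c: "submodule (carrier M) R M" by (rule carrier_is_submodule)
  show ?thesis
  proof (rule submoduleI)
    show "generated_submodule R M S \<subseteq> carrier M"
      using c assms(2) unfolding generated_submodule_def by auto
    show "\<zero>\<^bsub>M\<^esub> \<in> generated_submodule R M S"
      unfolding generated_submodule_def
      by (auto simp: submodule_def dest: subgroup.one_closed)
  next
    fix a assume "a \<in> generated_submodule R M S"
    then show "\<ominus>\<^bsub>M\<^esub> a \<in> generated_submodule R M S"
      unfolding generated_submodule_def using submoduleE(3) by auto
  next
    fix a b assume "a \<in> generated_submodule R M S" "b \<in> generated_submodule R M S"
    then show "a \<oplus>\<^bsub>M\<^esub> b \<in> generated_submodule R M S"
      unfolding generated_submodule_def using submoduleE(5) by auto
  next
    fix a b assume "a \<in> carrier R" "b \<in> generated_submodule R M S"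
    then show "a \<odot>\<^bsub>M\<^esub> b \<in> generated_submodule R M S"
      unfolding generated_submodule_def using submoduleE(4) by auto
  qed
qed

lemma free_module_module:
  assumes "cring R"
  shows "module R (free_module R S)"
proof -
  interpret R: cring R by fact
  have fin: "finite {s. f s \<noteq> \<zero>\<^bsub>R\<^esub>}"
    if "finite {s. c s \<noteq> \<zero>\<^bsub>R\<^esub>}" "finite {s. d s \<noteq> \<zero>\<^bsub>R\<^esub>}"
      "\<And>s. c s = \<zero>\<^bsub>R\<^esub> \<Longrightarrow> d s = \<zero>\<^bsub>R\<^esub> \<Longrightarrow> f s = \<zero>\<^bsub>R\<^esub>" for c d :: "_ \<Rightarrow> _" and f
    by (rule finite_subset[OF _ finite_UnI[OF that(1,2)]]) (use that(3) in auto)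
  have cl: "c s \<in> carrier R" if "c \<in> carrier (free_module R S)" for c s
    using that by (cases "s \<in> S") (auto simp: free_module_def)
  have ext: "c = d" if "c \<in> carrier (free_module R S)" "d \<in> carrier (free_module R S)"
    "\<And>s. s \<in> S \<Longrightarrow> c s = d s" for c d
    by (rule ext) (use that in \<open>auto simp: free_module_def, metis\<close>)
  have add: "c \<oplus>\<^bsub>free_module R S\<^esub> d \<in> carrier (free_module R S)"
    if "c \<in> carrier (free_module R S)" "d \<in> carrier (free_module R S)" for c d
    using that fin[of c d "\<lambda>s. c s \<oplus>\<^bsub>R\<^esub> d s"] by (auto simp: free_module_def)
  have ev: "(c \<oplus>\<^bsub>free_module R S\<^esub> d) s = c s \<oplus>\<^bsub>R\<^esub> d s" 
     "(a \<odot>\<^bsub>free_module R S\<^esub> c) s = a \<otimes>\<^bsub>R\<^esub> c s" "\<zero>\<^bsub>free_module R S\<^esub> s = \<zero>\<^bsub>R\<^esub>" for c d a s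
    by (auto simp: free_module_def)
  have sm: "a \<odot>\<^bsub>free_module R S\<^esub> c \<in> carrier (free_module R S)"
    if "a \<in> carrier R" "c \<in> carrier (free_module R S)" for a c
    using that fin[of c c "\<lambda>s. a \<otimes>\<^bsub>R\<^esub> c s"] by (auto simp: free_module_def)
  have z: "\<zero>\<^bsub>free_module R S\<^esub> \<in> carrier (free_module R S)"
    by (auto simp: free_module_def)
  show ?thesis
  proof (rule moduleI[OF assms])
    show "abelian_group (free_module R S)"
    proof (rule abelian_groupI)
      fix c assume c: "c \<in> carrier (free_module R S)"
      let ?d = "\<lambda>s. \<ominus>\<^bsub>R\<^esub> c s"
      have "?d \<in> carrier (free_module R S)" 
        using c fin[of c c ?d] by (auto simp: free_module_def)
      moreover have "?d \<oplus>\<^bsub>free_module R S\<^esub> c = \<zero>\<^bsub>free_module R S\<^esub>"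
        by (rule HOL.ext) (use cl[OF c] in \<open>auto simp: ev R.l_neg\<close>)
      ultimately show "\<exists>y\<in>carrier (free_module R S). y \<oplus>\<^bsub>free_module R S\<^esub> c = \<zero>\<^bsub>free_module R S\<^esub>"
        by blast
    qed (auto intro!: HOL.ext simp: add z ev cl R.a_ac)
  qed (auto intro!: HOL.ext simp: sm ev cl R.l_distr R.r_distr R.m_assoc)
qed

lemma free_gen_closed:
  assumes "cring R" "s \<in> S"
  shows "free_gen R s \<in> carrier (free_module R S)"
proof -
  interpret R: cring R by fact
  show ?thesis using assms(2) by (auto simp: free_module_def free_gen_def)
qed

lemma lin_hom_closed: "f \<in> lin_hom R M N \<Longrightarrow> x \<in> carrier M \<Longrightarrow> f x \<in> carrier N"
  by (auto simp: lin_hom_def)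

lemma lin_hom_add: "f \<in> lin_hom R M N \<Longrightarrow> x \<in> carrier M \<Longrightarrow> y \<in> carrier M \<Longrightarrow>
   f (x \<oplus>\<^bsub>M\<^esub> y) = f x \<oplus>\<^bsub>N\<^esub> f y"
  by (auto simp: lin_hom_def)

lemma lin_hom_smult: "f \<in> lin_hom R M N \<Longrightarrow> a \<in> carrier R \<Longrightarrow> x \<in> carrier M \<Longrightarrow>
   f (a \<odot>\<^bsub>M\<^esub> x) = a \<odot>\<^bsub>N\<^esub> f x"
  by (auto simp: lin_hom_def)

lemma lin_hom_ext: "f \<in> lin_hom R M N \<Longrightarrow> g \<in> lin_hom R M N' \<Longrightarrow>
   (\<And>x. x \<in> carrier M \<Longrightarrow> f x = g x) \<Longrightarrow> f = g"
  unfolding lin_hom_def by (auto intro: extensionalityI simp: PiE_def)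

lemma lin_hom_zero:
  assumes "f \<in> lin_hom R M N" "module R M" "module R N"
  shows "f \<zero>\<^bsub>M\<^esub> = \<zero>\<^bsub>N\<^esub>"
proof -
  interpret M: module R M by fact
  interpret N: module R N by fact
  have "f \<zero>\<^bsub>M\<^esub> = f (\<zero>\<^bsub>R\<^esub> \<odot>\<^bsub>M\<^esub> \<zero>\<^bsub>M\<^esub>)" by simp
  also have "\<dots> = \<zero>\<^bsub>R\<^esub> \<odot>\<^bsub>N\<^esub> f \<zero>\<^bsub>M\<^esub>" by (rule lin_hom_smult[OF assms(1)]) auto
  also have "\<dots> = \<zero>\<^bsub>N\<^esub>" using lin_hom_closed[OF assms(1)] by simp
  finally show ?thesis .
qed

lemma lin_hom_minus:
  assumes "f \<in> lin_hom R M N" "module R M" "module R N" "x \<in> carrier M" "y \<in> carrier M"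
  shows "f (x \<ominus>\<^bsub>M\<^esub> y) = f x \<ominus>\<^bsub>N\<^esub> f y"
proof -
  interpret M: module R M by fact
  interpret N: module R N by fact
  note cl = lin_hom_closed[OF assms(1)]
  have "f (\<ominus>\<^bsub>M\<^esub> y) = \<ominus>\<^bsub>N\<^esub> f y"
    using lin_hom_add[OF assms(1), of "\<ominus>\<^bsub>M\<^esub> y" y] assms(4,5) cl lin_hom_zero[OF assms(1-3)]
    by (metis M.M.l_neg M.a_inv_closed N.M.minus_equality)
  then show ?thesis
    using lin_hom_add[OF assms(1), of x "\<ominus>\<^bsub>M\<^esub> y"] assms(4,5) by (simp add: a_minus_def)
qed

lemma free_module_hom_eq:
  assumes R: "cring R" and M: "module R M" 
    and f: "f \<in> lin_hom R (free_module R S) M" and g: "g \<in> lin_hom R (free_module R S) M"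
    and eq: "\<And>s. s \<in> S \<Longrightarrow> f (free_gen R s) = g (free_gen R s)"
  shows "f = g"
proof (rule lin_hom_ext[OF f g])
  interpret R: cring R by fact
  interpret F: module R "free_module R S" by (rule free_module_module[OF R])
  have *: "finite T \<Longrightarrow> \<forall>c\<in>carrier (free_module R S). {s. c s \<noteq> \<zero>\<^bsub>R\<^esub>} \<subseteq> T \<longrightarrow> f c = g c" for T
  proof (induction T rule: finite_induct)
    case empty
    have "c = \<zero>\<^bsub>free_module R S\<^esub>" if "{s. c s \<noteq> \<zero>\<^bsub>R\<^esub>} \<subseteq> {}" for c
      using that by (auto simp: free_module_def)
    then show ?case 
      using lin_hom_zero[OF f F.module_axioms M] lin_hom_zero[OF g F.module_axioms M] by metis
  next
    case (insert t T)
    show ?case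
    proof (intro ballI impI)
      fix c assume c: "c \<in> carrier (free_module R S)" and sub: "{s. c s \<noteq> \<zero>\<^bsub>R\<^esub>} \<subseteq> insert t T"
      let ?c = "c(t := \<zero>\<^bsub>R\<^esub>)"
      have c': "?c \<in> carrier (free_module R S)"
        using c by (auto simp: free_module_def elim: finite_subset[rotated])
      have sub': "{s. ?c s \<noteq> \<zero>\<^bsub>R\<^esub>} \<subseteq> T" using sub by auto
      have IH: "f ?c = g ?c" using insert.IH c' sub' by blast
      show "f c = g c"
      proof (cases "t \<in> S")
        case False
        then have "?c = c" using c by (auto simp: free_module_def)
        then show ?thesis using IH by metis
      next
        case True
        have ct: "c t \<in> carrier R" using c True by (auto simp: free_module_def)
        have cs: "c s \<in> carrier R" for s using c by (cases "s \<in> S") (auto simp: free_module_def)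
        note e = free_gen_closed[OF R True]
        have dec: "c = ?c \<oplus>\<^bsub>free_module R S\<^esub> (c t \<odot>\<^bsub>free_module R S\<^esub> free_gen R t)"
          using cs by (auto simp: free_module_def free_gen_def)
        have "h c = h ?c \<oplus>\<^bsub>M\<^esub> (c t \<odot>\<^bsub>M\<^esub> h (free_gen R t))" if "h \<in> lin_hom R (free_module R S) M" for h
          by (subst dec) (use lin_hom_add[OF that c'] lin_hom_smult[OF that ct e] ct e in simp)
        from this[OF f] this[OF g] show ?thesis using IH eq[OF True] by simp
      qed
    qed
  qed
  fix c assume "c \<in> carrier (free_module R S)"
  then show "f c = g c" using *[of "{s. c s \<noteq> \<zero>\<^bsub>R\<^esub>}"] by (auto simp: free_module_def)
qed

lemma free_module_ext:
  assumes R: "cring R" and M: "module R M" and phi: "\<And>s. s \<in> S \<Longrightarrow> \<phi> s \<in> carrier M"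
  obtains f where "f \<in> lin_hom R (free_module R S) M" "\<And>s. s \<in> S \<Longrightarrow> f (free_gen R s) = \<phi> s"
proof -
  interpret R: cring R by fact
  interpret M: module R M by fact
  let ?F = "free_module R S"
  interpret F: module R ?F by (rule free_module_module[OF R])
  define f where "f = (\<lambda>c\<in>carrier ?F. \<Oplus>\<^bsub>M\<^esub>s\<in>{s. c s \<noteq> \<zero>\<^bsub>R\<^esub>}. c s \<odot>\<^bsub>M\<^esub> \<phi> s)"
  have cs: "c s \<in> carrier R" if "c \<in> carrier ?F" for c s 
    using that by (cases "s \<in> S") (auto simp: free_module_def)
  have f: "f c = (\<Oplus>\<^bsub>M\<^esub>s\<in>T. c s \<odot>\<^bsub>M\<^esub> \<phi> s)"
    if c: "c \<in> carrier ?F" and T: "finite T" "{s. c s \<noteq> \<zero>\<^bsub>R\<^esub>} \<subseteq> T" "T \<subseteq> S" for c T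
  proof -
    have "(\<Oplus>\<^bsub>M\<^esub>s\<in>{s. c s \<noteq> \<zero>\<^bsub>R\<^esub>}. c s \<odot>\<^bsub>M\<^esub> \<phi> s) = (\<Oplus>\<^bsub>M\<^esub>s\<in>T. c s \<odot>\<^bsub>M\<^esub> \<phi> s)"
      by (rule M.add.finprod_mono_neutral_cong_left) (use T phi cs[OF c] in auto)
    then show ?thesis using c by (simp add: f_def)
  qed
  have supp: "finite {s. c s \<noteq> \<zero>\<^bsub>R\<^esub>}" "{s. c s \<noteq> \<zero>\<^bsub>R\<^esub>} \<subseteq> S" if "c \<in> carrier ?F" for c
    using that by (auto simp: free_module_def)
  have "f \<in> lin_hom R ?F M"
    unfolding lin_hom_def
  proof (intro CollectI conjI ballI)
    show "f \<in> carrier ?F \<rightarrow>\<^sub>E carrier M"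
      unfolding f_def
    proof (rule PiE_I)
      fix c assume c: "c \<in> carrier ?F"
      have "(\<lambda>s. c s \<odot>\<^bsub>M\<^esub> \<phi> s) \<in> {s. c s \<noteq> \<zero>\<^bsub>R\<^esub>} \<rightarrow> carrier M"
        using phi cs[OF c] supp(2)[OF c] by (auto intro!: M.smult_closed)
      then show "(\<lambda>c\<in>carrier ?F. \<Oplus>\<^bsub>M\<^esub>s\<in>{s. c s \<noteq> \<zero>\<^bsub>R\<^esub>}. c s \<odot>\<^bsub>M\<^esub> \<phi> s) c \<in> carrier M"
        using c by (simp add: M.finsum_closed)
    qed simp
  next
    fix c d assume c: "c \<in> carrier ?F" and d: "d \<in> carrier ?F"
    let ?T = "{s. c s \<noteq> \<zero>\<^bsub>R\<^esub>} \<union> {s. d s \<noteq> \<zero>\<^bsub>R\<^esub>}"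
    have T: "finite ?T" "?T \<subseteq> S" using supp[OF c] supp[OF d] by auto
    have cd: "(c \<oplus>\<^bsub>?F\<^esub> d) s = c s \<oplus>\<^bsub>R\<^esub> d s" for s by (simp add: free_module_def)
    have "f (c \<oplus>\<^bsub>?F\<^esub> d) = (\<Oplus>\<^bsub>M\<^esub>s\<in>?T. (c \<oplus>\<^bsub>?F\<^esub> d) s \<odot>\<^bsub>M\<^esub> \<phi> s)"
      by (rule f) (use c d T in \<open>auto simp: cd\<close>)
    also have "\<dots> = (\<Oplus>\<^bsub>M\<^esub>s\<in>?T. c s \<odot>\<^bsub>M\<^esub> \<phi> s \<oplus>\<^bsub>M\<^esub> d s \<odot>\<^bsub>M\<^esub> \<phi> s)"
      by (rule M.finsum_cong') (use T(2) phi cs[OF c] cs[OF d] in \<open>auto simp: cd M.smult_l_distr\<close>)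
    also have "\<dots> = (\<Oplus>\<^bsub>M\<^esub>s\<in>?T. c s \<odot>\<^bsub>M\<^esub> \<phi> s) \<oplus>\<^bsub>M\<^esub> (\<Oplus>\<^bsub>M\<^esub>s\<in>?T. d s \<odot>\<^bsub>M\<^esub> \<phi> s)"
      by (rule M.finsum_addf) (use T(2) phi cs[OF c] cs[OF d] in auto)
    also have "\<dots> = f c \<oplus>\<^bsub>M\<^esub> f d"
      using f[OF c T(1) _ T(2)] f[OF d T(1) _ T(2)] by auto
    finally show "f (c \<oplus>\<^bsub>?F\<^esub> d) = f c \<oplus>\<^bsub>M\<^esub> f d" .
  next
    fix a c assume a: "a \<in> carrier R" and c: "c \<in> carrier ?F"
    have ac: "(a \<odot>\<^bsub>?F\<^esub> c) s = a \<otimes>\<^bsub>R\<^esub> c s" for s by (simp add: free_module_def)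
    let ?T = "{s. c s \<noteq> \<zero>\<^bsub>R\<^esub>}"
    have "f (a \<odot>\<^bsub>?F\<^esub> c) = (\<Oplus>\<^bsub>M\<^esub>s\<in>?T. (a \<odot>\<^bsub>?F\<^esub> c) s \<odot>\<^bsub>M\<^esub> \<phi> s)"
      by (rule f) (use a c supp[OF c] in \<open>auto simp: ac\<close>)
    also have "\<dots> = (\<Oplus>\<^bsub>M\<^esub>s\<in>?T. a \<odot>\<^bsub>M\<^esub> (c s \<odot>\<^bsub>M\<^esub> \<phi> s))"
      by (rule M.finsum_cong') (use a supp(2)[OF c] phi cs[OF c] in \<open>auto simp: ac M.smult_assoc1\<close>)
    also have "\<dots> = a \<odot>\<^bsub>M\<^esub> f c"
      unfolding f_def using c a supp[OF c] phi cs[OF c]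
      by (auto intro!: M.finsum_smult_ldistr[symmetric])
    finally show "f (a \<odot>\<^bsub>?F\<^esub> c) = a \<odot>\<^bsub>M\<^esub> f c" .
  qed
  moreover have "f (free_gen R s) = \<phi> s" if s: "s \<in> S" for s
  proof -
    have "f (free_gen R s) = (\<Oplus>\<^bsub>M\<^esub>t\<in>{s}. free_gen R s t \<odot>\<^bsub>M\<^esub> \<phi> t)"
      by (rule f) (use s free_gen_closed[OF R s] in \<open>auto simp: free_gen_def split: if_splits\<close>)
    then show ?thesis using phi[OF s] by (simp add: free_gen_def)
  qed
  ultimately show ?thesis by (rule that)
qed

lemma lin_hom_comp:
  assumes "f \<in> lin_hom R M N" "g \<in> lin_hom R N P" "module R M"
  shows "compose (carrier M) g f \<in> lin_hom R M P"
proof -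
  interpret M: module R M by fact
  show ?thesis
    unfolding lin_hom_def[of R M P]
    using lin_hom_closed[OF assms(1)] lin_hom_closed[OF assms(2)]
    by (auto simp: compose_def lin_hom_add[OF assms(1)] lin_hom_add[OF assms(2)]
        lin_hom_smult[OF assms(1)] lin_hom_smult[OF assms(2)])
qed

lemma projective_lifting:
  fixes P :: "('r, 'p) module" and M :: "('r, 'm) module" and N :: "('r, 'n) module"
  assumes P: "projective R P" and M: "module R M" and N: "module R N"
    and g: "g \<in> lin_hom R M N" and surj: "g ` carrier M = carrier N" and f: "f \<in> lin_hom R P N"
  shows "\<exists>h\<in>lin_hom R P M. \<forall>x\<in>carrier P. g (h x) = f x"
proof -
  have mP: "module R P" using P by (simp add: projective_def)
  interpret P: module R P by fact
  have R: "cring R" by (rule P.R.is_cring)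
  let ?F = "free_module R (carrier P)"
  have mF: "module R ?F" by (rule free_module_module[OF R])
  obtain q where q: "q \<in> lin_hom R ?F P" "\<And>x. x \<in> carrier P \<Longrightarrow> q (free_gen R x) = x"
    using free_module_ext[OF R mP, of "carrier P" "\<lambda>x. x"] by blast
  have "q ` carrier ?F = carrier P"
    using lin_hom_closed[OF q(1)] q(2) free_gen_closed[OF R] by (force simp: image_iff)
  moreover have "(\<lambda>x\<in>carrier P. x) \<in> lin_hom R P P" by (auto simp: lin_hom_def)
  ultimately obtain s where s: "s \<in> lin_hom R P ?F" "\<forall>x\<in>carrier P. q (s x) = (\<lambda>x\<in>carrier P. x) x"
    using P mF mP q(1) unfolding projective_def by blast
  define c where "c x = (SOME y. y \<in> carrier M \<and> g y = f x)" for x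
  have c: "c x \<in> carrier M \<and> g (c x) = f x" if "x \<in> carrier P" for x
  proof -
    have "f x \<in> g ` carrier M" using surj lin_hom_closed[OF f that] by simp
    then have "\<exists>y. y \<in> carrier M \<and> g y = f x" by force
    then show ?thesis unfolding c_def by (rule someI_ex)
  qed
  obtain k where k: "k \<in> lin_hom R ?F M" "\<And>x. x \<in> carrier P \<Longrightarrow> k (free_gen R x) = c x"
    using free_module_ext[OF R M, of "carrier P" c] c by blast
  have "compose (carrier ?F) g k = compose (carrier ?F) f q"
    by (rule free_module_hom_eq[OF R N lin_hom_comp[OF k(1) g mF] lin_hom_comp[OF q(1) f mF]])
      (use k(2) q(2) c free_gen_closed[OF R] in \<open>simp add: compose_def\<close>)
  then have gk: "g (k y) = f (q y)" if "y \<in> carrier ?F" for y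
    using that by (metis compose_eq)
  let ?h = "compose (carrier P) k s"
  have "?h \<in> lin_hom R P M" by (rule lin_hom_comp[OF s(1) k(1) mP])
  moreover have "\<forall>x\<in>carrier P. g (?h x) = f x"
    using gk s(2) lin_hom_closed[OF s(1)] by (simp add: compose_def)
  ultimately show ?thesis by blast
qed

lemma quot_module_facts:
  assumes M: "module R M" and N: "submodule N R M"
  shows quot_module_carrier: "\<And>X. X \<in> carrier (quot_module M N) \<longleftrightarrow> (\<exists>x\<in>carrier M. X = N +>\<^bsub>M\<^esub> x)"
    and quot_module_add: "\<And>x y. x \<in> carrier M \<Longrightarrow> y \<in> carrier M \<Longrightarrow>
      (N +>\<^bsub>M\<^esub> x) \<oplus>\<^bsub>quot_module M N\<^esub> (N +>\<^bsub>M\<^esub> y) = N +>\<^bsub>M\<^esub> (x \<oplus>\<^bsub>M\<^esub> y)"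
    and quot_module_smult: "\<And>a x. a \<in> carrier R \<Longrightarrow> x \<in> carrier M \<Longrightarrow>
      a \<odot>\<^bsub>quot_module M N\<^esub> (N +>\<^bsub>M\<^esub> x) = N +>\<^bsub>M\<^esub> (a \<odot>\<^bsub>M\<^esub> x)"
    and quot_module_zero: "\<zero>\<^bsub>quot_module M N\<^esub> = N +>\<^bsub>M\<^esub> \<zero>\<^bsub>M\<^esub>"
    and quot_module_eq: "\<And>x y. x \<in> carrier M \<Longrightarrow> y \<in> carrier M \<Longrightarrow>
      N +>\<^bsub>M\<^esub> x = N +>\<^bsub>M\<^esub> y \<longleftrightarrow> x \<ominus>\<^bsub>M\<^esub> y \<in> N"
proof -
  interpret M: module R M by fact
  have sg: "subgroup N (add_monoid M)" using N by (simp add: submodule_def)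
  have sub: "N \<subseteq> carrier M" using M.submoduleE(1)[OF N] .
  interpret N: abelian_subgroup N M
    by (rule abelian_subgroupI3) (auto simp: additive_subgroup_def sg M.abelian_group_axioms)
  show "X \<in> carrier (quot_module M N) \<longleftrightarrow> (\<exists>x\<in>carrier M. X = N +>\<^bsub>M\<^esub> x)" for X
    by (auto simp: quot_module_def A_RCOSETS_def')
  show "(N +>\<^bsub>M\<^esub> x) \<oplus>\<^bsub>quot_module M N\<^esub> (N +>\<^bsub>M\<^esub> y) = N +>\<^bsub>M\<^esub> (x \<oplus>\<^bsub>M\<^esub> y)"
    if "x \<in> carrier M" "y \<in> carrier M" for x y
    using that by (simp add: quot_module_def N.a_rcos_sum)
  show z: "\<zero>\<^bsub>quot_module M N\<^esub> = N +>\<^bsub>M\<^esub> \<zero>\<^bsub>M\<^esub>"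
    using sub by (simp add: quot_module_def)
  show eq: "N +>\<^bsub>M\<^esub> x = N +>\<^bsub>M\<^esub> y \<longleftrightarrow> x \<ominus>\<^bsub>M\<^esub> y \<in> N"
    if "x \<in> carrier M" "y \<in> carrier M" for x y
  proof
    assume "N +>\<^bsub>M\<^esub> x = N +>\<^bsub>M\<^esub> y"
    then have "x \<in> N +>\<^bsub>M\<^esub> y" using N.a_rcos_self that by metis
    then show "x \<ominus>\<^bsub>M\<^esub> y \<in> N" using that N.a_rcos_module_imp by (simp add: a_minus_def)
  next
    assume "x \<ominus>\<^bsub>M\<^esub> y \<in> N"
    then have "x \<in> N +>\<^bsub>M\<^esub> y" using that N.a_rcos_module_rev by (simp add: a_minus_def)
    then show "N +>\<^bsub>M\<^esub> x = N +>\<^bsub>M\<^esub> y" using M.a_repr_independence sg that by metis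
  qed
  show "a \<odot>\<^bsub>quot_module M N\<^esub> (N +>\<^bsub>M\<^esub> x) = N +>\<^bsub>M\<^esub> (a \<odot>\<^bsub>M\<^esub> x)"
    if a: "a \<in> carrier R" and x: "x \<in> carrier M" for a x
  proof -
    have "N +>\<^bsub>M\<^esub> (a \<odot>\<^bsub>M\<^esub> y) = N +>\<^bsub>M\<^esub> (a \<odot>\<^bsub>M\<^esub> x)" if y: "y \<in> N +>\<^bsub>M\<^esub> x" for y
    proof -
      have yM: "y \<in> carrier M" using y x sub M.a_r_coset_subset_G by blast
      have "y \<ominus>\<^bsub>M\<^esub> x \<in> N" using y N.a_rcos_module_imp x yM by (simp add: a_minus_def)
      then have "a \<odot>\<^bsub>M\<^esub> (y \<ominus>\<^bsub>M\<^esub> x) \<in> N" using M.submoduleE(4)[OF N a] by blast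
      also have "a \<odot>\<^bsub>M\<^esub> (y \<ominus>\<^bsub>M\<^esub> x) = a \<odot>\<^bsub>M\<^esub> y \<ominus>\<^bsub>M\<^esub> a \<odot>\<^bsub>M\<^esub> x"
        using a x yM by (simp add: a_minus_def M.smult_r_distr M.smult_r_minus)
      finally show ?thesis using eq a x yM by simp
    qed
    then have "(\<Union>y\<in>N +>\<^bsub>M\<^esub> x. N +>\<^bsub>M\<^esub> (a \<odot>\<^bsub>M\<^esub> y)) = (\<Union>y\<in>N +>\<^bsub>M\<^esub> x. N +>\<^bsub>M\<^esub> (a \<odot>\<^bsub>M\<^esub> x))"
      by (rule SUP_cong[OF refl])
    also have "\<dots> = N +>\<^bsub>M\<^esub> (a \<odot>\<^bsub>M\<^esub> x)" using N.a_rcos_self[OF x] by blast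
    finally show ?thesis by (simp add: quot_module_def)
  qed
qed

lemma quot_module_module:
  assumes M: "module R M" and N: "submodule N R M"
  shows "module R (quot_module M N)"
proof -
  interpret M: module R M by fact
  note [simp] = quot_module_add[OF M N] quot_module_smult[OF M N] quot_module_zero[OF M N]
  note car = quot_module_carrier[OF M N]
  show ?thesis
  proof (rule moduleI[OF M.R.is_cring])
    show "abelian_group (quot_module M N)"
    proof (rule abelian_groupI)
      fix X assume "X \<in> carrier (quot_module M N)"
      then obtain x where x: "x \<in> carrier M" "X = N +>\<^bsub>M\<^esub> x" by (auto simp: car)
      then have "(N +>\<^bsub>M\<^esub> (\<ominus>\<^bsub>M\<^esub> x)) \<oplus>\<^bsub>quot_module M N\<^esub> X = \<zero>\<^bsub>quot_module M N\<^esub>" 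
        by (simp add: M.M.l_neg)
      then show "\<exists>Y\<in>carrier (quot_module M N). Y \<oplus>\<^bsub>quot_module M N\<^esub> X = \<zero>\<^bsub>quot_module M N\<^esub>"
        using x car by blast
    next
      fix X Y assume "X \<in> carrier (quot_module M N)" "Y \<in> carrier (quot_module M N)"
      then obtain x y where "x \<in> carrier M" "X = N +>\<^bsub>M\<^esub> x" "y \<in> carrier M" "Y = N +>\<^bsub>M\<^esub> y"
        by (auto simp: car)
      then show "X \<oplus>\<^bsub>quot_module M N\<^esub> Y = Y \<oplus>\<^bsub>quot_module M N\<^esub> X" by (simp add: M.M.a_comm)
    next
      fix X Y Z
      assume "X \<in> carrier (quot_module M N)" "Y \<in> carrier (quot_module M N)"
        "Z \<in> carrier (quot_module M N)"
      then obtain x y z where "x \<in> carrier M" "X = N +>\<^bsub>M\<^esub> x" "y \<in> carrier M" "Y = N +>\<^bsub>M\<^esub> y"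
        "z \<in> carrier M" "Z = N +>\<^bsub>M\<^esub> z" by (auto simp: car)
      then show "X \<oplus>\<^bsub>quot_module M N\<^esub> Y \<oplus>\<^bsub>quot_module M N\<^esub> Z
         = X \<oplus>\<^bsub>quot_module M N\<^esub> (Y \<oplus>\<^bsub>quot_module M N\<^esub> Z)" by (simp add: M.M.a_assoc)
    next
      fix X Y assume "X \<in> carrier (quot_module M N)" "Y \<in> carrier (quot_module M N)"
      then show "X \<oplus>\<^bsub>quot_module M N\<^esub> Y \<in> carrier (quot_module M N)"
        by (force simp: car)
    next
      show "\<zero>\<^bsub>quot_module M N\<^esub> \<in> carrier (quot_module M N)"
        unfolding car by auto
    next
      fix X assume "X \<in> carrier (quot_module M N)"
      then obtain x where x: "x \<in> carrier M" "X = N +>\<^bsub>M\<^esub> x" by (auto simp: car)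
      then show "\<zero>\<^bsub>quot_module M N\<^esub> \<oplus>\<^bsub>quot_module M N\<^esub> X = X" by simp
    qed
  qed (force simp: car M.smult_l_distr M.smult_r_distr M.smult_assoc1)+
qed

lemma quot_module_proj:
  assumes M: "module R M" and N: "submodule N R M"
  shows "(\<lambda>x\<in>carrier M. N +>\<^bsub>M\<^esub> x) \<in> lin_hom R M (quot_module M N)"
proof -
  interpret M: module R M by fact
  show ?thesis unfolding lin_hom_def
    by (auto simp: quot_module_carrier[OF M N] quot_module_add[OF M N] quot_module_smult[OF M N])
qed

lemma quot_module_factor:
  assumes M: "module R M" and N: "submodule N R M" and P: "module R P"
    and f: "f \<in> lin_hom R M P" and z: "\<And>x. x \<in> N \<Longrightarrow> f x = \<zero>\<^bsub>P\<^esub>"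
  obtains g where "g \<in> lin_hom R (quot_module M N) P" "\<And>x. x \<in> carrier M \<Longrightarrow> g (N +>\<^bsub>M\<^esub> x) = f x"
proof -
  interpret M: module R M by fact
  interpret P: module R P by fact
  note [simp] = quot_module_add[OF M N] quot_module_smult[OF M N] quot_module_zero[OF M N]
  note car = quot_module_carrier[OF M N]
  define g where "g = (\<lambda>X\<in>carrier (quot_module M N). f (SOME x. x \<in> carrier M \<and> X = N +>\<^bsub>M\<^esub> x))"
  have g: "g (N +>\<^bsub>M\<^esub> x) = f x" if x: "x \<in> carrier M" for x
  proof -
    define y where "y = (SOME y. y \<in> carrier M \<and> N +>\<^bsub>M\<^esub> x = N +>\<^bsub>M\<^esub> y)"
    have y: "y \<in> carrier M \<and> N +>\<^bsub>M\<^esub> x = N +>\<^bsub>M\<^esub> y"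
      unfolding y_def by (rule someI[of _ x]) (use x in auto)
    then have "f (x \<ominus>\<^bsub>M\<^esub> y) = \<zero>\<^bsub>P\<^esub>" using z quot_module_eq[OF M N x] by blast
    then have "f x \<ominus>\<^bsub>P\<^esub> f y = \<zero>\<^bsub>P\<^esub>" using lin_hom_minus[OF f M P x] y by simp
    then have "f x = f y" 
      using lin_hom_closed[OF f] x y P.M.minus_equality[of "f x" "\<ominus>\<^bsub>P\<^esub> f y"]
      by (simp add: a_minus_def)
    moreover have "g (N +>\<^bsub>M\<^esub> x) = f y"
      unfolding g_def y_def using x car by auto
    ultimately show ?thesis by simp
  qed
  have "g \<in> lin_hom R (quot_module M N) P"
    unfolding lin_hom_def
  proof (intro CollectI conjI ballI)
    show "g \<in> carrier (quot_module M N) \<rightarrow>\<^sub>E carrier P"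
    proof (rule PiE_I)
      fix X assume "X \<in> carrier (quot_module M N)"
      then show "g X \<in> carrier P" using g lin_hom_closed[OF f] by (auto simp: car)
    qed (simp add: g_def)
  qed (auto simp: car g lin_hom_add[OF f] lin_hom_smult[OF f])
  with g that show ?thesis by blast
qed


section \<open>Graded modules and dgmodules\<close>

text \<open>A graded module is a family \<open>V :: int \<Rightarrow> _ module\<close>.\<close>

definition graded_module :: "('r, 'z) ring_scheme \<Rightarrow> (int \<Rightarrow> ('r, 'v) module) \<Rightarrow> bool" where
  "graded_module R V \<longleftrightarrow> (\<forall>i. module R (V i))"

definition graded_projective :: "('r, 'z) ring_scheme \<Rightarrow> (int \<Rightarrow> ('r, 'v) module) \<Rightarrow> bool" where
  "graded_projective R V \<longleftrightarrow> (\<forall>i. projective R (V i))"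

definition graded_hom ::
  "('r, 'z) ring_scheme \<Rightarrow> (int \<Rightarrow> ('r, 'c) module) \<Rightarrow> (int \<Rightarrow> ('r, 'd) module) \<Rightarrow> int \<Rightarrow>
   ('r, int \<Rightarrow> 'c \<Rightarrow> 'd) module" where
  "graded_hom R C D i =
     \<lparr>carrier = {f. \<forall>n. f n \<in> lin_hom R (C n) (D (n + i))},
      mult = undefined, one = undefined,
      zero = (\<lambda>n. \<lambda>x\<in>carrier (C n). \<zero>\<^bsub>D (n + i)\<^esub>),
      add = (\<lambda>f g n. \<lambda>x\<in>carrier (C n). f n x \<oplus>\<^bsub>D (n + i)\<^esub> g n x),
      smult = (\<lambda>a f n. \<lambda>x\<in>carrier (C n). a \<odot>\<^bsub>D (n + i)\<^esub> f n x)\<rparr>"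

text \<open>The composite of \<open>g\<close>, homogeneous of degree \<open>j\<close> with source \<open>C\<close>, and \<open>f\<close>.\<close>

definition graded_comp ::
  "(int \<Rightarrow> ('r, 'c) module) \<Rightarrow> (int \<Rightarrow> 'd \<Rightarrow> 'e) \<Rightarrow> int \<Rightarrow> (int \<Rightarrow> 'c \<Rightarrow> 'd) \<Rightarrow> int \<Rightarrow> 'c \<Rightarrow> 'e" where
  "graded_comp C f j g = (\<lambda>n. compose (carrier (C n)) (f (n + j)) (g n))"

definition dgmodule ::
  "('r, 'z) ring_scheme \<Rightarrow> (int \<Rightarrow> ('r, 'v) module) \<Rightarrow> (int \<Rightarrow> 'v \<Rightarrow> 'v) \<Rightarrow> bool" where
  "dgmodule R C \<delta> \<longleftrightarrow> graded_module R C \<and> \<delta> \<in> carrier (graded_hom R C C (-1)) \<and>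
     graded_comp C \<delta> (-1) \<delta> = \<zero>\<^bsub>graded_hom R C C (-2)\<^esub>"

definition cycles ::
  "(int \<Rightarrow> ('r, 'v) module) \<Rightarrow> (int \<Rightarrow> 'v \<Rightarrow> 'v) \<Rightarrow> int \<Rightarrow> ('r, 'v) module" where
  "cycles C \<delta> i = (C i)\<lparr>carrier := {x \<in> carrier (C i). \<delta> i x = \<zero>\<^bsub>C (i - 1)\<^esub>}\<rparr>"

definition boundaries ::
  "(int \<Rightarrow> ('r, 'v) module) \<Rightarrow> (int \<Rightarrow> 'v \<Rightarrow> 'v) \<Rightarrow> int \<Rightarrow> 'v set" where
  "boundaries C \<delta> i = \<delta> (i + 1) ` carrier (C (i + 1))"

definition homology ::
  "(int \<Rightarrow> ('r, 'v) module) \<Rightarrow> (int \<Rightarrow> 'v \<Rightarrow> 'v) \<Rightarrow> int \<Rightarrow> ('r, 'v set) module" where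
  "homology C \<delta> i = quot_module (cycles C \<delta> i) (boundaries C \<delta> i)"

definition hclass ::
  "(int \<Rightarrow> ('r, 'v) module) \<Rightarrow> (int \<Rightarrow> 'v \<Rightarrow> 'v) \<Rightarrow> int \<Rightarrow> 'v \<Rightarrow> 'v set" where
  "hclass C \<delta> i z = boundaries C \<delta> i +>\<^bsub>cycles C \<delta> i\<^esub> z"

text \<open>The differential of \<open>Hom(C, D)\<close> on elements of degree \<open>i\<close>.\<close>

definition hom_diff ::
  "('r, 'z) ring_scheme \<Rightarrow> (int \<Rightarrow> ('r, 'c) module) \<Rightarrow> (int \<Rightarrow> 'c \<Rightarrow> 'c) \<Rightarrow>
   (int \<Rightarrow> ('r, 'd) module) \<Rightarrow> (int \<Rightarrow> 'd \<Rightarrow> 'd) \<Rightarrow> int \<Rightarrow> (int \<Rightarrow> 'c \<Rightarrow> 'd) \<Rightarrow> int \<Rightarrow> 'c \<Rightarrow> 'd" where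
  "hom_diff R C \<delta>C D \<delta>D i f =
     graded_comp C \<delta>D i f \<ominus>\<^bsub>graded_hom R C D (i - 1)\<^esub>
     ksign (graded_hom R C D (i - 1)) i (graded_comp C f (-1) \<delta>C)"


section \<open>Tensor powers\<close>

text \<open>
  The degree \<open>d\<close> part of the \<open>n\<close>-fold tensor power of \<open>V\<close> is the direct sum of the modules
  \<open>V\<^bsub>i1\<^esub> \<otimes> \<dots> \<otimes> V\<^bsub>in\<^esub>\<close> over all \<open>i1 + \<dots> + in = d\<close>.  It is constructed as the free module on all
  words \<open>[(i1, x1), \<dots>, (in, xn)]\<close> of length \<open>n\<close> and total degree \<open>d\<close> with \<open>xk\<close> in \<open>V\<^bsub>ik\<^esub>\<close>, modulo
  multilinearity.  The relations only relate words with the same sequence of degrees, so the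
  quotient decomposes as the direct sum above.
\<close>

type_synonym 'v word = "(int \<times> 'v) list"
type_synonym ('r, 'v) tensor = "('v word \<Rightarrow> 'r) set"
type_synonym ('r, 'v) cochain = "int \<Rightarrow> ('r, 'v) tensor \<Rightarrow> 'v"

definition wdeg :: "'v word \<Rightarrow> int" where
  "wdeg xs = sum_list (map fst xs)"

definition words :: "(int \<Rightarrow> ('r, 'v) module) \<Rightarrow> nat \<Rightarrow> 'v word set" where
  "words V n = {xs. length xs = n \<and> (\<forall>(p, x)\<in>set xs. x \<in> carrier (V p))}"

definition words_deg :: "(int \<Rightarrow> ('r, 'v) module) \<Rightarrow> nat \<Rightarrow> int \<Rightarrow> 'v word set" where
  "words_deg V n d = {xs \<in> words V n. wdeg xs = d}"

definition tensor_relations ::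
  "('r, 'z) ring_scheme \<Rightarrow> (int \<Rightarrow> ('r, 'v) module) \<Rightarrow> nat \<Rightarrow> int \<Rightarrow> ('v word \<Rightarrow> 'r) set" where
  "tensor_relations R V n d =
     (let F = free_module R (words_deg V n d); e = free_gen R in
      generated_submodule R F
       ({e (us @ (p, x \<oplus>\<^bsub>V p\<^esub> y) # vs) \<ominus>\<^bsub>F\<^esub> (e (us @ (p, x) # vs) \<oplus>\<^bsub>F\<^esub> e (us @ (p, y) # vs))
           | us p x y vs. us @ (p, x) # vs \<in> words_deg V n d \<and> y \<in> carrier (V p)} \<union>
        {e (us @ (p, a \<odot>\<^bsub>V p\<^esub> x) # vs) \<ominus>\<^bsub>F\<^esub> a \<odot>\<^bsub>F\<^esub> e (us @ (p, x) # vs)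
           | us p a x vs. us @ (p, x) # vs \<in> words_deg V n d \<and> a \<in> carrier R}))"

definition tensor_power ::
  "('r, 'z) ring_scheme \<Rightarrow> (int \<Rightarrow> ('r, 'v) module) \<Rightarrow> nat \<Rightarrow> int \<Rightarrow> ('r, ('r, 'v) tensor) module"
  where
  "tensor_power R V n d =
     quot_module (free_module R (words_deg V n d)) (tensor_relations R V n d)"

text \<open>The element \<open>x1 \<otimes> \<dots> \<otimes> xn\<close>, of degree \<open>wdeg xs\<close>.\<close>

definition pure_tensor ::
  "('r, 'z) ring_scheme \<Rightarrow> (int \<Rightarrow> ('r, 'v) module) \<Rightarrow> 'v word \<Rightarrow> ('r, 'v) tensor" where
  "pure_tensor R V xs =
     tensor_relations R V (length xs) (wdeg xs)
       +>\<^bsub>free_module R (words_deg V (length xs) (wdeg xs))\<^esub> free_gen R xs"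

definition multilinear ::
  "('r, 'z) ring_scheme \<Rightarrow> (int \<Rightarrow> ('r, 'v) module) \<Rightarrow> nat \<Rightarrow> (int \<Rightarrow> ('r, 'w) module) \<Rightarrow> int \<Rightarrow>
   ('v word \<Rightarrow> 'w) \<Rightarrow> bool" where
  "multilinear R V n W j \<phi> \<longleftrightarrow>
     (\<forall>xs\<in>words V n. \<phi> xs \<in> carrier (W (wdeg xs + j))) \<and>
     (\<forall>us p x y vs. us @ (p, x) # vs \<in> words V n \<and> y \<in> carrier (V p) \<longrightarrow>
        \<phi> (us @ (p, x \<oplus>\<^bsub>V p\<^esub> y) # vs) =
        \<phi> (us @ (p, x) # vs) \<oplus>\<^bsub>W (wdeg (us @ (p, x) # vs) + j)\<^esub> \<phi> (us @ (p, y) # vs)) \<and>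
     (\<forall>us p a x vs. us @ (p, x) # vs \<in> words V n \<and> a \<in> carrier R \<longrightarrow>
        \<phi> (us @ (p, a \<odot>\<^bsub>V p\<^esub> x) # vs) =
        a \<odot>\<^bsub>W (wdeg (us @ (p, x) # vs) + j)\<^esub> \<phi> (us @ (p, x) # vs))"

lemma tensor_relations_submodule:
  assumes R: "cring R" and V: "graded_module R V"
  shows "submodule (tensor_relations R V n d) R (free_module R (words_deg V n d))"
proof -
  let ?S = "words_deg V n d"
  let ?F = "free_module R ?S"
  interpret F: module R ?F by (rule free_module_module[OF R])
  have g: "free_gen R s \<in> carrier ?F" if "s \<in> ?S" for s by (rule free_gen_closed[OF R that])
  have w: "us @ (p, x') # vs \<in> ?S" 
    if "us @ (p, x) # vs \<in> ?S" "x' \<in> carrier (V p)" for us p x x' vs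
    using that by (auto simp: words_deg_def words_def wdeg_def)
  have mV: "module R (V p)" for p using V by (simp add: graded_module_def)
  have xp: "x \<in> carrier (V p)" if "us @ (p, x) # vs \<in> ?S" for us p x vs
    using that by (auto simp: words_deg_def words_def)
  have add: "x \<oplus>\<^bsub>V p\<^esub> y \<in> carrier (V p)" if "x \<in> carrier (V p)" "y \<in> carrier (V p)" for p x y
    using that abelian_monoid.a_closed[OF abelian_group.axioms(1)[OF module.axioms(2)[OF mV]]] by blast
  have sm: "a \<odot>\<^bsub>V p\<^esub> x \<in> carrier (V p)" if "a \<in> carrier R" "x \<in> carrier (V p)" for p x a
    using that module.smult_closed[OF mV] by blast
  show ?thesis
    unfolding tensor_relations_def Let_def
    by (rule generated_submodule_submodule[OF F.module_axioms])
      (auto intro!: F.M.minus_closed F.M.a_closed F.smult_closed g intro: w add sm xp)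
qed

lemma tensor_power_module:
  assumes "cring R" "graded_module R V"
  shows "module R (tensor_power R V n d)"
  unfolding tensor_power_def
  by (rule quot_module_module[OF free_module_module[OF assms(1)] tensor_relations_submodule[OF assms]])

lemma pure_tensor_closed:
  assumes "cring R" "graded_module R V" "xs \<in> words V n"
  shows "pure_tensor R V xs \<in> carrier (tensor_power R V n (wdeg xs))"
proof -
  have n: "length xs = n" "xs \<in> words_deg V n (wdeg xs)"
    using assms(3) by (auto simp: words_def words_deg_def)
  show ?thesis
    using free_gen_closed[OF assms(1) n(2)] n(1)
    unfolding tensor_power_def pure_tensor_def
      quot_module_carrier[OF free_module_module[OF assms(1)] tensor_relations_submodule[OF assms(1,2)]]
    by blast
qed

lemma tensor_hom_eq:
  assumes R: "cring R" and V: "graded_module R V" and W: "graded_module R W"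
    and f: "f \<in> carrier (graded_hom R (tensor_power R V n) W j)"
    and g: "g \<in> carrier (graded_hom R (tensor_power R V n) W j)"
    and eq: "\<And>xs. xs \<in> words V n \<Longrightarrow> f (wdeg xs) (pure_tensor R V xs) = g (wdeg xs) (pure_tensor R V xs)"
  shows "f = g"
proof
  fix d
  let ?S = "words_deg V n d"
  let ?F = "free_module R ?S"
  let ?N = "tensor_relations R V n d"
  have mF: "module R ?F" by (rule free_module_module[OF R])
  note N = tensor_relations_submodule[OF R V, of n d]
  have mW: "module R (W (d + j))" using W by (simp add: graded_module_def)
  have fd: "f d \<in> lin_hom R (quot_module ?F ?N) (W (d + j))" and gd: "g d \<in> lin_hom R (quot_module ?F ?N) (W (d + j))"
    using f g by (auto simp: graded_hom_def tensor_power_def)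
  note pr = quot_module_proj[OF mF N]
  have "compose (carrier ?F) (f d) (\<lambda>x\<in>carrier ?F. ?N +>\<^bsub>?F\<^esub> x) = compose (carrier ?F) (g d) (\<lambda>x\<in>carrier ?F. ?N +>\<^bsub>?F\<^esub> x)"
  proof (rule free_module_hom_eq[OF R mW lin_hom_comp[OF pr fd mF] lin_hom_comp[OF pr gd mF]])
    fix xs assume xs: "xs \<in> ?S"
    then have "xs \<in> words V n" "wdeg xs = d" "length xs = n" by (auto simp: words_deg_def words_def)
    then show "compose (carrier ?F) (f d) (\<lambda>x\<in>carrier ?F. ?N +>\<^bsub>?F\<^esub> x) (free_gen R xs) = 
        compose (carrier ?F) (g d) (\<lambda>x\<in>carrier ?F. ?N +>\<^bsub>?F\<^esub> x) (free_gen R xs)"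
      using eq[of xs] free_gen_closed[OF R xs] by (simp add: compose_def pure_tensor_def)
  qed
  then have "f d (?N +>\<^bsub>?F\<^esub> c) = g d (?N +>\<^bsub>?F\<^esub> c)" if "c \<in> carrier ?F" for c
    using that by (auto simp: compose_def fun_eq_iff split: if_splits)
  then show "f d = g d"
    by (intro lin_hom_ext[OF fd gd]) (auto simp: quot_module_carrier[OF mF N])
qed

lemma tensor_universal:
  assumes R: "cring R" and V: "graded_module R V" and W: "graded_module R W"
    and phi: "multilinear R V n W j \<phi>"
  shows "\<exists>!h. h \<in> carrier (graded_hom R (tensor_power R V n) W j) \<and>
              (\<forall>xs\<in>words V n. h (wdeg xs) (pure_tensor R V xs) = \<phi> xs)"
proof -
  have ex: "\<exists>h\<in>lin_hom R (tensor_power R V n d) (W (d + j)).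
     \<forall>xs\<in>words_deg V n d. h (pure_tensor R V xs) = \<phi> xs" for d
  proof -
    let ?S = "words_deg V n d"
    let ?F = "free_module R ?S"
    let ?W = "W (d + j)"
    have mF: "module R ?F" by (rule free_module_module[OF R])
    interpret F: module R ?F by fact
    note N = tensor_relations_submodule[OF R V, of n d]
    have mW: "module R ?W" using W by (simp add: graded_module_def)
    interpret W: module R ?W by fact
    have phiW: "\<phi> xs \<in> carrier ?W" if "xs \<in> ?S" for xs
      using that phi by (auto simp: words_deg_def multilinear_def)
    obtain f where f: "f \<in> lin_hom R ?F ?W" "\<And>s. s \<in> ?S \<Longrightarrow> f (free_gen R s) = \<phi> s"
      using free_module_ext[OF R mW, of ?S \<phi>] phiW by blast
    let ?K = "{c \<in> carrier ?F. f c = \<zero>\<^bsub>?W\<^esub>}"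
    have K: "submodule ?K R ?F"
    proof (rule F.submoduleI)
      fix a assume a: "a \<in> ?K"
      have "f (\<zero>\<^bsub>?F\<^esub> \<ominus>\<^bsub>?F\<^esub> a) = \<zero>\<^bsub>?W\<^esub>"
        using lin_hom_minus[OF f(1) mF mW F.M.zero_closed, of a] a lin_hom_zero[OF f(1) mF mW]
        by (simp add: W.M.r_neg a_minus_def)
      then show "\<ominus>\<^bsub>?F\<^esub> a \<in> ?K" using a by (simp add: a_minus_def)
    qed (auto simp: lin_hom_zero[OF f(1) mF mW] lin_hom_add[OF f(1)] lin_hom_smult[OF f(1)])
    have g: "free_gen R s \<in> carrier ?F" if "s \<in> ?S" for s by (rule free_gen_closed[OF R that])
    have w: "us @ (p, x') # vs \<in> ?S" 
      if "us @ (p, x) # vs \<in> ?S" "x' \<in> carrier (V p)" for us p x x' vs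
      using that by (auto simp: words_deg_def words_def wdeg_def)
    have mV: "module R (V p)" for p using V by (simp add: graded_module_def)
    have xp: "x \<in> carrier (V p)" if "us @ (p, x) # vs \<in> ?S" for us p x vs
      using that by (auto simp: words_deg_def words_def)
    have add: "x \<oplus>\<^bsub>V p\<^esub> y \<in> carrier (V p)" if "x \<in> carrier (V p)" "y \<in> carrier (V p)" for p x y
      using that abelian_monoid.a_closed[OF abelian_group.axioms(1)[OF module.axioms(2)[OF mV]]] by blast
    have sm: "a \<odot>\<^bsub>V p\<^esub> x \<in> carrier (V p)" if "a \<in> carrier R" "x \<in> carrier (V p)" for p x a
      using that module.smult_closed[OF mV] by blast
    have r0: "z \<ominus>\<^bsub>?W\<^esub> z = \<zero>\<^bsub>?W\<^esub>" if "z \<in> carrier ?W" for z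
      using that by (simp add: a_minus_def W.M.r_neg)
    have k1: "free_gen R (us @ (p, x \<oplus>\<^bsub>V p\<^esub> y) # vs) \<ominus>\<^bsub>?F\<^esub>
         (free_gen R (us @ (p, x) # vs) \<oplus>\<^bsub>?F\<^esub> free_gen R (us @ (p, y) # vs)) \<in> ?K"
      if *: "us @ (p, x) # vs \<in> ?S" and y: "y \<in> carrier (V p)" for us p x y vs
    proof -
      note wx = *
      note wy = w[OF * y]
      note wxy = w[OF * add[OF xp[OF *] y]]
      have "\<phi> (us @ (p, x \<oplus>\<^bsub>V p\<^esub> y) # vs) = \<phi> (us @ (p, x) # vs) \<oplus>\<^bsub>?W\<^esub> \<phi> (us @ (p, y) # vs)"
        using phi * y unfolding multilinear_def words_deg_def by blast
      then show ?thesis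
        using g[OF wx] g[OF wy] g[OF wxy] phiW[OF wx] phiW[OF wy]
        by (simp add: lin_hom_minus[OF f(1) mF mW] lin_hom_add[OF f(1)] f(2) wx wy wxy
            r0 F.M.minus_closed)
    qed
    have k2: "free_gen R (us @ (p, a \<odot>\<^bsub>V p\<^esub> x) # vs) \<ominus>\<^bsub>?F\<^esub> a \<odot>\<^bsub>?F\<^esub> free_gen R (us @ (p, x) # vs) \<in> ?K"
      if *: "us @ (p, x) # vs \<in> ?S" and a: "a \<in> carrier R" for us p x a vs
    proof -
      note wx = *
      note wa = w[OF * sm[OF a xp[OF *]]]
      have "\<phi> (us @ (p, a \<odot>\<^bsub>V p\<^esub> x) # vs) = a \<odot>\<^bsub>?W\<^esub> \<phi> (us @ (p, x) # vs)"
        using phi * a unfolding multilinear_def words_deg_def by blast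
      then show ?thesis
        using g[OF wx] g[OF wa] phiW[OF wx] a
        by (simp add: lin_hom_minus[OF f(1) mF mW] lin_hom_smult[OF f(1)] f(2) wx wa
            r0 F.M.minus_closed)
    qed
    have "tensor_relations R V n d \<subseteq> ?K"
      unfolding tensor_relations_def Let_def
      by (rule generated_submodule_le[OF K]) (use k1 k2 in blast)
    then obtain h where "h \<in> lin_hom R (quot_module ?F (tensor_relations R V n d)) ?W"
      "\<And>c. c \<in> carrier ?F \<Longrightarrow> h (tensor_relations R V n d +>\<^bsub>?F\<^esub> c) = f c"
      using quot_module_factor[OF mF N mW f(1)] by blast
    then show ?thesis using g f(2)
      by (intro bexI[of _ h]) (auto simp: pure_tensor_def tensor_power_def words_deg_def words_def)
  qed
  then obtain h where h: "\<And>d. h d \<in> lin_hom R (tensor_power R V n d) (W (d + j))"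
     "\<And>d xs. xs \<in> words_deg V n d \<Longrightarrow> h d (pure_tensor R V xs) = \<phi> xs"
    by metis
  show ?thesis
  proof (rule ex1I[of _ h])
    show "h \<in> carrier (graded_hom R (tensor_power R V n) W j) \<and>
              (\<forall>xs\<in>words V n. h (wdeg xs) (pure_tensor R V xs) = \<phi> xs)"
      using h by (auto simp: graded_hom_def words_deg_def)
    then show "\<And>k. k \<in> carrier (graded_hom R (tensor_power R V n) W j) \<and>
              (\<forall>xs\<in>words V n. k (wdeg xs) (pure_tensor R V xs) = \<phi> xs) \<Longrightarrow> k = h"
      by (intro tensor_hom_eq[OF R V W]) auto
  qed
qed

text \<open>
  The linear map of degree \<open>j\<close> on the tensor power with prescribed values on pure tensors; by
  lemma \<open>tensor_universal\<close> it exists and is unique if \<open>\<phi>\<close> is multilinear.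
\<close>

definition tensor_lift ::
  "('r, 'z) ring_scheme \<Rightarrow> (int \<Rightarrow> ('r, 'v) module) \<Rightarrow> nat \<Rightarrow> (int \<Rightarrow> ('r, 'w) module) \<Rightarrow> int \<Rightarrow>
   ('v word \<Rightarrow> 'w) \<Rightarrow> int \<Rightarrow> ('r, 'v) tensor \<Rightarrow> 'w" where
  "tensor_lift R V n W j \<phi> =
     (THE h. h \<in> carrier (graded_hom R (tensor_power R V n) W j) \<and>
             (\<forall>xs\<in>words V n. h (wdeg xs) (pure_tensor R V xs) = \<phi> xs))"

definition tensor_diff ::
  "('r, 'z) ring_scheme \<Rightarrow> (int \<Rightarrow> ('r, 'v) module) \<Rightarrow> (int \<Rightarrow> 'v \<Rightarrow> 'v) \<Rightarrow> nat \<Rightarrow>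
   int \<Rightarrow> ('r, 'v) tensor \<Rightarrow> ('r, 'v) tensor" where
  "tensor_diff R V \<delta> n =
     tensor_lift R V n (tensor_power R V n) (-1)
       (\<lambda>xs. let T = tensor_power R V n (wdeg xs - 1) in
         \<Oplus>\<^bsub>T\<^esub>k\<in>{..<n}.
           ksign T (wdeg (take k xs))
             (pure_tensor R V (xs[k := (fst (xs ! k) - 1, \<delta> (fst (xs ! k)) (snd (xs ! k)))])))"


section \<open>The endomorphism modules and the pre-Lie product\<close>

definition End_mod ::
  "('r, 'z) ring_scheme \<Rightarrow> (int \<Rightarrow> ('r, 'v) module) \<Rightarrow> nat \<Rightarrow> int \<Rightarrow> ('r, ('r, 'v) cochain) module"
  where
  "End_mod R V n i = graded_hom R (tensor_power R V n) V i"

definition End_diff ::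
  "('r, 'z) ring_scheme \<Rightarrow> (int \<Rightarrow> ('r, 'v) module) \<Rightarrow> (int \<Rightarrow> 'v \<Rightarrow> 'v) \<Rightarrow> nat \<Rightarrow> int \<Rightarrow>
   ('r, 'v) cochain \<Rightarrow> ('r, 'v) cochain" where
  "End_diff R V \<delta> n i f = hom_diff R (tensor_power R V n) (tensor_diff R V \<delta> n) V \<delta> i f"

text \<open>
  For \<open>g\<close> of arity \<open>m\<close> and degree \<open>j\<close> and for \<open>1 \<le> k \<le> n\<close>, the map
  \<open>id\<^sup>\<otimes>\<^sup>k\<^sup>-\<^sup>1 \<otimes> g \<otimes> id\<^sup>\<otimes>\<^sup>n\<^sup>-\<^sup>k\<close> from the tensor power \<open>n + m - 1\<close> to the tensor power \<open>n\<close>.  The sign is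
  the Koszul sign for moving \<open>g\<close> past the first \<open>k - 1\<close> factors \<open>us\<close>.
\<close>

definition tensor_insert ::
  "('r, 'z) ring_scheme \<Rightarrow> (int \<Rightarrow> ('r, 'v) module) \<Rightarrow> nat \<Rightarrow> nat \<Rightarrow> int \<Rightarrow> nat \<Rightarrow>
   ('r, 'v) cochain \<Rightarrow> int \<Rightarrow> ('r, 'v) tensor \<Rightarrow> ('r, 'v) tensor" where
  "tensor_insert R V n m j k g =
     tensor_lift R V (n + m - 1) (tensor_power R V n) j
       (\<lambda>xs. let us = take (k - 1) xs; ys = take m (drop (k - 1) xs); vs = drop (k - 1 + m) xs in
         ksign (tensor_power R V n (wdeg xs + j)) (wdeg us * j)
           (pure_tensor R V
             (us @ (wdeg ys + j, g (wdeg ys) (pure_tensor R V ys)) # vs)))"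

definition weight :: "nat \<Rightarrow> int \<Rightarrow> int" where
  "weight n i = i + int n - 1"

text \<open>
  Arity and degree of a cochain are not recoverable from the function, so \<open>circ R V n i m j f g\<close> and
  \<open>bracket R V n i m j f g\<close> take them as arguments, for \<open>f\<close> of arity \<open>n\<close> and degree \<open>i\<close> and \<open>g\<close> of
  arity \<open>m\<close> and degree \<open>j\<close>.
\<close>

definition circ ::
  "('r, 'z) ring_scheme \<Rightarrow> (int \<Rightarrow> ('r, 'v) module) \<Rightarrow> nat \<Rightarrow> int \<Rightarrow> nat \<Rightarrow> int \<Rightarrow>
   ('r, 'v) cochain \<Rightarrow> ('r, 'v) cochain \<Rightarrow> ('r, 'v) cochain" where
  "circ R V n i m j f g =
     (let E = End_mod R V (n + m - 1) (i + j) in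
      ksign E (weight m j * (int n - 1))
        (\<Oplus>\<^bsub>E\<^esub>k\<in>{1..n}.
           ksign E ((int m - 1) * (int k - 1))
             (graded_comp (tensor_power R V (n + m - 1)) f j (tensor_insert R V n m j k g))))"

definition bracket ::
  "('r, 'z) ring_scheme \<Rightarrow> (int \<Rightarrow> ('r, 'v) module) \<Rightarrow> nat \<Rightarrow> int \<Rightarrow> nat \<Rightarrow> int \<Rightarrow>
   ('r, 'v) cochain \<Rightarrow> ('r, 'v) cochain \<Rightarrow> ('r, 'v) cochain" where
  "bracket R V n i m j f g =
     (let E = End_mod R V (n + m - 1) (i + j) in
      circ R V n i m j f g \<ominus>\<^bsub>E\<^esub>
      ksign E (weight n i * weight m j) (circ R V m j n i g f))"


section \<open>Truncated A-infinity structures\<close>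

definition A_structure ::
  "('r, 'z) ring_scheme \<Rightarrow> (int \<Rightarrow> ('r, 'v) module) \<Rightarrow> nat \<Rightarrow> (nat \<Rightarrow> ('r, 'v) cochain) \<Rightarrow> bool"
  where
  "A_structure R V r m \<longleftrightarrow>
     (\<forall>i\<in>{1..r}. m i \<in> carrier (End_mod R V i (int i - 2))) \<and>
     (\<forall>n\<in>{1..r}.
        (\<Oplus>\<^bsub>End_mod R V n (int n - 3)\<^esub>i\<in>{1..n}.
           circ R V i (int i - 2) (n + 1 - i) (int (n + 1 - i) - 2) (m i) (m (n + 1 - i)))
        = \<zero>\<^bsub>End_mod R V n (int n - 3)\<^esub>)"

text \<open>
  An \<open>A\<^sub>r\<close>-structure on the dgmodule \<open>(A, \<delta>)\<close>: the operation \<open>m\<^sub>1\<close> is \<open>\<delta>\<close>, under the identification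
  of \<open>A\<close> with its first tensor power.
\<close>

definition dg_A_structure ::
  "('r, 'z) ring_scheme \<Rightarrow> (int \<Rightarrow> ('r, 'v) module) \<Rightarrow> (int \<Rightarrow> 'v \<Rightarrow> 'v) \<Rightarrow> nat \<Rightarrow>
   (nat \<Rightarrow> ('r, 'v) cochain) \<Rightarrow> bool" where
  "dg_A_structure R A \<delta> r m \<longleftrightarrow> A_structure R A r m \<and>
     (\<forall>p. \<forall>x\<in>carrier (A p). m 1 p (pure_tensor R A [(p, x)]) = \<delta> p x)"

text \<open>The map induced on homology by a cocycle \<open>f\<close> of arity \<open>n\<close> and degree \<open>i\<close>.\<close>

definition induced ::
  "('r, 'z) ring_scheme \<Rightarrow> (int \<Rightarrow> ('r, 'v) module) \<Rightarrow> (int \<Rightarrow> 'v \<Rightarrow> 'v) \<Rightarrow> nat \<Rightarrow> int \<Rightarrow>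
   ('r, 'v) cochain \<Rightarrow> ('r, 'v set) cochain" where
  "induced R A \<delta> n i f =
     (THE h. h \<in> carrier (End_mod R (homology A \<delta>) n i) \<and>
        (\<forall>zs\<in>words (cycles A \<delta>) n.
           h (wdeg zs) (pure_tensor R (homology A \<delta>) (map (\<lambda>(p, z). (p, hclass A \<delta> p z)) zs)) =
           hclass A \<delta> (wdeg zs + i) (f (wdeg zs) (pure_tensor R A zs))))"


section \<open>Hochschild cohomology\<close>

definition graded_assoc_algebra ::
  "('r, 'z) ring_scheme \<Rightarrow> (int \<Rightarrow> ('r, 'v) module) \<Rightarrow> ('r, 'v) cochain \<Rightarrow> bool" where
  "graded_assoc_algebra R B \<mu> \<longleftrightarrow> graded_module R B \<and> \<mu> \<in> carrier (End_mod R B 2 0) \<and>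
     circ R B 2 0 2 0 \<mu> \<mu> = \<zero>\<^bsub>End_mod R B 3 0\<^esub>"

definition HH_diff ::
  "('r, 'z) ring_scheme \<Rightarrow> (int \<Rightarrow> ('r, 'v) module) \<Rightarrow> ('r, 'v) cochain \<Rightarrow> nat \<Rightarrow> int \<Rightarrow>
   ('r, 'v) cochain \<Rightarrow> ('r, 'v) cochain" where
  "HH_diff R B \<mu> n i f = bracket R B 2 0 n i \<mu> f"

definition HH_cocycles ::
  "('r, 'z) ring_scheme \<Rightarrow> (int \<Rightarrow> ('r, 'v) module) \<Rightarrow> ('r, 'v) cochain \<Rightarrow> nat \<Rightarrow> int \<Rightarrow>
   ('r, ('r, 'v) cochain) module" where
  "HH_cocycles R B \<mu> n i = (End_mod R B n i)
     \<lparr>carrier := {f \<in> carrier (End_mod R B n i).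
                    HH_diff R B \<mu> n i f = \<zero>\<^bsub>End_mod R B (n + 1) i\<^esub>}\<rparr>"

definition HH_coboundaries ::
  "('r, 'z) ring_scheme \<Rightarrow> (int \<Rightarrow> ('r, 'v) module) \<Rightarrow> ('r, 'v) cochain \<Rightarrow> nat \<Rightarrow> int \<Rightarrow>
   ('r, 'v) cochain set" where
  "HH_coboundaries R B \<mu> n i =
     (if n = 0 then {\<zero>\<^bsub>End_mod R B n i\<^esub>}
      else HH_diff R B \<mu> (n - 1) i ` carrier (End_mod R B (n - 1) i))"

definition HH ::
  "('r, 'z) ring_scheme \<Rightarrow> (int \<Rightarrow> ('r, 'v) module) \<Rightarrow> ('r, 'v) cochain \<Rightarrow> nat \<Rightarrow> int \<Rightarrow>
   ('r, ('r, 'v) cochain set) module" where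
  "HH R B \<mu> n i = quot_module (HH_cocycles R B \<mu> n i) (HH_coboundaries R B \<mu> n i)"

definition HH_class ::
  "('r, 'z) ring_scheme \<Rightarrow> (int \<Rightarrow> ('r, 'v) module) \<Rightarrow> ('r, 'v) cochain \<Rightarrow> nat \<Rightarrow> int \<Rightarrow>
   ('r, 'v) cochain \<Rightarrow> ('r, 'v) cochain set" where
  "HH_class R B \<mu> n i f = HH_coboundaries R B \<mu> n i +>\<^bsub>HH_cocycles R B \<mu> n i\<^esub> f"


section \<open>The obstruction\<close>

text \<open>
  An \<open>A\<^sub>r\<close>-structure extends by \<open>m\<^bsub>r+1\<^esub>\<close> to an \<open>A\<^bsub>r+1\<^esub>\<close>-structure iff the relation in arity
  \<open>r + 1\<close> holds, which reads \<open>\<partial> m\<^bsub>r+1\<^esub> = - \<Sum> m\<^sub>i \<circ> m\<^sub>j\<close>, the sum being over \<open>i + j = r + 2\<close> with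
  \<open>i, j \<ge> 2\<close>.  The obstruction is the Hochschild class of the map induced by this sum.
\<close>

definition obstruction_cochain ::
  "('r, 'z) ring_scheme \<Rightarrow> (int \<Rightarrow> ('r, 'v) module) \<Rightarrow> nat \<Rightarrow> (nat \<Rightarrow> ('r, 'v) cochain) \<Rightarrow>
   ('r, 'v) cochain" where
  "obstruction_cochain R A r m =
     (\<Oplus>\<^bsub>End_mod R A (r + 1) (int r - 2)\<^esub>i\<in>{2..r}.
        circ R A i (int i - 2) (r + 2 - i) (int (r + 2 - i) - 2) (m i) (m (r + 2 - i)))"

definition obstruction_class ::
  "('r, 'z) ring_scheme \<Rightarrow> (int \<Rightarrow> ('r, 'v) module) \<Rightarrow> (int \<Rightarrow> 'v \<Rightarrow> 'v) \<Rightarrow> nat \<Rightarrow>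
   (nat \<Rightarrow> ('r, 'v) cochain) \<Rightarrow> ('r, 'v set) cochain set" where
  "obstruction_class R A \<delta> r m =
     HH_class R (homology A \<delta>) (induced R A \<delta> 2 0 (m 2)) (r + 1) (int r - 2)
       (induced R A \<delta> (r + 1) (int r - 2) (obstruction_cochain R A r m))"

end

theory Submission
  imports Defs
begin

text \<open>
  A map out of a tensor power is determined by its values on pure tensors, so a cochain of arity \<open>n\<close>
  is the same thing as a multilinear function on words of length \<open>n\<close>; \<open>teval\<close> passes from the former
  to the latter.  On words, \<open>circ f g\<close> is a signed sum over the factorisations \<open>us @ ys @ vs\<close> of the
  argument, with \<open>g\<close> applied to the block \<open>ys\<close> (\<open>teval_circ\<close>), and \<open>End_diff\<close> is the bracket with
  the differential (\<open>End_diff_circ\<close>).  All identities are checked there.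

  Write \<open>m\<close> for the family of all operations, extended by zero beyond arity \<open>r\<close>, and
  \<open>D\<^sub>n = \<Sum> m\<^sub>i \<circ> m\<^sub>j\<close>, summed over \<open>i + j = n + 1\<close>.  Since all weights are odd,
  \<open>m \<circ> (m \<circ> m) = (m \<circ> m) \<circ> m\<close>: the terms of the right-hand side in which the two inner operations
  act on disjoint blocks cancel in pairs (\<open>family_square_assoc\<close>).  The hypothesis says that \<open>D\<^sub>n = 0\<close>
  for \<open>n \<le> r\<close>, and \<open>D\<^bsub>r+1\<^esub>\<close> is the obstruction cochain \<open>O\<close>.  In arity \<open>r + 1\<close> the identity therefore
  reads \<open>m\<^sub>1 \<circ> O = O \<circ> m\<^sub>1\<close>, that is, \<open>\<partial>O = 0\<close> (\<open>obs_cocycle\<close>).  In arity \<open>r + 2\<close> it says that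
  \<open>m\<^sub>2 \<circ> O - O \<circ> m\<^sub>2\<close> equals \<open>D\<^bsub>r+2\<^esub> \<circ> m\<^sub>1 - m\<^sub>1 \<circ> D\<^bsub>r+2\<^esub>\<close>, which takes boundaries as values on
  cycles; hence the map induced by \<open>O\<close> on homology is a Hochschild cocycle (\<open>obs_hochschild\<close>,
  \<open>ob_cocycle\<close>).

  If homology and cycles are projective, the complex contracts onto its homology
  (\<open>projective_contraction\<close>).  Let \<open>\<pi>\<close> be the resulting idempotent chain map, homotopic to the
  identity.  A cocycle \<open>f\<close> differs from \<open>f(\<pi> x\<^sub>1, \<dots>, \<pi> x\<^sub>n)\<close> by a coboundary
  (\<open>cocycle_homotopy\<close>), and this yields the part of the identification of the cohomology of \<open>End(A)\<close> with
  \<open>End(H(A))\<close> that matters: cocycles induce maps on homology (\<open>induces_exists\<close>), every map on homology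
  is induced by a cocycle (\<open>induces_lift\<close>), and a cocycle that induces zero is a coboundary
  (\<open>induces_zero_boundary\<close>).

  Finally, the structures on \<open>A\<close> in arities up to \<open>r\<close> with the given operations below \<open>r\<close> arise by replacing
  \<open>m\<^sub>r\<close> by \<open>m\<^sub>r - d\<close> for a cocycle \<open>d\<close>, which replaces \<open>O\<close> by \<open>O - [m\<^sub>2, d]\<close>
  (\<open>update_ainf\<close>, \<open>obstruction_update\<close>).  Such a structure extends to arity \<open>r + 1\<close> iff its
  obstruction cochain is a coboundary, that is, iff that cochain induces zero.  So a lift exists iff
  the map induced by \<open>O\<close> is \<open>[m\<^sub>2, d]\<close> on homology for some \<open>d\<close>, which is the vanishing of its class
  (\<open>ob_class_zero_iff_lift\<close>).
\<close>

section \<open>Signs, finite sums and linear maps\<close>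

locale rmod = module R M for R :: "('r, 'z) ring_scheme" (structure) and M :: "('r, 'm) module" (structure)
begin

lemma ksign_closed [simp, intro]: "x \<in> carrier M \<Longrightarrow> ksign M k x \<in> carrier M"
  by (simp add: ksign_def)

lemma ksign_zero [simp]: "ksign M k \<zero>\<^bsub>M\<^esub> = \<zero>\<^bsub>M\<^esub>"
  by (simp add: ksign_def)

lemma ksign_add:
  "x \<in> carrier M \<Longrightarrow> y \<in> carrier M \<Longrightarrow> ksign M k (x \<oplus>\<^bsub>M\<^esub> y) = ksign M k x \<oplus>\<^bsub>M\<^esub> ksign M k y"
  by (simp add: ksign_def M.minus_add)

lemma ksign_smult:
  "a \<in> carrier R \<Longrightarrow> x \<in> carrier M \<Longrightarrow> ksign M k (a \<odot>\<^bsub>M\<^esub> x) = a \<odot>\<^bsub>M\<^esub> ksign M k x"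
  by (simp add: ksign_def smult_r_minus)

lemma ksign_ksign [simp]: "x \<in> carrier M \<Longrightarrow> ksign M k (ksign M l x) = ksign M (k + l) x"
  by (simp add: ksign_def)

lemma ksign_Suc: "x \<in> carrier M \<Longrightarrow> even k \<noteq> even l \<Longrightarrow> ksign M k x = \<ominus>\<^bsub>M\<^esub> ksign M l x"
  by (auto simp: ksign_def)

lemma ksign_finsum:
  assumes "f \<in> I \<rightarrow> carrier M"
  shows "ksign M k (\<Oplus>\<^bsub>M\<^esub>i\<in>I. f i) = (\<Oplus>\<^bsub>M\<^esub>i\<in>I. ksign M k (f i))"
  using assms
proof (induction I rule: infinite_finite_induct)
  case (insert i I)
  then have "f i \<in> carrier M" "f \<in> I \<rightarrow> carrier M" by auto
  moreover from this have "(\<lambda>i. ksign M k (f i)) \<in> I \<rightarrow> carrier M" by auto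
  ultimately show ?case using insert by (simp add: ksign_add M.finsum_closed)
qed (simp_all add: M.finsum_infinite)

lemma finsum_zeroI: "(\<And>i. i \<in> I \<Longrightarrow> f i = \<zero>\<^bsub>M\<^esub>) \<Longrightarrow> (\<Oplus>\<^bsub>M\<^esub>i\<in>I. f i) = \<zero>\<^bsub>M\<^esub>"
  by (rule M.add.finprod_one_eqI)

lemma finsum_minus:
  assumes "f \<in> I \<rightarrow> carrier M"
  shows "(\<Oplus>\<^bsub>M\<^esub>i\<in>I. \<ominus>\<^bsub>M\<^esub> f i) = \<ominus>\<^bsub>M\<^esub> (\<Oplus>\<^bsub>M\<^esub>i\<in>I. f i)"
  using ksign_finsum[OF assms, of 1] by (simp add: ksign_def)

lemma finsum_Sigma:
  assumes "finite I" "\<And>i. i \<in> I \<Longrightarrow> finite (J i)"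
    and "\<And>i j. i \<in> I \<Longrightarrow> j \<in> J i \<Longrightarrow> f i j \<in> carrier M"
  shows "(\<Oplus>\<^bsub>M\<^esub>i\<in>I. \<Oplus>\<^bsub>M\<^esub>j\<in>J i. f i j) = (finsum M (\<lambda>(i, j). f i j) (Sigma I J))"
  using assms
proof (induction I rule: finite_induct)
  case (insert i I)
  have "(finsum M (\<lambda>(k, j). f k j) (Sigma (insert i I) J))
      = (finsum M (\<lambda>(k, j). f k j) ((Pair i ` J i) \<union> Sigma I J))"
    by (rule arg_cong[where f = "finsum M _"]) auto
  also have "\<dots> = (finsum M (\<lambda>(k, j). f k j) (Pair i ` J i)) \<oplus>\<^bsub>M\<^esub> (finsum M (\<lambda>(k, j). f k j) (Sigma I J))"
    by (rule M.finsum_Un_disjoint) (use insert in auto)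
  also have "(finsum M (\<lambda>(k, j). f k j) (Pair i ` J i)) = (\<Oplus>\<^bsub>M\<^esub>j\<in>J i. f i j)"
    by (subst M.finsum_reindex) (use insert in \<open>auto intro: inj_onI\<close>)
  also have "(finsum M (\<lambda>(k, j). f k j) (Sigma I J)) = (\<Oplus>\<^bsub>M\<^esub>k\<in>I. \<Oplus>\<^bsub>M\<^esub>j\<in>J k. f k j)"
    using insert by simp
  finally show ?case
    by (subst M.finsum_insert) (use insert in \<open>auto intro!: M.finsum_closed\<close>)
qed simp

lemma finsum_bij:
  assumes "inj_on h A" "h ` A = B" "\<And>a. a \<in> A \<Longrightarrow> g (h a) = f a" "\<And>a. a \<in> A \<Longrightarrow> f a \<in> carrier M"
  shows "(\<Oplus>\<^bsub>M\<^esub>b\<in>B. g b) = (\<Oplus>\<^bsub>M\<^esub>a\<in>A. f a)"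
proof -
  have "(\<Oplus>\<^bsub>M\<^esub>b\<in>B. g b) = (\<Oplus>\<^bsub>M\<^esub>a\<in>A. g (h a))"
    unfolding assms(2)[symmetric] by (rule M.finsum_reindex) (use assms in auto)
  also have "\<dots> = (\<Oplus>\<^bsub>M\<^esub>a\<in>A. f a)"
    by (rule M.finsum_cong') (use assms in auto)
  finally show ?thesis .
qed

lemma finsum_minusf:
  assumes "\<And>i. i \<in> I \<Longrightarrow> f i \<in> carrier M" "\<And>i. i \<in> I \<Longrightarrow> g i \<in> carrier M"
  shows "(\<Oplus>\<^bsub>M\<^esub>i\<in>I. f i) \<ominus>\<^bsub>M\<^esub> (\<Oplus>\<^bsub>M\<^esub>i\<in>I. g i) = (\<Oplus>\<^bsub>M\<^esub>i\<in>I. f i \<ominus>\<^bsub>M\<^esub> g i)"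
proof -
  have "(\<Oplus>\<^bsub>M\<^esub>i\<in>I. f i \<ominus>\<^bsub>M\<^esub> g i) = (\<Oplus>\<^bsub>M\<^esub>i\<in>I. f i) \<oplus>\<^bsub>M\<^esub> (\<Oplus>\<^bsub>M\<^esub>i\<in>I. \<ominus>\<^bsub>M\<^esub> g i)"
    unfolding a_minus_def by (rule M.finsum_addf) (use assms in auto)
  then show ?thesis using assms by (simp add: a_minus_def finsum_minus Pi_def)
qed

lemma minus_add_distrib:
  assumes "a \<in> carrier M" "b \<in> carrier M" "c \<in> carrier M" "d \<in> carrier M"
  shows "(a \<ominus>\<^bsub>M\<^esub> b) \<oplus>\<^bsub>M\<^esub> (c \<ominus>\<^bsub>M\<^esub> d) = (a \<oplus>\<^bsub>M\<^esub> c) \<ominus>\<^bsub>M\<^esub> (b \<oplus>\<^bsub>M\<^esub> d)"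
  using assms by (simp add: a_minus_def M.minus_add M.a_ac)

lemma finsum_pick_one:
  assumes "finite I" "k \<in> I" "f k \<in> carrier M" "\<And>i. i \<in> I \<Longrightarrow> i \<noteq> k \<Longrightarrow> f i = \<zero>\<^bsub>M\<^esub>"
  shows "(\<Oplus>\<^bsub>M\<^esub>i\<in>I. f i) = f k"
proof -
  have "(\<Oplus>\<^bsub>M\<^esub>i\<in>insert k (I - {k}). f i) = f k \<oplus>\<^bsub>M\<^esub> (\<Oplus>\<^bsub>M\<^esub>i\<in>I - {k}. f i)"
    by (rule M.finsum_insert) (use assms in auto)
  moreover have "(\<Oplus>\<^bsub>M\<^esub>i\<in>I - {k}. f i) = \<zero>\<^bsub>M\<^esub>" by (rule finsum_zeroI) (use assms in auto)
  moreover have "insert k (I - {k}) = I" using assms by auto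
  ultimately show ?thesis using assms(3) by simp
qed

lemma finsum_pick_two:
  assumes "finite I" "k \<in> I" "l \<in> I" "k \<noteq> l" "\<And>i. i \<in> I \<Longrightarrow> f i \<in> carrier M"
  shows "(\<Oplus>\<^bsub>M\<^esub>i\<in>I. f i) = (f k \<oplus>\<^bsub>M\<^esub> f l) \<oplus>\<^bsub>M\<^esub> (\<Oplus>\<^bsub>M\<^esub>i\<in>I - {k, l}. f i)"
proof -
  have "(\<Oplus>\<^bsub>M\<^esub>i\<in>insert k (insert l (I - {k, l})). f i) = f k \<oplus>\<^bsub>M\<^esub> (f l \<oplus>\<^bsub>M\<^esub> (\<Oplus>\<^bsub>M\<^esub>i\<in>I - {k, l}. f i))"
    by (subst M.finsum_insert, use assms in \<open>auto intro!: M.finsum_closed\<close>)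
  moreover have "insert k (insert l (I - {k, l})) = I" using assms by auto
  moreover have "(\<Oplus>\<^bsub>M\<^esub>i\<in>I - {k, l}. f i) \<in> carrier M"
    by (rule M.finsum_closed) (use assms in auto)
  ultimately show ?thesis using assms by (simp add: M.a_assoc)
qed

lemma minus_eq_zero_iff: "x \<in> carrier M \<Longrightarrow> y \<in> carrier M \<Longrightarrow> x \<ominus>\<^bsub>M\<^esub> y = \<zero>\<^bsub>M\<^esub> \<longleftrightarrow> x = y"
  by (metis M.add.inv_closed M.minus_equality M.minus_minus M.r_neg a_minus_def)

end

lemma ksign_cong: "even k = even l \<Longrightarrow> ksign M k x = ksign M l x"
  by (simp add: ksign_def)

lemma ksign_even [simp]: "even k \<Longrightarrow> ksign M k x = x"
  by (simp add: ksign_def)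

lemma lin_hom_uminus:
  assumes "f \<in> lin_hom R M N" "module R M" "module R N" "x \<in> carrier M"
  shows "f (\<ominus>\<^bsub>M\<^esub> x) = \<ominus>\<^bsub>N\<^esub> f x"
proof -
  interpret M: module R M by fact
  interpret N: module R N by fact
  show ?thesis
    using lin_hom_minus[OF assms(1-3) M.M.zero_closed assms(4)] assms lin_hom_closed[OF assms(1)]
      lin_hom_zero[OF assms(1-3)]
    by (simp add: a_minus_def)
qed

lemma lin_hom_ksign:
  assumes "f \<in> lin_hom R M N" "module R M" "module R N" "x \<in> carrier M"
  shows "f (ksign M k x) = ksign N k (f x)"
  using assms lin_hom_uminus[OF assms] by (simp add: ksign_def)

lemma lin_hom_finsum:
  assumes f: "f \<in> lin_hom R M N" and M: "module R M" and N: "module R N"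
    and g: "\<And>i. i \<in> I \<Longrightarrow> g i \<in> carrier M"
  shows "f (\<Oplus>\<^bsub>M\<^esub>i\<in>I. g i) = (\<Oplus>\<^bsub>N\<^esub>i\<in>I. f (g i))"
proof -
  interpret M: module R M by fact
  interpret N: module R N by fact
  show ?thesis using g
  proof (induction I rule: infinite_finite_induct)
    case (insert i I)
    then have "g \<in> I \<rightarrow> carrier M" "(\<lambda>i. f (g i)) \<in> I \<rightarrow> carrier N"
      using lin_hom_closed[OF f] by auto
    then show ?case using insert lin_hom_closed[OF f] by (simp add: lin_hom_add[OF f] M.M.finsum_closed)
  qed (simp_all add: M.M.finsum_infinite N.M.finsum_infinite lin_hom_zero[OF f M N])
qed

lemma submoduleI':
  assumes "module R M" "N \<subseteq> carrier M" "\<zero>\<^bsub>M\<^esub> \<in> N"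
    and "\<And>x y. x \<in> N \<Longrightarrow> y \<in> N \<Longrightarrow> x \<oplus>\<^bsub>M\<^esub> y \<in> N"
    and sm: "\<And>a x. a \<in> carrier R \<Longrightarrow> x \<in> N \<Longrightarrow> a \<odot>\<^bsub>M\<^esub> x \<in> N"
  shows "submodule N R M"
proof -
  interpret module R M by fact
  show ?thesis
  proof (rule submoduleI)
    fix x assume x: "x \<in> N"
    have "(\<ominus>\<^bsub>R\<^esub> \<one>\<^bsub>R\<^esub>) \<odot>\<^bsub>M\<^esub> x = \<ominus>\<^bsub>M\<^esub> x" using x assms(2) by (subst smult_l_minus) auto
    then show "\<ominus>\<^bsub>M\<^esub> x \<in> N" using sm[OF _ x, of "\<ominus>\<^bsub>R\<^esub> \<one>\<^bsub>R\<^esub>"] by simp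
  qed (use assms in auto)
qed

lemma lin_homI:
  assumes "f \<in> extensional (carrier M)" "\<And>x. x \<in> carrier M \<Longrightarrow> f x \<in> carrier N"
    and "\<And>x y. x \<in> carrier M \<Longrightarrow> y \<in> carrier M \<Longrightarrow> f (x \<oplus>\<^bsub>M\<^esub> y) = f x \<oplus>\<^bsub>N\<^esub> f y"
    and "\<And>a x. a \<in> carrier R \<Longrightarrow> x \<in> carrier M \<Longrightarrow> f (a \<odot>\<^bsub>M\<^esub> x) = a \<odot>\<^bsub>N\<^esub> f x"
  shows "f \<in> lin_hom R M N"
  using assms by (auto simp: lin_hom_def PiE_def)

lemma lin_hom_restrictI:
  assumes "module R M" "\<And>x. x \<in> carrier M \<Longrightarrow> f x \<in> carrier N"
    and "\<And>x y. x \<in> carrier M \<Longrightarrow> y \<in> carrier M \<Longrightarrow> f (x \<oplus>\<^bsub>M\<^esub> y) = f x \<oplus>\<^bsub>N\<^esub> f y"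
    and "\<And>a x. a \<in> carrier R \<Longrightarrow> x \<in> carrier M \<Longrightarrow> f (a \<odot>\<^bsub>M\<^esub> x) = a \<odot>\<^bsub>N\<^esub> f x"
  shows "(\<lambda>x\<in>carrier M. f x) \<in> lin_hom R M N"
proof -
  interpret module R M by fact
  show ?thesis by (rule lin_homI) (use assms in auto)
qed

lemma lin_hom_ksignI:
  assumes f: "f \<in> lin_hom R M N" and M: "module R M" and N: "module R N"
  shows "(\<lambda>x\<in>carrier M. ksign N k (f x)) \<in> lin_hom R M N"
proof -
  interpret N: rmod R N using N by (simp add: rmod_def)
  show ?thesis
    by (rule lin_hom_restrictI[OF M])
      (simp_all add: lin_hom_closed[OF f] lin_hom_add[OF f] lin_hom_smult[OF f] N.ksign_add N.ksign_smult)
qed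

lemma lin_hom_minusI:
  assumes f: "f \<in> lin_hom R M N" and g: "g \<in> lin_hom R M N" and M: "module R M" and N: "module R N"
  shows "(\<lambda>x\<in>carrier M. f x \<ominus>\<^bsub>N\<^esub> g x) \<in> lin_hom R M N"
proof -
  interpret N: rmod R N using N by (simp add: rmod_def)
  note c = lin_hom_closed[OF f] lin_hom_closed[OF g]
  show ?thesis
    by (rule lin_hom_restrictI[OF M])
      (simp_all add: c lin_hom_add[OF f] lin_hom_add[OF g] lin_hom_smult[OF f] lin_hom_smult[OF g]
        N.minus_add_distrib N.M.minus_closed, simp add: c a_minus_def N.smult_r_distr N.smult_r_minus)
qed

lemma lin_hom_finsumI:
  assumes f: "\<And>i. i \<in> I \<Longrightarrow> f i \<in> lin_hom R M N" and M: "module R M" and N: "module R N" and I: "finite I"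
  shows "(\<lambda>x\<in>carrier M. \<Oplus>\<^bsub>N\<^esub>i\<in>I. f i x) \<in> lin_hom R M N"
proof -
  interpret N: rmod R N using N by (simp add: rmod_def)
  note c = lin_hom_closed[OF f]
  show ?thesis
  proof (rule lin_hom_restrictI[OF M], goal_cases)
    case (1 x)
    then show ?case using c by (auto intro: N.M.finsum_closed)
  next
    case (2 x y)
    have "(\<Oplus>\<^bsub>N\<^esub>i\<in>I. f i (x \<oplus>\<^bsub>M\<^esub> y)) = (\<Oplus>\<^bsub>N\<^esub>i\<in>I. f i x \<oplus>\<^bsub>N\<^esub> f i y)"
      by (rule N.M.finsum_cong') (use c lin_hom_add[OF f] 2 in auto)
    also have "\<dots> = (\<Oplus>\<^bsub>N\<^esub>i\<in>I. f i x) \<oplus>\<^bsub>N\<^esub> (\<Oplus>\<^bsub>N\<^esub>i\<in>I. f i y)"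
      by (rule N.M.finsum_addf) (use c 2 in auto)
    finally show ?case .
  next
    case (3 a x)
    have "(\<Oplus>\<^bsub>N\<^esub>i\<in>I. f i (a \<odot>\<^bsub>M\<^esub> x)) = (\<Oplus>\<^bsub>N\<^esub>i\<in>I. a \<odot>\<^bsub>N\<^esub> f i x)"
      by (rule N.M.finsum_cong') (use c lin_hom_smult[OF f] 3 in auto)
    then show ?case using c 3 by (simp add: N.finsum_smult_ldistr[OF I] Pi_def)
  qed
qed

lemma lin_hom_into:
  assumes "f \<in> lin_hom R M N" "\<And>x. x \<in> carrier M \<Longrightarrow> f x \<in> K"
  shows "f \<in> lin_hom R M (N\<lparr>carrier := K\<rparr>)"
  using assms by (auto simp: lin_hom_def PiE_def)

lemma graded_hom_simps:
  "f \<in> carrier (graded_hom R C D i) \<longleftrightarrow> (\<forall>n. f n \<in> lin_hom R (C n) (D (n + i)))"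
  "(f \<oplus>\<^bsub>graded_hom R C D i\<^esub> g) = (\<lambda>n. \<lambda>x\<in>carrier (C n). f n x \<oplus>\<^bsub>D (n + i)\<^esub> g n x)"
  "(a \<odot>\<^bsub>graded_hom R C D i\<^esub> f) = (\<lambda>n. \<lambda>x\<in>carrier (C n). a \<odot>\<^bsub>D (n + i)\<^esub> f n x)"
  "\<zero>\<^bsub>graded_hom R C D i\<^esub> = (\<lambda>n. \<lambda>x\<in>carrier (C n). \<zero>\<^bsub>D (n + i)\<^esub>)"
  by (simp_all add: graded_hom_def)

lemma graded_hom_ext:
  assumes "f \<in> carrier (graded_hom R C D i)" "g \<in> carrier (graded_hom R C D i)"
    and "\<And>n x. x \<in> carrier (C n) \<Longrightarrow> f n x = g n x"
  shows "f = g"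
  proof
  fix n
  have "f n \<in> lin_hom R (C n) (D (n + i))" "g n \<in> lin_hom R (C n) (D (n + i))"
    using assms by (auto simp: graded_hom_simps)
  then show "f n = g n" by (rule lin_hom_ext) (use assms(3) in auto)
qed

lemma graded_hom_module:
  assumes R: "cring R" and C: "graded_module R C" and D: "graded_module R D"
  shows "module R (graded_hom R C D i)"
proof -
  have mC: "module R (C n)" and mD: "module R (D n)" for n
    using C D by (auto simp: graded_module_def)
  interpret R: cring R by (rule R)
  interpret C: module R "C n" for n by (rule mC)
  interpret D: module R "D n" for n by (rule mD)
  let ?E = "graded_hom R C D i"
  have lh: "(\<lambda>x\<in>carrier (C n). h n x) \<in> lin_hom R (C n) (D (n + i))"
    if "\<And>x. x \<in> carrier (C n) \<Longrightarrow> h n x \<in> carrier (D (n + i))"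
      "\<And>x y. x \<in> carrier (C n) \<Longrightarrow> y \<in> carrier (C n) \<Longrightarrow> h n (x \<oplus>\<^bsub>C n\<^esub> y) = h n x \<oplus>\<^bsub>D (n + i)\<^esub> h n y"
      "\<And>a x. a \<in> carrier R \<Longrightarrow> x \<in> carrier (C n) \<Longrightarrow> h n (a \<odot>\<^bsub>C n\<^esub> x) = a \<odot>\<^bsub>D (n + i)\<^esub> h n x"
    for h n
    by (rule lin_hom_restrictI[OF mC]) (use that in auto)
  have add: "f \<oplus>\<^bsub>?E\<^esub> g \<in> carrier ?E" if "f \<in> carrier ?E" "g \<in> carrier ?E" for f g
  proof -
    have f: "f n \<in> lin_hom R (C n) (D (n + i))" and g: "g n \<in> lin_hom R (C n) (D (n + i))" for n
      using that by (auto simp: graded_hom_simps)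
    note cl = lin_hom_closed[OF f] lin_hom_closed[OF g]
    show ?thesis unfolding graded_hom_simps
      by (intro allI lh)
        (simp_all add: cl lin_hom_add[OF f] lin_hom_add[OF g] lin_hom_smult[OF f] lin_hom_smult[OF g]
          D.M.a_ac D.smult_r_distr)
  qed
  have zero: "\<zero>\<^bsub>?E\<^esub> \<in> carrier ?E"
    unfolding graded_hom_simps by (intro allI lh) auto
  have sm: "a \<odot>\<^bsub>?E\<^esub> f \<in> carrier ?E" if a: "a \<in> carrier R" and "f \<in> carrier ?E" for a f
  proof -
    have f: "f n \<in> lin_hom R (C n) (D (n + i))" for n using that by (auto simp: graded_hom_simps)
    note cl = lin_hom_closed[OF f]
    show ?thesis unfolding graded_hom_simps
      by (intro allI lh)
        (simp_all add: a cl lin_hom_add[OF f] lin_hom_smult[OF f] D.smult_r_distr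
           D.smult_assoc1[symmetric] R.m_comm)
  qed
  have cl: "f n x \<in> carrier (D (n + i))" if "f \<in> carrier ?E" "x \<in> carrier (C n)" for f n x
    using that by (auto simp: graded_hom_simps intro: lin_hom_closed)
  have car: "(\<lambda>x\<in>carrier (C n). f n x) = f n" if "f \<in> carrier ?E" for f n
    using that by (auto simp: graded_hom_simps lin_hom_def PiE_def intro: extensionalityI)
  show ?thesis
  proof (rule moduleI[OF R])
    show "abelian_group ?E"
    proof (rule abelian_groupI)
      fix f assume f: "f \<in> carrier ?E"
      have "(\<ominus>\<^bsub>R\<^esub> \<one>\<^bsub>R\<^esub>) \<odot>\<^bsub>?E\<^esub> f \<oplus>\<^bsub>?E\<^esub> f = \<zero>\<^bsub>?E\<^esub>"
        by (rule graded_hom_ext[of _ R C D i])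
          (auto simp: add sm f zero, auto simp: graded_hom_simps(2-4) cl[OF f] D.smult_l_minus D.M.l_neg)
      then show "\<exists>g\<in>carrier ?E. g \<oplus>\<^bsub>?E\<^esub> f = \<zero>\<^bsub>?E\<^esub>" using sm[OF _ f] by blast
    qed (auto intro!: graded_hom_ext[of _ R C D i] add zero, auto simp: graded_hom_simps(2-4) cl D.M.a_ac)
  qed (auto intro!: graded_hom_ext[of _ R C D i] add sm,
      auto simp: graded_hom_simps(2-4) cl D.smult_l_distr D.smult_r_distr D.smult_assoc1)
qed

lemma graded_hom_eval:
  assumes R: "cring R" and C: "graded_module R C" and D: "graded_module R D" and x: "x \<in> carrier (C n)"
    and d: "d = n + i"
  shows "(\<lambda>f\<in>carrier (graded_hom R C D i). f n x) \<in> lin_hom R (graded_hom R C D i) (D d)"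
  unfolding d
  by (rule lin_hom_restrictI[OF graded_hom_module[OF R C D]])
    (use x in \<open>auto simp: graded_hom_simps intro: lin_hom_closed\<close>)

section \<open>Words and multilinear maps\<close>

lemma wdeg_simps [simp]:
  "wdeg [] = 0" "wdeg (a # xs) = fst a + wdeg xs" "wdeg (xs @ ys) = wdeg xs + wdeg ys"
  by (simp_all add: wdeg_def)

definition word_ok :: "(int \<Rightarrow> ('r, 'v) module) \<Rightarrow> 'v word \<Rightarrow> bool" where
  "word_ok V xs \<longleftrightarrow> (\<forall>a\<in>set xs. snd a \<in> carrier (V (fst a)))"

lemma word_ok_simps [simp]:
  "word_ok V []" "word_ok V (a # xs) \<longleftrightarrow> snd a \<in> carrier (V (fst a)) \<and> word_ok V xs"
  "word_ok V (xs @ ys) \<longleftrightarrow> word_ok V xs \<and> word_ok V ys"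
  by (auto simp: word_ok_def)

lemma words_iff: "xs \<in> words V n \<longleftrightarrow> length xs = n \<and> word_ok V xs"
  by (auto simp: words_def word_ok_def)

locale graded_mod =
  fixes R :: "('r, 'z) ring_scheme" and V :: "int \<Rightarrow> ('r, 'v) module"
  assumes R_cring: "cring R" and V_graded: "graded_module R V"
begin

lemma V_module: "module R (V d)"
  using V_graded by (simp add: graded_module_def)

sublocale V: rmod R "V d" for d
  by (simp add: rmod_def V_module)

text \<open>
  With all other letters frozen, each slot of a multilinear map is a linear map.  In this form
  sums, signs and zeros can be pulled out of a slot by the general facts on linear maps.
\<close>

lemma multilinear_slots:
  "multilinear R V n W j \<phi> \<longleftrightarrow>
     (\<forall>xs. word_ok V xs \<and> length xs = n \<longrightarrow> \<phi> xs \<in> carrier (W (wdeg xs + j))) \<and>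
     (\<forall>us p vs. word_ok V us \<and> word_ok V vs \<and> length us + 1 + length vs = n \<longrightarrow>
        (\<lambda>x\<in>carrier (V p). \<phi> (us @ (p, x) # vs)) \<in> lin_hom R (V p) (W (wdeg us + (p + wdeg vs) + j)))"
  (is "_ \<longleftrightarrow> ?C \<and> ?S")
proof
  assume *: "multilinear R V n W j \<phi>"
  have "(\<lambda>x\<in>carrier (V p). \<phi> (us @ (p, x) # vs)) \<in> lin_hom R (V p) (W (wdeg us + (p + wdeg vs) + j))"
    if w: "word_ok V us" "word_ok V vs" "length us + 1 + length vs = n" for us p vs
  proof (rule lin_hom_restrictI[OF V_module])
    fix x assume x: "x \<in> carrier (V p)"
    then have m: "us @ (p, x) # vs \<in> words V n" using w by (simp add: words_iff)
    then show "\<phi> (us @ (p, x) # vs) \<in> carrier (W (wdeg us + (p + wdeg vs) + j))"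
      using * unfolding multilinear_def by force
    show "\<phi> (us @ (p, x \<oplus>\<^bsub>V p\<^esub> y) # vs)
         = \<phi> (us @ (p, x) # vs) \<oplus>\<^bsub>W (wdeg us + (p + wdeg vs) + j)\<^esub> \<phi> (us @ (p, y) # vs)"
      if "y \<in> carrier (V p)" for y
      using * m that unfolding multilinear_def by simp
    show "\<phi> (us @ (p, a \<odot>\<^bsub>V p\<^esub> x) # vs)
         = a \<odot>\<^bsub>W (wdeg us + (p + wdeg vs) + j)\<^esub> \<phi> (us @ (p, x) # vs)"
      if "a \<in> carrier R" for a
      using * m that unfolding multilinear_def by simp
  qed
  then show "?C \<and> ?S" using * by (auto simp: multilinear_def words_iff)
next
  assume *: "?C \<and> ?S"
  show "multilinear R V n W j \<phi>"
    unfolding multilinear_def words_iff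
  proof (intro conjI allI ballI impI, goal_cases)
    case (1 xs)
    then show ?case using * by (simp add: words_iff)
  next
    case (2 us p x y vs)
    then have "(\<lambda>x\<in>carrier (V p). \<phi> (us @ (p, x) # vs)) \<in> lin_hom R (V p) (W (wdeg us + (p + wdeg vs) + j))"
      using * by simp
    from lin_hom_add[OF this, of x y] show ?case using 2 by simp
  next
    case (3 us p a x vs)
    then have "(\<lambda>x\<in>carrier (V p). \<phi> (us @ (p, x) # vs)) \<in> lin_hom R (V p) (W (wdeg us + (p + wdeg vs) + j))"
      using * by simp
    from lin_hom_smult[OF this, of a x] show ?case using 3 by simp
  qed
qed

lemma multilinear_closed:
  "multilinear R V n W j \<phi> \<Longrightarrow> word_ok V xs \<Longrightarrow> length xs = n \<Longrightarrow> d = wdeg xs + j \<Longrightarrow> \<phi> xs \<in> carrier (W d)"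
  by (simp add: multilinear_slots)

lemma multilinear_slot:
  "multilinear R V n W j \<phi> \<Longrightarrow> word_ok V us \<Longrightarrow> word_ok V vs \<Longrightarrow> length us + 1 + length vs = n \<Longrightarrow>
   d = wdeg us + p + wdeg vs + j \<Longrightarrow>
   (\<lambda>x\<in>carrier (V p). \<phi> (us @ (p, x) # vs)) \<in> lin_hom R (V p) (W d)"
  by (simp add: multilinear_slots add.assoc)

lemma multilinear_zero_slot:
  assumes "multilinear R V n W j \<phi>" "graded_module R W" "word_ok V us" "word_ok V vs"
    "length us + 1 + length vs = n" "d = wdeg us + p + wdeg vs + j"
  shows "\<phi> (us @ (p, \<zero>\<^bsub>V p\<^esub>) # vs) = \<zero>\<^bsub>W d\<^esub>"
  using lin_hom_zero[OF multilinear_slot[OF assms(1,3-6)] V_module] assms(2)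
  by (simp add: graded_module_def)

lemma multilinear_cong:
  assumes "\<And>xs. word_ok V xs \<Longrightarrow> length xs = n \<Longrightarrow> \<phi> xs = \<psi> xs"
  shows "multilinear R V n W j \<phi> \<longleftrightarrow> multilinear R V n W j \<psi>"
proof -
  have "(\<lambda>x\<in>carrier (V p). \<phi> (us @ (p, x) # vs)) = (\<lambda>x\<in>carrier (V p). \<psi> (us @ (p, x) # vs))"
    if "word_ok V us" "word_ok V vs" "length us + 1 + length vs = n" for us p vs
    by (rule restrict_ext) (use that assms in auto)
  then show ?thesis using assms unfolding multilinear_slots by (simp cong: conj_cong)
qed

lemma multilinear_ksign:
  assumes phi: "multilinear R V n W j \<phi>" and W: "graded_module R W"
  shows "multilinear R V n W j (\<lambda>xs. ksign (W (wdeg xs + j)) (e (map fst xs)) (\<phi> xs))"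
  unfolding multilinear_slots
proof (intro conjI allI impI, goal_cases)
  case (1 xs)
  interpret W: rmod R "W d" for d using W by (simp add: rmod_def graded_module_def)
  show ?case using multilinear_closed[OF phi] 1 by auto
next
  case (2 us p vs)
  let ?d = "wdeg us + (p + wdeg vs) + j" and ?e = "e (map fst us @ p # map fst vs)"
  have s: "(\<lambda>x\<in>carrier (V p). \<phi> (us @ (p, x) # vs)) \<in> lin_hom R (V p) (W ?d)"
    by (rule multilinear_slot[OF phi]) (use 2 in auto)
  have "(\<lambda>x\<in>carrier (V p). ksign (W (wdeg (us @ (p, x) # vs) + j)) (e (map fst (us @ (p, x) # vs))) (\<phi> (us @ (p, x) # vs)))
      = (\<lambda>x\<in>carrier (V p). ksign (W ?d) ?e ((\<lambda>x\<in>carrier (V p). \<phi> (us @ (p, x) # vs)) x))"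
    by (rule restrict_ext) simp
  then show ?case using lin_hom_ksignI[OF s V_module, of ?e] W by (simp add: graded_module_def)
qed

lemma multilinear_finsum:
  assumes phi: "\<And>k. k \<in> I \<Longrightarrow> multilinear R V n W j (\<phi> k)" and W: "graded_module R W"
    and I: "finite I"
  shows "multilinear R V n W j (\<lambda>xs. \<Oplus>\<^bsub>W (wdeg xs + j)\<^esub>k\<in>I. \<phi> k xs)"
  unfolding multilinear_slots
proof (intro conjI allI impI, goal_cases)
  case (1 xs)
  interpret W: rmod R "W d" for d using W by (simp add: rmod_def graded_module_def)
  show ?case using multilinear_closed[OF phi] 1 by (auto intro: W.M.finsum_closed)
next
  case (2 us p vs)
  let ?d = "wdeg us + (p + wdeg vs) + j"
  have s: "(\<lambda>x\<in>carrier (V p). \<phi> k (us @ (p, x) # vs)) \<in> lin_hom R (V p) (W ?d)" if "k \<in> I" for k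
    by (rule multilinear_slot[OF phi[OF that]]) (use 2 in auto)
  have "(\<lambda>x\<in>carrier (V p). \<Oplus>\<^bsub>W (wdeg (us @ (p, x) # vs) + j)\<^esub>k\<in>I. \<phi> k (us @ (p, x) # vs))
      = (\<lambda>x\<in>carrier (V p). \<Oplus>\<^bsub>W ?d\<^esub>k\<in>I. (\<lambda>x\<in>carrier (V p). \<phi> k (us @ (p, x) # vs)) x)"
    by (rule restrict_ext) simp
  then show ?case using lin_hom_finsumI[OF s V_module _ I] W by (simp add: graded_module_def)
qed

text \<open>
  Every composition in sight inserts the value of one multilinear map into a slot of another one.
  A slot of the composite lies before, inside or after the inserted block.
\<close>

definition insert_at :: "nat \<Rightarrow> nat \<Rightarrow> int \<Rightarrow> ('v word \<Rightarrow> 'v) \<Rightarrow> 'v word \<Rightarrow> 'v word" where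
  "insert_at u m j \<gamma> xs = (let ys = take m (drop u xs) in
     take u xs @ (wdeg ys + j, \<gamma> ys) # drop (u + m) xs)"

end

lemma split3E:
  assumes "length xs = u + m + v"
  obtains us ys vs where "xs = us @ ys @ vs" "length us = u" "length ys = m" "length vs = v"
  using that[of "take u xs" "take m (drop u xs)" "drop (u + m) xs"] assms
  by (simp add: add.commute drop_drop[symmetric] del: drop_drop)

context graded_mod begin

lemma insert_at_append:
  "length us = u \<Longrightarrow> length ys = m \<Longrightarrow>
   insert_at u m j \<gamma> (us @ ys @ vs) = us @ (wdeg ys + j, \<gamma> ys) # vs"
  by (simp add: insert_at_def)

lemma multilinear_insert:
  assumes Phi: "multilinear R V n W i \<Phi>" and gam: "multilinear R V m V j \<gamma>" and u: "u < n"
  shows "multilinear R V (n + m - 1) W (i + j) (\<lambda>xs. \<Phi> (insert_at u m j \<gamma> xs))"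
  unfolding multilinear_slots
proof (intro conjI allI impI, goal_cases)
  case (1 xs)
  obtain us ys vs where xs: "xs = us @ ys @ vs" "length us = u" "length ys = m" "length vs = n - 1 - u"
    by (rule split3E[of xs u m "n - 1 - u"]) (use u 1 in auto)
  show ?case unfolding xs insert_at_append[OF xs(2,3)]
    by (rule multilinear_closed[OF Phi]) (use 1 xs u multilinear_closed[OF gam] in auto)
next
  case (2 as p bs)
  let ?d = "wdeg as + (p + wdeg bs) + (i + j)"
  consider "length as < u" | "u \<le> length as" "length as < u + m" | "u + m \<le> length as" by linarith
  then show ?case
  proof cases
    case c: 1
    obtain us ys vs where bs: "bs = us @ ys @ vs" "length us = u - Suc (length as)" "length ys = m"
        "length vs = n - 1 - u"
      by (rule split3E[of bs "u - Suc (length as)" m "n - 1 - u"]) (use u 2 c in auto)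
    have eq: "insert_at u m j \<gamma> (as @ (p, x) # bs) = as @ (p, x) # (us @ (wdeg ys + j, \<gamma> ys) # vs)" for x
      using insert_at_append[of "as @ (p, x) # us" u ys m j \<gamma> vs] bs c by simp
    show ?thesis unfolding eq
      by (rule multilinear_slot[OF Phi]) (use 2 bs c u multilinear_closed[OF gam] in auto)
  next
    case c: 2
    define us a1 where "us = take u as" and "a1 = drop u as"
    define b1 vs where "b1 = take (u + m - Suc (length as)) bs" and "vs = drop (u + m - Suc (length as)) bs"
    have as: "as = us @ a1" and bs: "bs = b1 @ vs" by (simp_all add: us_def a1_def b1_def vs_def)
    have len: "length us = u" "length a1 + 1 + length b1 = m" "length vs = n - 1 - u"
      using c 2 u by (auto simp: us_def a1_def b1_def vs_def)
    let ?q = "wdeg a1 + p + wdeg b1 + j"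
    have eq: "insert_at u m j \<gamma> (as @ (p, x) # bs) = us @ (?q, \<gamma> (a1 @ (p, x) # b1)) # vs" for x
      using insert_at_append[of us u "a1 @ (p, x) # b1" m j \<gamma> vs] len by (simp add: as bs ac_simps)
    have g: "(\<lambda>x\<in>carrier (V p). \<gamma> (a1 @ (p, x) # b1)) \<in> lin_hom R (V p) (V ?q)"
      by (rule multilinear_slot[OF gam]) (use 2 as bs len in auto)
    have f: "(\<lambda>y\<in>carrier (V ?q). \<Phi> (us @ (?q, y) # vs)) \<in> lin_hom R (V ?q) (W ?d)"
      by (rule multilinear_slot[OF Phi]) (use 2 as bs len u in auto)
    have "compose (carrier (V p)) (\<lambda>y\<in>carrier (V ?q). \<Phi> (us @ (?q, y) # vs))
            (\<lambda>x\<in>carrier (V p). \<gamma> (a1 @ (p, x) # b1))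
        = (\<lambda>x\<in>carrier (V p). \<Phi> (us @ (?q, \<gamma> (a1 @ (p, x) # b1)) # vs))"
      unfolding compose_def by (rule restrict_ext) (use lin_hom_closed[OF g] in auto)
    then show ?thesis unfolding eq using lin_hom_comp[OF g f V_module] by simp
  next
    case c: 3
    have "length as = u + m + (length as - (u + m))" using c by simp
    then obtain us ys vs where as: "as = us @ ys @ vs" "length us = u" "length ys = m"
      by (rule split3E)
    have eq: "insert_at u m j \<gamma> (as @ (p, x) # bs) = (us @ (wdeg ys + j, \<gamma> ys) # vs) @ (p, x) # bs" for x
      using insert_at_append[of us u ys m j \<gamma> "vs @ (p, x) # bs"] as by simp
    show ?thesis unfolding eq
      by (rule multilinear_slot[OF Phi]) (use 2 as c u multilinear_closed[OF gam] in auto)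
  qed
qed

end

definition map_letters :: "(int \<Rightarrow> 'v \<Rightarrow> 'w) \<Rightarrow> 'v word \<Rightarrow> 'w word" where
  "map_letters \<alpha> = map (\<lambda>a. (fst a, \<alpha> (fst a) (snd a)))"

lemma map_letters_simps [simp]:
  "map_letters \<alpha> [] = []" "map_letters \<alpha> (a # xs) = (fst a, \<alpha> (fst a) (snd a)) # map_letters \<alpha> xs"
  "map_letters \<alpha> (xs @ ys) = map_letters \<alpha> xs @ map_letters \<alpha> ys"
  "wdeg (map_letters \<alpha> xs) = wdeg xs" "length (map_letters \<alpha> xs) = length xs"
  by (simp_all add: map_letters_def wdeg_def comp_def)

lemma map_letters_ok:
  "(\<And>p x. x \<in> carrier (V p) \<Longrightarrow> \<alpha> p x \<in> carrier (V' p)) \<Longrightarrow> word_ok V xs \<Longrightarrow> word_ok V' (map_letters \<alpha> xs)"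
  by (induction xs) auto

text \<open>
  Transport along a homotopy equivalence: restrict the arguments along a linear map of degree zero
  and apply a homogeneous linear map to the value.
\<close>

lemma multilinear_map_letters:
  assumes V: "graded_mod R V" and V': "graded_mod R V'"
    and phi: "multilinear R V n W i \<phi>"
    and \<alpha>: "\<And>p. \<alpha> p \<in> lin_hom R (V' p) (V p)"
    and \<beta>: "\<And>d. \<beta> d \<in> lin_hom R (W d) (W' (d + j))"
  shows "multilinear R V' n W' (i + j) (\<lambda>xs. \<beta> (wdeg xs + i) (\<phi> (map_letters \<alpha> xs)))"
proof -
  interpret V: graded_mod R V by fact
  interpret V': graded_mod R V' by fact
  have ok: "word_ok V (map_letters \<alpha> xs)" if "word_ok V' xs" for xs
    by (rule map_letters_ok[OF _ that]) (rule lin_hom_closed[OF \<alpha>])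
  show ?thesis unfolding V'.multilinear_slots
  proof (intro conjI allI impI, goal_cases)
    case (1 xs)
    then have "\<phi> (map_letters \<alpha> xs) \<in> carrier (W (wdeg xs + i))"
      using V.multilinear_closed[OF phi _ _ refl, of "map_letters \<alpha> xs"] ok by simp
    from lin_hom_closed[OF \<beta> this] show ?case by (simp add: add.assoc)
  next
    case (2 us p vs)
    let ?us = "map_letters \<alpha> us" and ?vs = "map_letters \<alpha> vs"
    let ?e = "wdeg us + p + wdeg vs + i"
    have f: "(\<lambda>x\<in>carrier (V p). \<phi> (?us @ (p, x) # ?vs)) \<in> lin_hom R (V p) (W ?e)"
      by (rule V.multilinear_slot[OF phi]) (use ok 2 in auto)
    have b: "\<beta> ?e \<in> lin_hom R (W ?e) (W' (wdeg us + (p + wdeg vs) + (i + j)))"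
      using \<beta>[of ?e] by (simp add: add.assoc)
    have "(\<lambda>x\<in>carrier (V' p). \<beta> (wdeg (us @ (p, x) # vs) + i) (\<phi> (map_letters \<alpha> (us @ (p, x) # vs))))
       = (\<lambda>x\<in>carrier (V' p). \<beta> ?e ((\<lambda>x\<in>carrier (V p). \<phi> (?us @ (p, x) # ?vs)) (\<alpha> p x)))"
      by (rule restrict_ext) (use lin_hom_closed[OF \<alpha>] in \<open>simp add: ac_simps\<close>)
    also have "\<dots> \<in> lin_hom R (V' p) (W' (wdeg us + (p + wdeg vs) + (i + j)))"
      by (rule lin_hom_restrictI[OF V'.V_module])
        (use lin_hom_closed[OF \<alpha>] lin_hom_closed[OF f] lin_hom_closed[OF b] in
          \<open>simp_all add: lin_hom_add[OF \<alpha>] lin_hom_smult[OF \<alpha>] lin_hom_add[OF f] lin_hom_smult[OF f] lin_hom_add[OF b] lin_hom_smult[OF b] del: restrict_apply\<close>)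
    finally show ?case .
  qed
qed

text \<open>
  The map \<open>id \<otimes> \<dots> \<otimes> g \<otimes> \<dots> \<otimes> id\<close> with \<open>g\<close> of degree \<open>j\<close> on the letter at position \<open>k\<close>, without its
  Koszul sign.
\<close>

definition upd :: "nat \<Rightarrow> int \<Rightarrow> (int \<Rightarrow> 'v \<Rightarrow> 'v) \<Rightarrow> 'v word \<Rightarrow> 'v word" where
  "upd k j g xs = xs[k := (fst (xs ! k) + j, g (fst (xs ! k)) (snd (xs ! k)))]"

lemma length_upd [simp]: "length (upd k j g xs) = length xs"
  by (simp add: upd_def)

lemma upd_append: "length us = k \<Longrightarrow> upd k j g (us @ (p, x) # vs) = us @ (p + j, g p x) # vs"
  by (auto simp: upd_def)

lemma upd_swap: "k \<noteq> l \<Longrightarrow> upd l a f (upd k b g xs) = upd k b g (upd l a f xs)"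
  by (simp add: upd_def list_update_swap)

lemma wdeg_take_upd:
  assumes "k < length xs"
  shows "wdeg (take l (upd k j g xs)) = wdeg (take l xs) + (if k < l then j else 0)"
proof (cases "k < l")
  case True
  have xs: "xs = take k xs @ xs ! k # drop (Suc k) xs" using assms by (rule id_take_nth_drop)
  obtain p x where px: "xs ! k = (p, x)" by (cases "xs ! k")
  define us vs where "us = take k xs" and "vs = drop (Suc k) xs"
  have e: "xs = us @ (p, x) # vs" "length us = k" using xs px assms by (simp_all add: us_def vs_def)
  obtain l' where l': "l = Suc (k + l')" using True less_imp_Suc_add by blast
  show ?thesis unfolding e(1) upd_append[OF e(2)] using True e(2) by (simp add: l')
next
  case False
  then show ?thesis by (simp add: upd_def take_update_swap list_update_beyond)
qed

lemma word_split:
  assumes "k < length xs"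
  obtains us p x vs where "xs = us @ (p, x) # vs" "length us = k"
proof -
  obtain p x where "xs ! k = (p, x)" by (cases "xs ! k")
  then show ?thesis using that[of "take k xs" p x "drop (Suc k) xs"] id_take_nth_drop[OF assms] assms by simp
qed

section \<open>Cochains as multilinear maps on words\<close>

definition teval ::
  "('r, 'z) ring_scheme \<Rightarrow> (int \<Rightarrow> ('r, 'v) module) \<Rightarrow> (int \<Rightarrow> ('r, 'v) tensor \<Rightarrow> 'w) \<Rightarrow> 'v word \<Rightarrow> 'w" where
  "teval R V f xs = f (wdeg xs) (pure_tensor R V xs)"

text \<open>
  The factorisations of a word into three blocks, the middle one of length \<open>m\<close>; they index the
  summands of a composite with a cochain of arity \<open>m\<close>.
\<close>

definition splits :: "nat \<Rightarrow> 'v word \<Rightarrow> ('v word \<times> 'v word \<times> 'v word) set" where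
  "splits m xs = {(us, ys, vs). us @ ys @ vs = xs \<and> length ys = m}"

text \<open>
  The exponent of the sign with which the factorisation \<open>us @ ys @ vs\<close> enters a composite whose inner
  cochain has degree \<open>j\<close>: the Koszul sign for passing that cochain over \<open>us\<close>, and the two signs in
  the pre-Lie product, where the arity of the outer cochain is \<open>length us + 1 + length vs\<close> and that
  of the inner one is \<open>length ys\<close>.
\<close>

definition circ_sign :: "int \<Rightarrow> 'v word \<Rightarrow> 'v word \<Rightarrow> 'v word \<Rightarrow> int" where
  "circ_sign j us ys vs = wdeg us * j + (j + int (length ys) - 1) * (int (length us) + int (length vs))
     + (int (length ys) - 1) * int (length us)"

context graded_mod begin

lemma tensor_power_graded: "graded_module R (tensor_power R V n)"
  by (simp add: graded_module_def tensor_power_module[OF R_cring V_graded])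

sublocale T: rmod R "tensor_power R V n d" for n d
  by (simp add: rmod_def tensor_power_module[OF R_cring V_graded])

lemma pure_tensor_multilinear: "multilinear R V n (tensor_power R V n) 0 (pure_tensor R V)"
  unfolding multilinear_def
proof (intro conjI allI impI ballI, goal_cases)
  case (1 xs)
  then show ?case using pure_tensor_closed[OF R_cring V_graded] by simp
next
  case (2 us p x y vs)
  let ?d = "wdeg (us @ (p, x) # vs)"
  let ?S = "words_deg V n ?d"
  let ?F = "free_module R ?S"
  let ?N = "tensor_relations R V n ?d"
  note mF = free_module_module[OF R_cring, of ?S]
  interpret F: rmod R ?F using mF by (simp add: rmod_def)
  note N = tensor_relations_submodule[OF R_cring V_graded, of n ?d]
  have S: "us @ (p, x) # vs \<in> ?S" "us @ (p, y) # vs \<in> ?S" "us @ (p, x \<oplus>\<^bsub>V p\<^esub> y) # vs \<in> ?S"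
    using 2 by (auto simp: words_deg_def words_iff)
  note c = free_gen_closed[OF R_cring S(1)] free_gen_closed[OF R_cring S(2)] free_gen_closed[OF R_cring S(3)]
  have n: "Suc (length us + length vs) = n" using 2 by (simp add: words_iff)
  have "free_gen R (us @ (p, x \<oplus>\<^bsub>V p\<^esub> y) # vs) \<ominus>\<^bsub>?F\<^esub>
      (free_gen R (us @ (p, x) # vs) \<oplus>\<^bsub>?F\<^esub> free_gen R (us @ (p, y) # vs)) \<in> ?N"
    unfolding tensor_relations_def Let_def
    by (rule subsetD[OF generated_submodule_gen]) (use S 2 in blast)
  then have "?N +>\<^bsub>?F\<^esub> free_gen R (us @ (p, x \<oplus>\<^bsub>V p\<^esub> y) # vs)
      = ?N +>\<^bsub>?F\<^esub> (free_gen R (us @ (p, x) # vs) \<oplus>\<^bsub>?F\<^esub> free_gen R (us @ (p, y) # vs))"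
    using quot_module_eq[OF mF N c(3) F.M.a_closed[OF c(1,2)]] by blast
  then show ?case
    using quot_module_add[OF mF N c(1,2)] by (simp add: pure_tensor_def tensor_power_def n)
next
  case (3 us p a x vs)
  let ?d = "wdeg (us @ (p, x) # vs)"
  let ?S = "words_deg V n ?d"
  let ?F = "free_module R ?S"
  let ?N = "tensor_relations R V n ?d"
  note mF = free_module_module[OF R_cring, of ?S]
  interpret F: rmod R ?F using mF by (simp add: rmod_def)
  note N = tensor_relations_submodule[OF R_cring V_graded, of n ?d]
  have S: "us @ (p, x) # vs \<in> ?S" "us @ (p, a \<odot>\<^bsub>V p\<^esub> x) # vs \<in> ?S"
    using 3 by (auto simp: words_deg_def words_iff)
  note c = free_gen_closed[OF R_cring S(1)] free_gen_closed[OF R_cring S(2)]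
  have n: "Suc (length us + length vs) = n" using 3 by (simp add: words_iff)
  have "free_gen R (us @ (p, a \<odot>\<^bsub>V p\<^esub> x) # vs) \<ominus>\<^bsub>?F\<^esub> a \<odot>\<^bsub>?F\<^esub> free_gen R (us @ (p, x) # vs) \<in> ?N"
    unfolding tensor_relations_def Let_def
    by (rule subsetD[OF generated_submodule_gen]) (use S 3 in blast)
  then have "?N +>\<^bsub>?F\<^esub> free_gen R (us @ (p, a \<odot>\<^bsub>V p\<^esub> x) # vs)
      = ?N +>\<^bsub>?F\<^esub> (a \<odot>\<^bsub>?F\<^esub> free_gen R (us @ (p, x) # vs))"
    using quot_module_eq[OF mF N c(2) F.smult_closed[OF _ c(1)], of a] 3 by blast
  then show ?case
    using quot_module_smult[OF mF N _ c(1), of a] 3 by (simp add: pure_tensor_def tensor_power_def n)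
qed

lemma teval_multilinear:
  assumes f: "f \<in> carrier (graded_hom R (tensor_power R V n) W j)"
  shows "multilinear R V n W j (teval R V f)"
proof -
  have fd: "f d \<in> lin_hom R (tensor_power R V n d) (W (d + j))" for d
    using f by (simp add: graded_hom_simps)
  note pt = pure_tensor_multilinear[of n]
  have cl: "pure_tensor R V xs \<in> carrier (tensor_power R V n d)" if "xs \<in> words V n" "d = wdeg xs" for xs d
    using that multilinear_closed[OF pt] by (simp add: words_iff)
  show ?thesis
    unfolding multilinear_def teval_def
  proof (intro conjI allI impI ballI, goal_cases)
    case (1 xs)
    then show ?case using lin_hom_closed[OF fd cl] by simp
  next
    case (2 us p x y vs)
    have "us @ (p, y) # vs \<in> words V n" using 2 by (simp add: words_iff)
    then show ?case
      using 2 pt lin_hom_add[OF fd cl cl, of "us @ (p, x) # vs" "wdeg (us @ (p, x) # vs)" "us @ (p, y) # vs"]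
      unfolding multilinear_def by simp
  next
    case (3 us p a x vs)
    then show ?case
      using pt lin_hom_smult[OF fd _ cl, of a "us @ (p, x) # vs" "wdeg (us @ (p, x) # vs)"]
      unfolding multilinear_def by simp
  qed
qed

lemma tensor_lift_spec:
  assumes "graded_module R W" "multilinear R V n W j \<phi>"
  shows tensor_lift_closed: "tensor_lift R V n W j \<phi> \<in> carrier (graded_hom R (tensor_power R V n) W j)"
    and teval_tensor_lift: "\<And>xs. word_ok V xs \<Longrightarrow> length xs = n \<Longrightarrow> teval R V (tensor_lift R V n W j \<phi>) xs = \<phi> xs"
  using theI'[OF tensor_universal[OF R_cring V_graded assms]]
  by (auto simp: tensor_lift_def teval_def words_iff)

lemma cochain_ext:
  assumes "graded_module R W" "f \<in> carrier (graded_hom R (tensor_power R V n) W j)"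
    "g \<in> carrier (graded_hom R (tensor_power R V n) W j)"
    and "\<And>xs. word_ok V xs \<Longrightarrow> length xs = n \<Longrightarrow> teval R V f xs = teval R V g xs"
  shows "f = g"
  by (rule tensor_hom_eq[OF R_cring V_graded assms(1-3)]) (use assms(4) in \<open>auto simp: teval_def words_iff\<close>)

abbreviation "E \<equiv> End_mod R V"
abbreviation "ev \<equiv> teval R V"

lemma End_module: "module R (E n i)"
  unfolding End_mod_def by (rule graded_hom_module[OF R_cring tensor_power_graded V_graded])

sublocale E: rmod R "E n i" for n i
  by (simp add: rmod_def End_module)

lemma End_ext:
  assumes "f \<in> carrier (E n i)" "g \<in> carrier (E n i)"
    and "\<And>xs. word_ok V xs \<Longrightarrow> length xs = n \<Longrightarrow> ev f xs = ev g xs"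
  shows "f = g"
  by (rule cochain_ext[OF V_graded]) (use assms in \<open>auto simp: End_mod_def\<close>)

lemma End_multilinear: "f \<in> carrier (E n i) \<Longrightarrow> multilinear R V n V i (ev f)"
  unfolding End_mod_def by (rule teval_multilinear)

lemma End_cochainE:
  assumes "multilinear R V n V i \<phi>"
  obtains f where "f \<in> carrier (E n i)"
    "\<And>xs. word_ok V xs \<Longrightarrow> length xs = n \<Longrightarrow> ev f xs = \<phi> xs"
  using tensor_lift_spec[OF V_graded assms] that unfolding End_mod_def by blast

lemmas teval_closed = multilinear_closed[OF End_multilinear]
lemmas teval_slot = multilinear_slot[OF End_multilinear]
lemmas teval_zero_slot = multilinear_zero_slot[OF End_multilinear V_graded]

lemma teval_lin_hom:
  assumes "word_ok V xs" "length xs = n" "d = wdeg xs + i"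
  shows "(\<lambda>f\<in>carrier (E n i). ev f xs) \<in> lin_hom R (E n i) (V d)"
  unfolding End_mod_def teval_def
  by (rule graded_hom_eval[OF R_cring tensor_power_graded V_graded])
    (use assms multilinear_closed[OF pure_tensor_multilinear] in auto)

context
  fixes xs n d i
  assumes xs: "word_ok V xs" "length xs = n" "d = wdeg xs + i"
begin

lemma teval_add:
  "f \<in> carrier (E n i) \<Longrightarrow> g \<in> carrier (E n i) \<Longrightarrow>
   ev (f \<oplus>\<^bsub>E n i\<^esub> g) xs = ev f xs \<oplus>\<^bsub>V d\<^esub> ev g xs"
  using lin_hom_add[OF teval_lin_hom[OF xs], of f g] by simp

lemma teval_smult:
  "a \<in> carrier R \<Longrightarrow> f \<in> carrier (E n i) \<Longrightarrow>
   ev (a \<odot>\<^bsub>E n i\<^esub> f) xs = a \<odot>\<^bsub>V d\<^esub> ev f xs"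
  using lin_hom_smult[OF teval_lin_hom[OF xs], of a f] by simp

lemma teval_minus:
  "f \<in> carrier (E n i) \<Longrightarrow> g \<in> carrier (E n i) \<Longrightarrow>
   ev (f \<ominus>\<^bsub>E n i\<^esub> g) xs = ev f xs \<ominus>\<^bsub>V d\<^esub> ev g xs"
  using lin_hom_minus[OF teval_lin_hom[OF xs] End_module V_module, of f g] by (simp add: E.M.minus_closed)

lemma teval_zero: "ev \<zero>\<^bsub>E n i\<^esub> xs = \<zero>\<^bsub>V d\<^esub>"
  using lin_hom_zero[OF teval_lin_hom[OF xs] End_module V_module] by simp

lemma teval_ksign:
  "f \<in> carrier (E n i) \<Longrightarrow>
   ev (ksign (E n i) k f) xs = ksign (V d) k (ev f xs)"
  using lin_hom_ksign[OF teval_lin_hom[OF xs] End_module V_module, of f] by simp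

lemma teval_finsum:
  assumes "\<And>k. k \<in> I \<Longrightarrow> f k \<in> carrier (E n i)"
  shows "ev (\<Oplus>\<^bsub>E n i\<^esub>k\<in>I. f k) xs = (\<Oplus>\<^bsub>V d\<^esub>k\<in>I. ev (f k) xs)"
proof -
  have "(\<Oplus>\<^bsub>E n i\<^esub>k\<in>I. f k) \<in> carrier (E n i)"
    using assms by (intro E.M.finsum_closed) auto
  then have "ev (\<Oplus>\<^bsub>E n i\<^esub>k\<in>I. f k) xs
     = (\<Oplus>\<^bsub>V d\<^esub>k\<in>I. (\<lambda>f\<in>carrier (E n i). ev f xs) (f k))"
    using lin_hom_finsum[OF teval_lin_hom[OF xs] End_module V_module, of I f] assms by simp
  also have "\<dots> = (\<Oplus>\<^bsub>V d\<^esub>k\<in>I. ev (f k) xs)"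
    by (rule V.M.finsum_cong') (use assms teval_closed[OF assms] xs in auto)
  finally show ?thesis .
qed

end

section \<open>Evaluating insertions, compositions and differentials\<close>

lemma tensor_insert_spec:
  assumes g: "g \<in> carrier (E m j)" and k: "k \<in> {1..n}"
  shows tensor_insert_closed:
      "tensor_insert R V n m j k g \<in> carrier (graded_hom R (tensor_power R V (n + m - 1)) (tensor_power R V n) j)"
    and teval_tensor_insert: "\<And>xs. word_ok V xs \<Longrightarrow> length xs = n + m - 1 \<Longrightarrow>
      ev (tensor_insert R V n m j k g) xs =
        ksign (tensor_power R V n (wdeg xs + j)) (wdeg (take (k - 1) xs) * j)
          (pure_tensor R V (insert_at (k - 1) m j (ev g) xs))"
proof -
  have "multilinear R V (n + m - 1) (tensor_power R V n) (0 + j)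
     (\<lambda>xs. ksign (tensor_power R V n (wdeg xs + (0 + j))) ((\<lambda>ds. sum_list (take (k - 1) ds) * j) (map fst xs))
          (pure_tensor R V (insert_at (k - 1) m j (ev g) xs)))"
    by (rule multilinear_ksign[OF multilinear_insert[OF pure_tensor_multilinear End_multilinear[OF g]] tensor_power_graded])
      (use k in auto)
  also have "(\<lambda>xs. ksign (tensor_power R V n (wdeg xs + (0 + j))) ((\<lambda>ds. sum_list (take (k - 1) ds) * j) (map fst xs))
          (pure_tensor R V (insert_at (k - 1) m j (ev g) xs)))
     = (\<lambda>xs. ksign (tensor_power R V n (wdeg xs + j)) (wdeg (take (k - 1) xs) * j)
          (pure_tensor R V (insert_at (k - 1) m j (ev g) xs)))"
    by (simp add: wdeg_def take_map)
  finally have *: "multilinear R V (n + m - 1) (tensor_power R V n) j \<dots>" by simp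
  have eq: "tensor_insert R V n m j k g = tensor_lift R V (n + m - 1) (tensor_power R V n) j
     (\<lambda>xs. ksign (tensor_power R V n (wdeg xs + j)) (wdeg (take (k - 1) xs) * j)
          (pure_tensor R V (insert_at (k - 1) m j (ev g) xs)))"
    by (simp add: tensor_insert_def insert_at_def Let_def teval_def)
  show "tensor_insert R V n m j k g \<in> carrier (graded_hom R (tensor_power R V (n + m - 1)) (tensor_power R V n) j)"
    unfolding eq by (rule tensor_lift_closed[OF tensor_power_graded *])
  show "ev (tensor_insert R V n m j k g) xs =
        ksign (tensor_power R V n (wdeg xs + j)) (wdeg (take (k - 1) xs) * j)
          (pure_tensor R V (insert_at (k - 1) m j (ev g) xs))"
    if "word_ok V xs" "length xs = n + m - 1" for xs
    unfolding eq using teval_tensor_lift[OF tensor_power_graded * that] .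
qed

lemma graded_comp_closed:
  assumes f: "f \<in> carrier (graded_hom R D W i)" and g: "g \<in> carrier (graded_hom R C D j)"
    and C: "graded_module R C"
  shows "graded_comp C f j g \<in> carrier (graded_hom R C W (i + j))"
proof -
  have "compose (carrier (C n)) (f (n + j)) (g n) \<in> lin_hom R (C n) (W (n + (i + j)))" for n
    by (rule lin_hom_comp[of _ _ _ "D (n + j)"])
      (use f g C spec[of _ "n + j"] in \<open>auto simp: graded_hom_simps graded_module_def ac_simps\<close>)
  then show ?thesis by (simp add: graded_hom_simps graded_comp_def)
qed

lemma teval_graded_comp:
  assumes "word_ok V xs" "length xs = n"
  shows "ev (graded_comp (tensor_power R V n) f j g) xs = f (wdeg xs + j) (ev g xs)"
  using multilinear_closed[OF pure_tensor_multilinear assms refl]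
  by (simp add: teval_def graded_comp_def compose_def)

lemma insert_comp_spec:
  assumes f: "f \<in> carrier (E n i)" and g: "g \<in> carrier (E m j)" and k: "k \<in> {1..n}"
  shows insert_comp_closed:
    "graded_comp (tensor_power R V (n + m - 1)) f j (tensor_insert R V n m j k g)
       \<in> carrier (E (n + m - 1) (i + j))"
    and teval_insert_comp: "\<And>xs. word_ok V xs \<Longrightarrow> length xs = n + m - 1 \<Longrightarrow>
      ev (graded_comp (tensor_power R V (n + m - 1)) f j (tensor_insert R V n m j k g)) xs
      = ksign (V (wdeg xs + (i + j))) (wdeg (take (k - 1) xs) * j)
          (ev f (insert_at (k - 1) m j (ev g) xs))"
proof -
  show "graded_comp (tensor_power R V (n + m - 1)) f j (tensor_insert R V n m j k g)
       \<in> carrier (E (n + m - 1) (i + j))"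
    using graded_comp_closed[OF _ tensor_insert_closed[OF g k] tensor_power_graded] f
    unfolding End_mod_def by blast
  fix xs assume xs: "word_ok V xs" "length xs = n + m - 1"
  let ?d = "wdeg xs + j"
  have f': "f ?d \<in> lin_hom R (tensor_power R V n ?d) (V (?d + i))"
    using f unfolding End_mod_def graded_hom_simps by blast
  obtain us ys vs where w: "xs = us @ ys @ vs" "length us = k - 1" "length ys = m" "length vs = n - k"
    by (rule split3E[of xs "k - 1" m "n - k"]) (use xs k in auto)
  have i: "word_ok V (insert_at (k - 1) m j (ev g) xs)"
    "length (insert_at (k - 1) m j (ev g) xs) = n"
    "wdeg (insert_at (k - 1) m j (ev g) xs) = ?d"
    unfolding w(1) insert_at_append[OF w(2,3)]
    using xs w k teval_closed[OF g] by auto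
  show "ev (graded_comp (tensor_power R V (n + m - 1)) f j (tensor_insert R V n m j k g)) xs
      = ksign (V (wdeg xs + (i + j))) (wdeg (take (k - 1) xs) * j)
          (ev f (insert_at (k - 1) m j (ev g) xs))"
    unfolding teval_graded_comp[OF xs] teval_tensor_insert[OF g k xs]
    using lin_hom_ksign[OF f' T.module_axioms V_module multilinear_closed[OF pure_tensor_multilinear i(1,2)]] i(3)
    by (simp add: teval_def ac_simps)
qed

lemma splits_image:
  assumes "length xs = n + m - 1" "1 \<le> n"
  shows "inj_on (\<lambda>k. (take (k - 1) xs, take m (drop (k - 1) xs), drop (k - 1 + m) xs)) {1..n}"
    "(\<lambda>k. (take (k - 1) xs, take m (drop (k - 1) xs), drop (k - 1 + m) xs)) ` {1..n} = splits m xs"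
proof -
  show "inj_on (\<lambda>k. (take (k - 1) xs, take m (drop (k - 1) xs), drop (k - 1 + m) xs)) {1..n}"
  proof (rule inj_onI)
    fix k l assume "k \<in> {1..n}" "l \<in> {1..n}" and
      "(take (k - 1) xs, take m (drop (k - 1) xs), drop (k - 1 + m) xs)
       = (take (l - 1) xs, take m (drop (l - 1) xs), drop (l - 1 + m) xs)"
    then have "length (take (k - 1) xs) = length (take (l - 1) xs)" by simp
    then show "k = l" using \<open>k \<in> {1..n}\<close> \<open>l \<in> {1..n}\<close> assms by auto
  qed
  show "(\<lambda>k. (take (k - 1) xs, take m (drop (k - 1) xs), drop (k - 1 + m) xs)) ` {1..n} = splits m xs"
  proof (intro Set.set_eqI iffI)
    fix t assume "t \<in> splits m xs"
    then obtain us ys vs where t: "t = (us, ys, vs)" "xs = us @ ys @ vs" "length ys = m"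
      by (auto simp: splits_def)
    then show "t \<in> (\<lambda>k. (take (k - 1) xs, take m (drop (k - 1) xs), drop (k - 1 + m) xs)) ` {1..n}"
      using assms by (intro image_eqI[of _ _ "length us + 1"]) auto
  next
    fix t assume "t \<in> (\<lambda>k. (take (k - 1) xs, take m (drop (k - 1) xs), drop (k - 1 + m) xs)) ` {1..n}"
    then obtain k where k: "k \<in> {1..n}" "t = (take (k - 1) xs, take m (drop (k - 1) xs), drop (k - 1 + m) xs)"
      by blast
    have "take (k - 1) xs @ take m (drop (k - 1) xs) @ drop (k - 1 + m) xs = xs"
      by (simp add: add.commute drop_drop[symmetric] del: drop_drop)
    then show "t \<in> splits m xs" using k assms by (auto simp: splits_def)
  qed
qed

lemma splits_finite: "finite (splits m xs)"
proof (rule finite_subset)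
  show "splits m xs \<subseteq> (\<lambda>k. (take k xs, take m (drop k xs), drop (k + m) xs)) ` {..length xs}"
  proof
    fix t assume "t \<in> splits m xs"
    then obtain us ys vs where "t = (us, ys, vs)" "xs = us @ ys @ vs" "length ys = m"
      by (auto simp: splits_def)
    then show "t \<in> (\<lambda>k. (take k xs, take m (drop k xs), drop (k + m) xs)) ` {..length xs}"
      by (intro image_eqI[of _ _ "length us"]) auto
  qed
qed auto

lemma circ_spec:
  assumes f: "f \<in> carrier (E n i)" and g: "g \<in> carrier (E m j)"
  shows circ_closed: "circ R V n i m j f g \<in> carrier (E (n + m - 1) (i + j))"
    and teval_circ: "\<And>xs d. word_ok V xs \<Longrightarrow> length xs = n + m - 1 \<Longrightarrow> 1 \<le> n \<Longrightarrow> d = wdeg xs + (i + j) \<Longrightarrow>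
      ev (circ R V n i m j f g) xs = finsum (V d) (\<lambda>(us, ys, vs).
        ksign (V d) (circ_sign j us ys vs) (ev f (us @ (wdeg ys + j, ev g ys) # vs))) (splits m xs)"
proof -
  let ?E = "E (n + m - 1) (i + j)"
  let ?G = "\<lambda>k. graded_comp (tensor_power R V (n + m - 1)) f j (tensor_insert R V n m j k g)"
  let ?t = "\<lambda>k. ksign ?E ((int m - 1) * (int k - 1)) (?G k)"
  have t: "?t k \<in> carrier ?E" if "k \<in> {1..n}" for k
    using insert_comp_closed[OF f g that] by simp
  have s: "(\<Oplus>\<^bsub>?E\<^esub>k\<in>{1..n}. ?t k) \<in> carrier ?E"
    by (rule E.M.finsum_closed) (use t in auto)
  then show "circ R V n i m j f g \<in> carrier ?E"
    by (simp add: circ_def Let_def)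
  fix xs d assume xs: "word_ok V xs" "length xs = n + m - 1" and n: "1 \<le> n" and d: "d = wdeg xs + (i + j)"
  note x = xs d
  have G: "ev (?G k) xs = ksign (V d) (wdeg (take (k - 1) xs) * j)
          (ev f (insert_at (k - 1) m j (ev g) xs))" if "k \<in> {1..n}" for k
    using teval_insert_comp[OF f g that xs] d by simp
  have G': "ev (?t k) xs = ksign (V d) ((int m - 1) * (int k - 1)) (ev (?G k) xs)" if "k \<in> {1..n}" for k
    by (rule teval_ksign[OF x insert_comp_closed[OF f g that]])
  have c: "ev f (insert_at (k - 1) m j (ev g) xs) \<in> carrier (V d)" if k: "k \<in> {1..n}" for k
    by (rule multilinear_closed[OF multilinear_insert[OF End_multilinear[OF f] End_multilinear[OF g]]])
      (use k x in auto)
  have "ev (circ R V n i m j f g) xs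
      = ksign (V d) (weight m j * (int n - 1)) (\<Oplus>\<^bsub>V d\<^esub>k\<in>{1..n}. ev (?t k) xs)"
    unfolding circ_def Let_def teval_ksign[OF x s] by (subst teval_finsum[OF x t]) auto
  also have "(\<Oplus>\<^bsub>V d\<^esub>k\<in>{1..n}. ev (?t k) xs)
     = (\<Oplus>\<^bsub>V d\<^esub>k\<in>{1..n}. ksign (V d) ((int m - 1) * (int k - 1) + wdeg (take (k - 1) xs) * j)
           (ev f (insert_at (k - 1) m j (ev g) xs)))"
    by (rule V.M.finsum_cong') (unfold G' G, use c in auto)
  also have "ksign (V d) (weight m j * (int n - 1)) \<dots>
     = (\<Oplus>\<^bsub>V d\<^esub>k\<in>{1..n}. ksign (V d) (weight m j * (int n - 1)
             + ((int m - 1) * (int k - 1) + wdeg (take (k - 1) xs) * j))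
           (ev f (insert_at (k - 1) m j (ev g) xs)))"
    by (subst V.ksign_finsum) (use c in \<open>auto intro!: V.M.finsum_cong'\<close>)
  also have "\<dots> = finsum (V d) (\<lambda>(us, ys, vs).
        ksign (V d) (circ_sign j us ys vs) (ev f (us @ (wdeg ys + j, ev g ys) # vs))) (splits m xs)"
    by (rule V.finsum_bij[OF splits_image[OF xs(2) n], symmetric])
      (use c n xs in \<open>auto simp: insert_at_def Let_def circ_sign_def weight_def algebra_simps of_nat_diff\<close>)
  finally show "ev (circ R V n i m j f g) xs = finsum (V d) (\<lambda>(us, ys, vs).
        ksign (V d) (circ_sign j us ys vs) (ev f (us @ (wdeg ys + j, ev g ys) # vs))) (splits m xs)" .
qed

lemma splits_ok:
  assumes "(us, ys, vs) \<in> splits m xs" "word_ok V xs"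
  shows "word_ok V us" "word_ok V ys" "word_ok V vs" "length ys = m" "length us + m + length vs = length xs"
    "wdeg us + wdeg ys + wdeg vs = wdeg xs"
  using assms by (auto simp: splits_def)

lemma upd_insert_at:
  "k < length xs \<Longrightarrow> upd k j g xs = insert_at k 1 j (\<lambda>ys. g (fst (hd ys)) (snd (hd ys))) xs"
  by (simp add: upd_def insert_at_def Let_def upd_conv_take_nth_drop take_Suc_conv_app_nth
      Cons_nth_drop_Suc[symmetric])

lemma letter_multilinear:
  assumes "\<And>p. g p \<in> lin_hom R (V p) (W (p + j))"
  shows "multilinear R V 1 W j (\<lambda>ys. g (fst (hd ys)) (snd (hd ys)))"
  unfolding multilinear_slots
proof (intro conjI allI impI, goal_cases)
  case (1 xs)
  then obtain p x where "xs = [(p, x)]" by (cases xs) auto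
  then show ?case using 1 lin_hom_closed[OF assms] by simp
next
  case (2 us p vs)
  then have "us = []" "vs = []" by auto
  moreover have "(\<lambda>x\<in>carrier (V p). g p x) = g p"
    using assms[of p] by (auto simp: lin_hom_def PiE_def intro: extensionalityI)
  ultimately show ?case using assms[of p] by simp
qed

lemma multilinear_upd:
  assumes "multilinear R V n W i \<Phi>" "\<And>p. g p \<in> lin_hom R (V p) (V (p + j))" "k < n"
  shows "multilinear R V n W (i + j) (\<lambda>xs. \<Phi> (upd k j g xs))"
proof -
  have "multilinear R V (n + 1 - 1) W (i + j) (\<lambda>xs. \<Phi> (insert_at k 1 j (\<lambda>ys. g (fst (hd ys)) (snd (hd ys))) xs))"
    by (rule multilinear_insert[OF assms(1) letter_multilinear[OF assms(2)] assms(3)])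
  then show ?thesis using multilinear_cong[of n "\<lambda>xs. \<Phi> (upd k j g xs)"
        "\<lambda>xs. \<Phi> (insert_at k 1 j (\<lambda>ys. g (fst (hd ys)) (snd (hd ys))) xs)"] assms(3)
    by (simp add: upd_insert_at)
qed

lemma upd_ok:
  assumes "word_ok V xs" "\<And>p. g p \<in> lin_hom R (V p) (V (p + j))" "k < length xs"
  shows "word_ok V (upd k j g xs)" "wdeg (upd k j g xs) = wdeg xs + j"
proof -
  have "xs = take k xs @ xs ! k # drop (Suc k) xs" using assms(3) by (rule id_take_nth_drop)
  then have "word_ok V (take k xs)" "snd (xs ! k) \<in> carrier (V (fst (xs ! k)))" "word_ok V (drop (Suc k) xs)"
    "wdeg xs = wdeg (take k xs) + (fst (xs ! k) + wdeg (drop (Suc k) xs))"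
    using assms(1) by (metis word_ok_simps(2,3), metis word_ok_simps(2,3), metis word_ok_simps(2,3), metis wdeg_simps(2,3))
  then show "word_ok V (upd k j g xs)" "wdeg (upd k j g xs) = wdeg xs + j"
    using assms(3) lin_hom_closed[OF assms(2)] by (simp_all add: upd_def upd_conv_take_nth_drop)
qed

end

locale dg_mod = graded_mod R V for R :: "('r, 'z) ring_scheme" and V :: "int \<Rightarrow> ('r, 'v) module" +
  fixes \<delta> :: "int \<Rightarrow> 'v \<Rightarrow> 'v"
  assumes dg: "dgmodule R V \<delta>"
begin

lemma delta_hom: "\<delta> p \<in> lin_hom R (V p) (V (p - 1))"
  using dg by (simp add: dgmodule_def graded_hom_simps)

lemma delta_hom': "\<delta> p \<in> lin_hom R (V p) (V (p + (-1)))"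
  using delta_hom by simp

lemmas delta_closed = lin_hom_closed[OF delta_hom]

lemma delta_delta: "x \<in> carrier (V p) \<Longrightarrow> q = p - 1 \<Longrightarrow> \<delta> q (\<delta> p x) = \<zero>\<^bsub>V (p - 2)\<^esub>"
proof -
  assume x: "x \<in> carrier (V p)" "q = p - 1"
  have "graded_comp V \<delta> (-1) \<delta> = \<zero>\<^bsub>graded_hom R V V (-2)\<^esub>" using dg by (simp add: dgmodule_def)
  from fun_cong[OF fun_cong[OF this, of p], of x] show ?thesis
    using x by (simp add: graded_comp_def graded_hom_simps compose_def)
qed

lemma delta_zero: "\<delta> p \<zero>\<^bsub>V p\<^esub> = \<zero>\<^bsub>V (p - 1)\<^esub>"
  by (rule lin_hom_zero[OF delta_hom V_module V_module])

lemma tensor_diff_spec: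
  shows tensor_diff_closed:
      "tensor_diff R V \<delta> n \<in> carrier (graded_hom R (tensor_power R V n) (tensor_power R V n) (-1))"
    and teval_tensor_diff: "\<And>xs. word_ok V xs \<Longrightarrow> length xs = n \<Longrightarrow>
      ev (tensor_diff R V \<delta> n) xs = (\<Oplus>\<^bsub>tensor_power R V n (wdeg xs - 1)\<^esub>k\<in>{..<n}.
        ksign (tensor_power R V n (wdeg xs - 1)) (wdeg (take k xs)) (pure_tensor R V (upd k (-1) \<delta> xs)))"
proof -
  have "multilinear R V n (tensor_power R V n) (0 + - 1)
     (\<lambda>xs. ksign (tensor_power R V n (wdeg xs + (0 + -1))) ((\<lambda>ds. sum_list (take k ds)) (map fst xs))
         (pure_tensor R V (upd k (-1) \<delta> xs)))" if "k \<in> {..<n}" for k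
    by (rule multilinear_ksign[OF multilinear_upd[OF pure_tensor_multilinear delta_hom'] tensor_power_graded])
      (use that in auto)
  from multilinear_finsum[OF this tensor_power_graded, of "{..<n}" "\<lambda>k. k"]
  have *: "multilinear R V n (tensor_power R V n) (-1) (\<lambda>xs. \<Oplus>\<^bsub>tensor_power R V n (wdeg xs - 1)\<^esub>k\<in>{..<n}.
        ksign (tensor_power R V n (wdeg xs - 1)) (wdeg (take k xs)) (pure_tensor R V (upd k (-1) \<delta> xs)))"
    by (simp add: wdeg_def take_map)
  have eq: "tensor_diff R V \<delta> n = tensor_lift R V n (tensor_power R V n) (-1)
     (\<lambda>xs. \<Oplus>\<^bsub>tensor_power R V n (wdeg xs - 1)\<^esub>k\<in>{..<n}.
        ksign (tensor_power R V n (wdeg xs - 1)) (wdeg (take k xs)) (pure_tensor R V (upd k (-1) \<delta> xs)))"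
    by (simp add: tensor_diff_def Let_def upd_def)
  show "tensor_diff R V \<delta> n \<in> carrier (graded_hom R (tensor_power R V n) (tensor_power R V n) (-1))"
    unfolding eq by (rule tensor_lift_closed[OF tensor_power_graded *])
  show "ev (tensor_diff R V \<delta> n) xs = (\<Oplus>\<^bsub>tensor_power R V n (wdeg xs - 1)\<^esub>k\<in>{..<n}.
        ksign (tensor_power R V n (wdeg xs - 1)) (wdeg (take k xs)) (pure_tensor R V (upd k (-1) \<delta> xs)))"
    if "word_ok V xs" "length xs = n" for xs
    unfolding eq using teval_tensor_lift[OF tensor_power_graded * that] .
qed

lemma End_diff_spec:
  assumes f: "f \<in> carrier (E n i)"
  shows End_diff_closed: "End_diff R V \<delta> n i f \<in> carrier (E n (i - 1))"
    and teval_End_diff: "\<And>xs d. word_ok V xs \<Longrightarrow> length xs = n \<Longrightarrow> d = wdeg xs + i - 1 \<Longrightarrow>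
      ev (End_diff R V \<delta> n i f) xs = \<delta> (wdeg xs + i) (ev f xs) \<ominus>\<^bsub>V d\<^esub>
        ksign (V d) i (\<Oplus>\<^bsub>V d\<^esub>k\<in>{..<n}. ksign (V d) (wdeg (take k xs)) (ev f (upd k (-1) \<delta> xs)))"
proof -
  let ?T = "tensor_power R V n"
  let ?E = "E n (i - 1)"
  have f': "f \<in> carrier (graded_hom R ?T V i)" using f by (simp add: End_mod_def)
  have d': "\<delta> \<in> carrier (graded_hom R V V (-1))" using delta_hom by (simp add: graded_hom_simps)
  have 1: "graded_comp ?T \<delta> i f \<in> carrier ?E"
    using graded_comp_closed[OF d' f' tensor_power_graded] by (simp add: End_mod_def)
  have 2: "graded_comp ?T f (-1) (tensor_diff R V \<delta> n) \<in> carrier ?E"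
    using graded_comp_closed[OF f' tensor_diff_closed tensor_power_graded] by (simp add: End_mod_def)
  have eq: "End_diff R V \<delta> n i f =
      graded_comp ?T \<delta> i f \<ominus>\<^bsub>?E\<^esub> ksign ?E i (graded_comp ?T f (-1) (tensor_diff R V \<delta> n))"
    by (simp add: End_diff_def hom_diff_def End_mod_def)
  show "End_diff R V \<delta> n i f \<in> carrier ?E"
    unfolding eq using 1 2 by (intro E.M.minus_closed E.ksign_closed)
  fix xs d assume xs: "word_ok V xs" "length xs = n" and d: "d = wdeg xs + i - 1"
  let ?T' = "tensor_power R V n (wdeg xs - 1)"
  have fd: "f (wdeg xs - 1) \<in> lin_hom R ?T' (V d)"
  proof -
    have "f (wdeg xs - 1) \<in> lin_hom R ?T' (V (wdeg xs - 1 + i))" using f' by (simp add: graded_hom_simps)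
    moreover have "wdeg xs - 1 + i = d" using d by simp
    ultimately show ?thesis by metis
  qed
  have u: "pure_tensor R V (upd k (-1) \<delta> xs) \<in> carrier ?T'" if "k < n" for k
    by (rule multilinear_closed[OF pure_tensor_multilinear])
      (use upd_ok[OF xs(1) delta_hom'] that xs in auto)
  have "ev (graded_comp ?T f (-1) (tensor_diff R V \<delta> n)) xs = f (wdeg xs - 1)
     (\<Oplus>\<^bsub>?T'\<^esub>k\<in>{..<n}. ksign ?T' (wdeg (take k xs)) (pure_tensor R V (upd k (-1) \<delta> xs)))"
    by (simp add: teval_graded_comp[OF xs] teval_tensor_diff[OF xs])
  also have "\<dots> = (\<Oplus>\<^bsub>V d\<^esub>k\<in>{..<n}. f (wdeg xs - 1) (ksign ?T' (wdeg (take k xs)) (pure_tensor R V (upd k (-1) \<delta> xs))))"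
    by (rule lin_hom_finsum[OF fd T.module_axioms V_module]) (use u in auto)
  also have "\<dots> = (\<Oplus>\<^bsub>V d\<^esub>k\<in>{..<n}. ksign (V d) (wdeg (take k xs)) (ev f (upd k (-1) \<delta> xs)))"
    by (rule V.M.finsum_cong')
      (use u upd_ok[OF xs(1) delta_hom'] xs lin_hom_closed[OF fd] in
        \<open>auto simp: lin_hom_ksign[OF fd T.module_axioms V_module] teval_def\<close>)
  finally show "ev (End_diff R V \<delta> n i f) xs = \<delta> (wdeg xs + i) (ev f xs) \<ominus>\<^bsub>V d\<^esub>
        ksign (V d) i (\<Oplus>\<^bsub>V d\<^esub>k\<in>{..<n}. ksign (V d) (wdeg (take k xs)) (ev f (upd k (-1) \<delta> xs)))"
    unfolding eq using 1 2 xs d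
    by (simp add: teval_minus[where d = d] teval_ksign[where d = d] teval_graded_comp)
qed

end

section \<open>Bilinearity of the pre-Lie product\<close>

context graded_mod begin

text \<open>
  Linearity of a map between cochain modules can be tested after evaluation on words, where a
  composite is a signed sum of linear maps.
\<close>

lemma End_lin_homI:
  assumes c: "\<And>f. f \<in> carrier (E n i) \<Longrightarrow> \<Phi> f \<in> carrier (E n' i')"
    and l: "\<And>xs. word_ok V xs \<Longrightarrow> length xs = n' \<Longrightarrow>
      (\<lambda>f\<in>carrier (E n i). ev (\<Phi> f) xs) \<in> lin_hom R (E n i) (V (wdeg xs + i'))"
  shows "(\<lambda>f\<in>carrier (E n i). \<Phi> f) \<in> lin_hom R (E n i) (E n' i')"
proof (rule lin_hom_restrictI[OF End_module c])
  let ?E = "E n i" and ?E' = "E n' i'"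
  show "\<Phi> (f \<oplus>\<^bsub>?E\<^esub> g) = \<Phi> f \<oplus>\<^bsub>?E'\<^esub> \<Phi> g" if f: "f \<in> carrier ?E" and g: "g \<in> carrier ?E" for f g
  proof (rule End_ext[OF c[OF E.M.a_closed[OF f g]] E.M.a_closed[OF c[OF f] c[OF g]]])
    fix xs assume xs: "word_ok V xs" "length xs = n'"
    show "ev (\<Phi> (f \<oplus>\<^bsub>?E\<^esub> g)) xs = ev (\<Phi> f \<oplus>\<^bsub>?E'\<^esub> \<Phi> g) xs"
      using lin_hom_add[OF l[OF xs] f g] f g by (simp add: teval_add[OF xs refl c[OF f] c[OF g]])
  qed
  show "\<Phi> (a \<odot>\<^bsub>?E\<^esub> f) = a \<odot>\<^bsub>?E'\<^esub> \<Phi> f" if a: "a \<in> carrier R" and f: "f \<in> carrier ?E" for a f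
  proof (rule End_ext[OF c[OF E.smult_closed[OF a f]] E.smult_closed[OF a c[OF f]]])
    fix xs assume xs: "word_ok V xs" "length xs = n'"
    show "ev (\<Phi> (a \<odot>\<^bsub>?E\<^esub> f)) xs = ev (a \<odot>\<^bsub>?E'\<^esub> \<Phi> f) xs"
      using lin_hom_smult[OF l[OF xs] a f] a f by (simp add: teval_smult[OF xs refl a c[OF f]])
  qed
qed

lemma circ_lin_left:
  assumes g: "g \<in> carrier (E m j)" and n: "1 \<le> n"
  shows "(\<lambda>f\<in>carrier (E n i). circ R V n i m j f g)
     \<in> lin_hom R (E n i) (E (n + m - 1) (i + j))"
proof (rule End_lin_homI[OF circ_closed[OF _ g]])
  let ?E = "E n i"
  fix xs assume xs: "word_ok V xs" "length xs = n + m - 1"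
  let ?d = "wdeg xs + (i + j)"
  let ?l = "\<lambda>(us, ys, vs). \<lambda>f\<in>carrier ?E. ksign (V ?d) (circ_sign j us ys vs)
     ((\<lambda>f\<in>carrier ?E. ev f (us @ (wdeg ys + j, ev g ys) # vs)) f)"
  have l: "?l t \<in> lin_hom R ?E (V ?d)" if t: "t \<in> splits m xs" for t
  proof -
    obtain us ys vs where t': "t = (us, ys, vs)" by (cases t) auto
    note ok = splits_ok[OF t[unfolded t'] xs(1)]
    have w: "word_ok V (us @ (wdeg ys + j, ev g ys) # vs)"
      using ok teval_closed[OF g ok(2,4) refl] by simp
    show ?thesis unfolding t' prod.case
      by (rule lin_hom_ksignI[OF teval_lin_hom[OF w] End_module V_module]) (use ok xs n in auto)
  qed
  have "(\<lambda>f\<in>carrier ?E. ev (circ R V n i m j f g) xs)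
      = (\<lambda>f\<in>carrier ?E. \<Oplus>\<^bsub>V ?d\<^esub>t\<in>splits m xs. ?l t f)"
  proof (rule restrict_ext)
    fix f assume f: "f \<in> carrier ?E"
    show "ev (circ R V n i m j f g) xs = (\<Oplus>\<^bsub>V ?d\<^esub>t\<in>splits m xs. ?l t f)"
      unfolding teval_circ[OF f g xs n refl]
      by (rule V.M.finsum_cong') (use lin_hom_closed[OF l f] f in auto)
  qed
  then show "(\<lambda>f\<in>carrier ?E. ev (circ R V n i m j f g) xs) \<in> lin_hom R ?E (V ?d)"
    using lin_hom_finsumI[OF l End_module V_module splits_finite] by simp
qed

lemma circ_lin_right:
  assumes f: "f \<in> carrier (E n i)" and n: "1 \<le> n"
  shows "(\<lambda>g\<in>carrier (E m j). circ R V n i m j f g)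
     \<in> lin_hom R (E m j) (E (n + m - 1) (i + j))"
proof (rule End_lin_homI[OF circ_closed[OF f]])
  let ?E = "E m j"
  fix xs assume xs: "word_ok V xs" "length xs = n + m - 1"
  let ?d = "wdeg xs + (i + j)"
  let ?s = "\<lambda>us ys vs. \<lambda>x\<in>carrier (V (wdeg ys + j)). ev f (us @ (wdeg ys + j, x) # vs)"
  let ?l = "\<lambda>(us, ys, vs). \<lambda>g\<in>carrier ?E. ksign (V ?d) (circ_sign j us ys vs)
     (compose (carrier ?E) (?s us ys vs) (\<lambda>g\<in>carrier ?E. ev g ys) g)"
  have l: "?l t \<in> lin_hom R ?E (V ?d)" if t: "t \<in> splits m xs" for t
  proof -
    obtain us ys vs where t': "t = (us, ys, vs)" by (cases t) auto
    note ok = splits_ok[OF t[unfolded t'] xs(1)]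
    have s: "?s us ys vs \<in> lin_hom R (V (wdeg ys + j)) (V ?d)"
      by (rule teval_slot[OF f ok(1,3)]) (use ok xs n in auto)
    show ?thesis unfolding t' prod.case
      by (rule lin_hom_ksignI[OF lin_hom_comp[OF teval_lin_hom[OF ok(2,4) refl] s End_module] End_module V_module])
  qed
  have "(\<lambda>g\<in>carrier ?E. ev (circ R V n i m j f g) xs)
      = (\<lambda>g\<in>carrier ?E. \<Oplus>\<^bsub>V ?d\<^esub>t\<in>splits m xs. ?l t g)"
  proof (rule restrict_ext)
    fix g assume g: "g \<in> carrier ?E"
    have "ev g ys \<in> carrier (V (wdeg ys + j))" if "(us, ys, vs) \<in> splits m xs" for us ys vs
      using teval_closed[OF g splits_ok(2,4)[OF that xs(1)] refl] .
    then show "ev (circ R V n i m j f g) xs = (\<Oplus>\<^bsub>V ?d\<^esub>t\<in>splits m xs. ?l t g)"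
      unfolding teval_circ[OF f g xs n refl]
      by (intro V.M.finsum_cong') (use lin_hom_closed[OF l g] g in \<open>auto simp: compose_def\<close>)
  qed
  then show "(\<lambda>g\<in>carrier ?E. ev (circ R V n i m j f g) xs) \<in> lin_hom R ?E (V ?d)"
    using lin_hom_finsumI[OF l End_module V_module splits_finite] by simp
qed

lemma circ_zero_left:
  assumes "g \<in> carrier (E m j)" "1 \<le> n"
  shows "circ R V n i m j \<zero>\<^bsub>E n i\<^esub> g = \<zero>\<^bsub>E (n + m - 1) (i + j)\<^esub>"
  using lin_hom_zero[OF circ_lin_left[OF assms] End_module End_module] by simp

lemma circ_zero_right:
  assumes "f \<in> carrier (E n i)" "1 \<le> n"
  shows "circ R V n i m j f \<zero>\<^bsub>E m j\<^esub> = \<zero>\<^bsub>E (n + m - 1) (i + j)\<^esub>"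
  using lin_hom_zero[OF circ_lin_right[OF assms] End_module End_module] by simp

lemma circ_minus_left:
  assumes "g \<in> carrier (E m j)" "1 \<le> n"
    and "f \<in> carrier (E n i)" "f' \<in> carrier (E n i)"
  shows "circ R V n i m j (f \<ominus>\<^bsub>E n i\<^esub> f') g
    = circ R V n i m j f g \<ominus>\<^bsub>E (n + m - 1) (i + j)\<^esub> circ R V n i m j f' g"
  using lin_hom_minus[OF circ_lin_left[OF assms(1,2)] End_module End_module assms(3,4)] assms(3,4)
  by (simp add: E.M.minus_closed)

lemma circ_minus_right:
  assumes "f \<in> carrier (E n i)" "1 \<le> n"
    and "g \<in> carrier (E m j)" "g' \<in> carrier (E m j)"
  shows "circ R V n i m j f (g \<ominus>\<^bsub>E m j\<^esub> g')
    = circ R V n i m j f g \<ominus>\<^bsub>E (n + m - 1) (i + j)\<^esub> circ R V n i m j f g'"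
  using lin_hom_minus[OF circ_lin_right[OF assms(1,2)] End_module End_module assms(3,4)] assms(3,4)
  by (simp add: E.M.minus_closed)

end

section \<open>The square of a family of odd operations\<close>

text \<open>
  When a whole family of operations is inserted, blocks of all lengths occur.  The middle block is
  nonempty because the families of interest start in arity one.
\<close>

definition nesplits :: "'v word \<Rightarrow> ('v word \<times> 'v word \<times> 'v word) set" where
  "nesplits xs = {(us, ys, vs). us @ ys @ vs = xs \<and> ys \<noteq> []}"

text \<open>
  The component of arity \<open>N\<close> of the product of two families; the members of arity \<open>i\<close> have degrees
  \<open>i - \<alpha>\<close> and \<open>i - \<beta>\<close>.  The operations of an \<open>A\<^sub>\<infinity>\<close>-structure have \<open>\<alpha> = 2\<close>, and the product of two such
  families is again a family of this kind, with \<open>\<alpha> = 3\<close>.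
\<close>

definition family_circ ::
  "('r, 'z) ring_scheme \<Rightarrow> (int \<Rightarrow> ('r, 'v) module) \<Rightarrow> int \<Rightarrow> int \<Rightarrow> (nat \<Rightarrow> ('r, 'v) cochain) \<Rightarrow>
   (nat \<Rightarrow> ('r, 'v) cochain) \<Rightarrow> nat \<Rightarrow> ('r, 'v) cochain" where
  "family_circ R V \<alpha> \<beta> F G N = (\<Oplus>\<^bsub>End_mod R V N (int N + 1 - \<alpha> - \<beta>)\<^esub>i\<in>{1..N}.
     circ R V i (int i - \<alpha>) (N + 1 - i) (int (N + 1 - i) - \<beta>) (F i) (G (N + 1 - i)))"

context graded_mod begin

lemma nesplits_finite: "finite (nesplits xs)"
proof (rule finite_subset)
  show "nesplits xs \<subseteq> (\<Union>m\<in>{..length xs}. splits m xs)"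
    by (auto simp: nesplits_def splits_def)
qed (auto simp: splits_finite)

lemma family_summand_closed:
  assumes F: "\<And>i. F i \<in> carrier (E i (int i - \<alpha>))"
    and G: "\<And>i. G i \<in> carrier (E i (int i - \<beta>))"
    and i: "i \<in> {1..N}"
  shows "circ R V i (int i - \<alpha>) (N + 1 - i) (int (N + 1 - i) - \<beta>) (F i) (G (N + 1 - i))
     \<in> carrier (E N (int N + 1 - \<alpha> - \<beta>))"
proof -
  have "i + (N + 1 - i) - 1 = N" "int i - \<alpha> + (int (N + 1 - i) - \<beta>) = int N + 1 - \<alpha> - \<beta>"
    using i by auto
  then show ?thesis using circ_closed[OF F G, of i "N + 1 - i"] by metis
qed

lemma family_circ_closed:
  assumes "\<And>i. F i \<in> carrier (E i (int i - \<alpha>))"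
    and "\<And>i. G i \<in> carrier (E i (int i - \<beta>))"
  shows "family_circ R V \<alpha> \<beta> F G N \<in> carrier (E N (int N + 1 - \<alpha> - \<beta>))"
  unfolding family_circ_def
  by (rule E.M.finsum_closed) (use family_summand_closed[OF assms] in blast)

lemma teval_family_circ:
  assumes F: "\<And>i. F i \<in> carrier (E i (int i - \<alpha>))"
    and G: "\<And>i. G i \<in> carrier (E i (int i - \<beta>))"
    and xs: "word_ok V xs" "length xs = N" and d: "d = wdeg xs + (int N + 1 - \<alpha> - \<beta>)"
  shows "ev (family_circ R V \<alpha> \<beta> F G N) xs = finsum (V d) (\<lambda>(us, ys, vs).
     ksign (V d) (circ_sign (int (length ys) - \<beta>) us ys vs)
       (ev (F (length us + 1 + length vs))
          (us @ (wdeg ys + (int (length ys) - \<beta>), ev (G (length ys)) ys) # vs))) (nesplits xs)"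
proof -
  let ?t = "\<lambda>(us, ys, vs). ksign (V d) (circ_sign (int (length ys) - \<beta>) us ys vs)
       (ev (F (length us + 1 + length vs))
          (us @ (wdeg ys + (int (length ys) - \<beta>), ev (G (length ys)) ys) # vs))"
  have c: "?t t \<in> carrier (V d)" if "t \<in> splits m xs" for t m
  proof -
    obtain us ys vs where t: "t = (us, ys, vs)" by (cases t) auto
    note ok = splits_ok[OF that[unfolded t] xs(1)]
    have "ev (F (length us + 1 + length vs))
          (us @ (wdeg ys + (int (length ys) - \<beta>), ev (G (length ys)) ys) # vs) \<in> carrier (V d)"
      by (rule teval_closed[OF F]) (use ok teval_closed[OF G ok(2) refl refl] d xs in auto)
    then show ?thesis by (simp add: t)
  qed
  have "ev (family_circ R V \<alpha> \<beta> F G N) xs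
     = (\<Oplus>\<^bsub>V d\<^esub>i\<in>{1..N}. ev (circ R V i (int i - \<alpha>) (N + 1 - i) (int (N + 1 - i) - \<beta>) (F i) (G (N + 1 - i))) xs)"
    unfolding family_circ_def
    by (rule teval_finsum[OF xs d]) (rule family_summand_closed[OF F G])
  also have "\<dots> = (\<Oplus>\<^bsub>V d\<^esub>i\<in>{1..N}. finsum (V d) ?t (splits (N + 1 - i) xs))"
  proof (rule V.M.finsum_cong'[OF refl], goal_cases)
    case 1
    show ?case using c by (auto intro!: V.M.finsum_closed)
  next
    case (2 i)
    then have e: "length xs = i + (N + 1 - i) - 1" "1 \<le> i" "d = wdeg xs + (int i - \<alpha> + (int (N + 1 - i) - \<beta>))"
      using xs d by auto
    show ?case unfolding teval_circ[OF F G xs(1) e]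
    proof (rule V.M.finsum_cong'[OF refl])
      show "?t \<in> splits (N + 1 - i) xs \<rightarrow> carrier (V d)" using c by blast
      fix t assume t': "t \<in> splits (N + 1 - i) xs"
      obtain us ys vs where t: "t = (us, ys, vs)" by (cases t) auto
      have "length ys = N + 1 - i" "length us + 1 + length vs = i"
        using splits_ok(4,5)[OF t'[unfolded t] xs(1)] 2 xs(2) by auto
      then show "(case t of (us, ys, vs) \<Rightarrow> ksign (V d) (circ_sign (int (N + 1 - i) - \<beta>) us ys vs)
           (ev (F i) (us @ (wdeg ys + (int (N + 1 - i) - \<beta>), ev (G (N + 1 - i)) ys) # vs))) = ?t t"
        by (simp only: t prod.case)
    qed
  qed
  also have "\<dots> = finsum (V d) (\<lambda>(i, t). ?t t) (Sigma {1..N} (\<lambda>i. splits (N + 1 - i) xs))"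
    by (rule V.finsum_Sigma) (use c splits_finite in auto)
  also have "\<dots> = finsum (V d) ?t (nesplits xs)"
  proof (rule V.finsum_bij[symmetric, of snd])
    show "inj_on snd (Sigma {1..N} (\<lambda>i. splits (N + 1 - i) xs))"
      by (auto simp: inj_on_def splits_def)
    show "snd ` Sigma {1..N} (\<lambda>i. splits (N + 1 - i) xs) = nesplits xs"
    proof (intro Set.set_eqI iffI)
      fix t assume "t \<in> nesplits xs"
      then obtain us ys vs where t: "t = (us, ys, vs)" "us @ ys @ vs = xs" "ys \<noteq> []"
        by (auto simp: nesplits_def)
      moreover have "length ys > 0" "length us + length ys + length vs = N" using t xs(2) by auto
      ultimately show "t \<in> snd ` Sigma {1..N} (\<lambda>i. splits (N + 1 - i) xs)"
        by (intro image_eqI[of _ _ "(length us + 1 + length vs, t)"]) (auto simp: splits_def Suc_le_eq)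
    qed (auto simp: nesplits_def splits_def)
  qed (use c in auto)
  finally show ?thesis .
qed

lemma family_circ_cong:
  assumes "\<And>i. F' i \<in> carrier (E i (int i - \<alpha>))" "\<And>i. G' i \<in> carrier (E i (int i - \<beta>))"
    and "\<And>i. i \<in> {1..N} \<Longrightarrow> F i = F' i" "\<And>i. i \<in> {1..N} \<Longrightarrow> G i = G' i"
  shows "family_circ R V \<alpha> \<beta> F G N = family_circ R V \<alpha> \<beta> F' G' N"
  unfolding family_circ_def
proof (rule E.M.finsum_cong'[OF refl])
  show "(\<lambda>i. circ R V i (int i - \<alpha>) (N + 1 - i) (int (N + 1 - i) - \<beta>) (F' i) (G' (N + 1 - i)))
     \<in> {1..N} \<rightarrow> carrier (E N (int N + 1 - \<alpha> - \<beta>))"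
    using family_summand_closed[OF assms(1,2)] by blast
  fix i assume "i \<in> {1..N}"
  then have "i \<in> {1..N}" "N + 1 - i \<in> {1..N}" by auto
  then show "circ R V i (int i - \<alpha>) (N + 1 - i) (int (N + 1 - i) - \<beta>) (F i) (G (N + 1 - i))
     = circ R V i (int i - \<alpha>) (N + 1 - i) (int (N + 1 - i) - \<beta>) (F' i) (G' (N + 1 - i))"
    using assms(3,4) by simp
qed

end

text \<open>
  The parities for inner cochains of degree \<open>m - 2\<close> (odd weight) and \<open>m - 3\<close> (even weight), where \<open>m\<close>
  is the arity.  Every sign in the proof of associativity is of one of these two kinds.
\<close>

lemma circ_sign_even:
  "even (circ_sign (int (length ys) - 2) us ys vs)
     \<longleftrightarrow> even (int (length ys) * (wdeg us + int (length us)) + int (length vs))"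
  "even (circ_sign (int (length ys) - 3) us ys vs)
     \<longleftrightarrow> even ((int (length ys) - 1) * (wdeg us + int (length us)))"
  by (simp_all add: circ_sign_def) blast+

text \<open>
  A block in a word with a marked letter lies after the marker, before it, or around it.  The marker
  is the value of the operation applied first.
\<close>

lemma nesplits_marker:
  assumes "(a, b, c) \<in> nesplits (us @ l # vs)"
  shows "length a > length us \<Longrightarrow> \<exists>a2. a = us @ l # a2 \<and> a2 @ b @ c = vs"
    and "length a + length b \<le> length us \<Longrightarrow> \<exists>c1. c = c1 @ l # vs \<and> a @ b @ c1 = us"
    and "length a \<le> length us \<Longrightarrow> length a + length b > length us \<Longrightarrow>
      \<exists>b1 b2. b = b1 @ l # b2 \<and> a @ b1 = us \<and> b2 @ c = vs"
  using assms
  by (auto simp: nesplits_def append_eq_append_conv2 append_eq_Cons_conv Cons_eq_append_conv)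

context graded_mod begin

lemma family_square_closed:
  assumes "\<And>i. m i \<in> carrier (E i (int i - 2))"
  shows "family_circ R V 2 2 m m i \<in> carrier (E i (int i - 3))"
  using family_circ_closed[OF assms assms] by simp

text \<open>
  For a single odd element \<open>m\<close> of a pre-Lie algebra of this kind, \<open>(m \<circ> m) \<circ> m - m \<circ> (m \<circ> m)\<close> is the
  sum of all \<open>m(\<dots>, m(\<dots>), \<dots>, m(\<dots>), \<dots>)\<close>, once for each order in which the two inner operations are
  applied.  The two orders differ by the sign for exchanging two odd operations, so they cancel
  exactly; no division by two is involved.
\<close>

lemma family_square_assoc:
  assumes m: "\<And>i. m i \<in> carrier (E i (int i - 2))"
  shows "family_circ R V 2 3 m (family_circ R V 2 2 m m) N = family_circ R V 3 2 (family_circ R V 2 2 m m) m N"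
proof -
  define D where "D = family_circ R V 2 2 m m"
  have D: "D i \<in> carrier (E i (int i - 3))" for i
    unfolding D_def by (rule family_square_closed[OF m])
  define M where "M w = ev (m (length w)) w" for w
  define L where "L y = (wdeg y + (int (length y) - 2), M y)" for y
  have Mc: "M w \<in> carrier (V e)" if "word_ok V w" "e = wdeg w + (int (length w) - 2)" for w e
    unfolding M_def by (rule teval_closed[OF m that(1) refl that(2)])
  have L: "fst (L y) = wdeg y + (int (length y) - 2)" "snd (L y) = M y" for y
    by (simp_all add: L_def)
  have Lc: "snd (L y) \<in> carrier (V (fst (L y)))" if "word_ok V y" for y
    using Mc[OF that refl] by (simp add: L)
  have Dv: "ev (D (length w)) w = finsum (V e) (\<lambda>(a, b, c).
      ksign (V e) (circ_sign (int (length b) - 2) a b c) (M (a @ L b # c))) (nesplits w)"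
    if "word_ok V w" "e = wdeg w + (int (length w) - 3)" for w e
    using teval_family_circ[OF m m that(1) refl, of e] that(2) by (simp add: D_def M_def L_def)
  have inner: "word_ok V a" "word_ok V b" "word_ok V c" "length a + length b + length c = length w"
    "wdeg a + wdeg b + wdeg c = wdeg w"
    if "(a, b, c) \<in> nesplits w" "word_ok V w" for a b c w
    using that by (auto simp: nesplits_def)
  have Mc': "M (a @ L b # c) \<in> carrier (V e)"
    if "(a, b, c) \<in> nesplits w" "word_ok V w" "e = wdeg w + (int (length w) - 3)" for a b c w e
    using inner[OF that(1,2)] that(3) Lc by (intro Mc) (auto simp: L)
  show ?thesis
    unfolding D_def[symmetric]
  proof (rule End_ext)
    show "family_circ R V 2 3 m D N \<in> carrier (E N (int N - 4))"
      using family_circ_closed[OF m D] by simp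
    show "family_circ R V 3 2 D m N \<in> carrier (E N (int N - 4))"
      using family_circ_closed[OF D m] by simp
    fix xs assume xs: "word_ok V xs" "length xs = N"
    define d where "d = wdeg xs + (int N - 4)"

    \<comment> \<open>The summands of the two composites where the inner operations are nested.\<close>
    define nest where "nest a b1 y b2 c = ksign (V d)
       (circ_sign (int (length (b1 @ y @ b2)) - 3) a (b1 @ y @ b2) c + circ_sign (int (length y) - 2) b1 y b2)
       (M (a @ L (b1 @ L y # b2) # c))" for a b1 y b2 c
    have nestc: "nest a b1 y b2 c \<in> carrier (V d)" if "a @ b1 @ y @ b2 @ c = xs" for a b1 y b2 c
    proof -
      have ok: "word_ok V a" "word_ok V b1" "word_ok V y" "word_ok V b2" "word_ok V c"
        using that xs by auto
      have "M (a @ L (b1 @ L y # b2) # c) \<in> carrier (V d)"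
      proof (rule Mc)
        have "word_ok V (b1 @ L y # b2)" using ok Lc by simp
        then show "word_ok V (a @ L (b1 @ L y # b2) # c)" using ok Lc by simp
        show "d = wdeg (a @ L (b1 @ L y # b2) # c) + (int (length (a @ L (b1 @ L y # b2) # c)) - 2)"
          using that xs by (auto simp: L d_def)
      qed
      then show ?thesis by (simp add: nest_def)
    qed
    \<comment> \<open>Nested composites are indexed by \<open>Q1\<close>, composites with two disjoint inner blocks \<open>y\<close> and \<open>z\<close> by \<open>Q2\<close>.\<close>
    define Q1 where "Q1 = {(a, b1, y, b2, c). a @ b1 @ y @ b2 @ c = xs \<and> y \<noteq> []}"
    define Q2 where "Q2 = {(a, y, b, z, c). a @ y @ b @ z @ c = xs \<and> y \<noteq> [] \<and> z \<noteq> []}"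

    have "ev (family_circ R V 2 3 m D N) xs = finsum (V d) (\<lambda>(us, ys, vs).
         ksign (V d) (circ_sign (int (length ys) - 3) us ys vs)
           (M (us @ (wdeg ys + (int (length ys) - 3), ev (D (length ys)) ys) # vs))) (nesplits xs)"
      using teval_family_circ[OF m D xs, of d] by (simp add: d_def M_def)
    also have "\<dots> = finsum (V d) (\<lambda>t. finsum (V d) (\<lambda>s. (\<lambda>(us, ys, vs) (a, b, c). nest us a b c vs) t s)
        (nesplits (fst (snd t)))) (nesplits xs)"
    proof (rule V.M.finsum_cong'[OF refl])
      show "(\<lambda>t. finsum (V d) (\<lambda>s. (\<lambda>(us, ys, vs) (a, b, c). nest us a b c vs) t s) (nesplits (fst (snd t))))
         \<in> nesplits xs \<rightarrow> carrier (V d)"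
        by (auto simp: nesplits_def intro!: V.M.finsum_closed nestc)
      fix t assume t': "t \<in> nesplits xs"
      obtain us ys vs where t: "t = (us, ys, vs)" by (cases t) auto
      note ok = inner[OF t'[unfolded t] xs(1)]
      let ?q = "wdeg ys + (int (length ys) - 3)"
      have S: "(\<lambda>x\<in>carrier (V ?q). M (us @ (?q, x) # vs)) \<in> lin_hom R (V ?q) (V d)"
        unfolding M_def length_append list.size
        by (rule teval_slot[OF m ok(1,3)]) (use ok xs in \<open>auto simp: d_def\<close>)
      let ?k = "\<lambda>(a, b, c). ksign (V ?q) (circ_sign (int (length b) - 2) a b c) (M (a @ L b # c))"
      have kc: "?k s \<in> carrier (V ?q)" if "s \<in> nesplits ys" for s
        using that Mc'[OF _ ok(2) refl] by (cases s) auto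
      have Dc: "ev (D (length ys)) ys \<in> carrier (V ?q)"
        by (rule teval_closed[OF D ok(2)]) auto
      have "M (us @ (?q, ev (D (length ys)) ys) # vs)
         = (\<lambda>x\<in>carrier (V ?q). M (us @ (?q, x) # vs)) (finsum (V ?q) ?k (nesplits ys))"
        using Dc unfolding Dv[OF ok(2) refl] by simp
      also have "\<dots> = (\<Oplus>\<^bsub>V d\<^esub>s\<in>nesplits ys. (\<lambda>x\<in>carrier (V ?q). M (us @ (?q, x) # vs)) (?k s))"
        by (rule lin_hom_finsum[OF S V_module V_module]) (rule kc)
      also have "\<dots> = finsum (V d) (\<lambda>(a, b, c). ksign (V d) (circ_sign (int (length b) - 2) a b c)
          (M (us @ L (a @ L b # c) # vs))) (nesplits ys)"
      proof (rule V.M.finsum_cong'[OF refl], rule Pi_I)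
        fix s assume s': "s \<in> nesplits ys"
        obtain a b c where s: "s = (a, b, c)" by (cases s) auto
        have L': "L (a @ L b # c) = (?q, M (a @ L b # c))"
          using inner(4,5)[OF s'[unfolded s] ok(2)] by (simp add: L_def)
        note Mk = Mc'[OF s'[unfolded s] ok(2) refl]
        show "(\<lambda>x\<in>carrier (V ?q). M (us @ (?q, x) # vs)) (?k s) = (case s of (a, b, c) \<Rightarrow>
          ksign (V d) (circ_sign (int (length b) - 2) a b c) (M (us @ L (a @ L b # c) # vs)))"
          unfolding s prod.case lin_hom_ksign[OF S V_module V_module Mk] L' using Mk by simp
        show "(case s of (a, b, c) \<Rightarrow>
          ksign (V d) (circ_sign (int (length b) - 2) a b c) (M (us @ L (a @ L b # c) # vs))) \<in> carrier (V d)"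
          unfolding s prod.case L' using lin_hom_closed[OF S Mk] Mk by simp
      qed
      finally have e: "M (us @ (?q, ev (D (length ys)) ys) # vs) = \<dots>" .
      have c: "M (us @ L (a @ L b # c) # vs) \<in> carrier (V d)" if "(a, b, c) \<in> nesplits ys" for a b c
      proof -
        have "L (a @ L b # c) = (?q, M (a @ L b # c))"
          using inner(4,5)[OF that ok(2)] by (simp add: L_def)
        then show ?thesis using lin_hom_closed[OF S Mc'[OF that ok(2) refl]] Mc'[OF that ok(2) refl] by simp
      qed
      show "(case t of (us, ys, vs) \<Rightarrow> ksign (V d) (circ_sign (int (length ys) - 3) us ys vs)
           (M (us @ (wdeg ys + (int (length ys) - 3), ev (D (length ys)) ys) # vs)))
         = finsum (V d) (\<lambda>s. (\<lambda>(us, ys, vs) (a, b, c). nest us a b c vs) t s) (nesplits (fst (snd t)))"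
        unfolding t prod.case e fst_conv snd_conv
        by (subst V.ksign_finsum) (use c in \<open>auto intro!: V.M.finsum_cong' simp: nest_def nesplits_def\<close>)
    qed
    also have "\<dots> = finsum (V d) (\<lambda>(t, s). (\<lambda>(us, ys, vs) (a, b, c). nest us a b c vs) t s)
        (Sigma (nesplits xs) (\<lambda>t. nesplits (fst (snd t))))"
      by (rule V.finsum_Sigma) (auto simp: nesplits_def intro!: nesplits_finite[unfolded nesplits_def] nestc)
    also have "\<dots> = finsum (V d) (\<lambda>(a, b1, y, b2, c). nest a b1 y b2 c) Q1"
      by (rule V.finsum_bij[of "\<lambda>(a, b1, y, b2, c). ((a, b1 @ y @ b2, c), (b1, y, b2))"])
        (auto simp: Q1_def nesplits_def inj_on_def image_iff intro!: nestc)
    finally have lhs: "ev (family_circ R V 2 3 m D N) xs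
        = finsum (V d) (\<lambda>(a, b1, y, b2, c). nest a b1 y b2 c) Q1" .

    \<comment> \<open>In the other composite, the outer block can contain, precede or follow the inner one.\<close>
    define u where "u = (\<lambda>(us :: 'v word, ys :: 'v word, vs :: 'v word) (a, b, c). ksign (V d)
       (circ_sign (int (length ys) - 2) us ys vs + circ_sign (int (length b) - 2) a b c) (M (a @ L b # c)))"
    define P where "P = Sigma (nesplits xs) (\<lambda>(us, ys, vs). nesplits (us @ L ys # vs))"
    have uc: "u (us, ys, vs) (a, b, c) \<in> carrier (V d)"
      if "(us, ys, vs) \<in> nesplits xs" "(a, b, c) \<in> nesplits (us @ L ys # vs)" for us ys vs a b c
    proof -
      note ok = inner[OF that(1) xs(1)]
      have "M (a @ L b # c) \<in> carrier (V d)"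
        by (rule Mc'[OF that(2)]) (use ok Lc[OF ok(2)] xs in \<open>auto simp: L d_def\<close>)
      then show ?thesis by (simp add: u_def)
    qed
    have "ev (family_circ R V 3 2 D m N) xs = finsum (V d) (\<lambda>(us, ys, vs).
         ksign (V d) (circ_sign (int (length ys) - 2) us ys vs)
           (ev (D (length us + 1 + length vs)) (us @ L ys # vs))) (nesplits xs)"
      using teval_family_circ[OF D m xs, of d] by (simp add: d_def L_def M_def)
    also have "\<dots> = finsum (V d) (\<lambda>t. finsum (V d) (u t) ((\<lambda>(us, ys, vs). nesplits (us @ L ys # vs)) t))
         (nesplits xs)"
    proof (rule V.M.finsum_cong'[OF refl])
      show "(\<lambda>t. finsum (V d) (u t) ((\<lambda>(us, ys, vs). nesplits (us @ L ys # vs)) t)) \<in> nesplits xs \<rightarrow> carrier (V d)"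
        using uc by (auto intro!: V.M.finsum_closed)
      fix t assume t': "t \<in> nesplits xs"
      obtain us ys vs where t: "t = (us, ys, vs)" by (cases t) auto
      note ok = inner[OF t'[unfolded t] xs(1)]
      have w: "word_ok V (us @ L ys # vs)" "d = wdeg (us @ L ys # vs) + (int (length (us @ L ys # vs)) - 3)"
        using ok xs Lc by (auto simp: d_def L)
      have l: "length us + 1 + length vs = length (us @ L ys # vs)" by simp
      have c: "M (a @ L b # c) \<in> carrier (V d)" if "(a, b, c) \<in> nesplits (us @ L ys # vs)" for a b c
        by (rule Mc'[OF that w])
      show "(case t of (us, ys, vs) \<Rightarrow> ksign (V d) (circ_sign (int (length ys) - 2) us ys vs)
           (ev (D (length us + 1 + length vs)) (us @ L ys # vs)))
         = finsum (V d) (u t) ((\<lambda>(us, ys, vs). nesplits (us @ L ys # vs)) t)"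
        unfolding t prod.case l Dv[OF w]
        by (subst V.ksign_finsum) (use c in \<open>auto intro!: V.M.finsum_cong' simp: u_def\<close>)
    qed
    also have "\<dots> = finsum (V d) (\<lambda>(t, s). u t s) P"
      unfolding P_def
      by (rule V.finsum_Sigma) (use uc nesplits_finite in auto)
    finally have rhs: "ev (family_circ R V 3 2 D m N) xs = finsum (V d) (\<lambda>(t, s). u t s) P" .

    \<comment> \<open>\<open>Pl\<close>, \<open>Pr\<close>, \<open>Pi\<close>: the value of the operation applied first lies to the left of, to the right of, or inside the block of the second one.\<close>
    define Pl where "Pl = {p \<in> P. length (fst (snd p)) > length (fst (fst p))}"
    define Pr where "Pr = {p \<in> P. length (fst (snd p)) + length (fst (snd (snd p))) \<le> length (fst (fst p))}"
    define Pi where "Pi = {p \<in> P. length (fst (snd p)) \<le> length (fst (fst p)) \<and>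
       length (fst (snd p)) + length (fst (snd (snd p))) > length (fst (fst p))}"
    have fP: "finite P" unfolding P_def by (rule finite_SigmaI) (auto simp: nesplits_finite)
    have uP: "u t s \<in> carrier (V d)" if "(t, s) \<in> P" for t s using uc that by (cases s) (auto simp: P_def)
    have "finsum (V d) (\<lambda>(t, s). u t s) P = finsum (V d) (\<lambda>(t, s). u t s) (Pi \<union> (Pl \<union> Pr))"
      by (rule arg_cong[where f = "finsum _ _"]) (auto simp: Pi_def Pl_def Pr_def)
    also have "\<dots> = finsum (V d) (\<lambda>(t, s). u t s) Pi \<oplus>\<^bsub>V d\<^esub> finsum (V d) (\<lambda>(t, s). u t s) (Pl \<union> Pr)"
      by (rule V.M.finsum_Un_disjoint) (use uP fP in \<open>auto simp: Pi_def Pl_def Pr_def\<close>)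
    also have "finsum (V d) (\<lambda>(t, s). u t s) (Pl \<union> Pr)
       = finsum (V d) (\<lambda>(t, s). u t s) Pl \<oplus>\<^bsub>V d\<^esub> finsum (V d) (\<lambda>(t, s). u t s) Pr"
      by (rule V.M.finsum_Un_disjoint) (use uP fP in \<open>auto simp: Pl_def Pr_def\<close>)
    also have "finsum (V d) (\<lambda>(t, s). u t s) Pi = finsum (V d) (\<lambda>(a, b1, y, b2, c). nest a b1 y b2 c) Q1"
    proof (rule V.finsum_bij[of "\<lambda>(a, b1, y, b2, c). ((a @ b1, y, b2 @ c), (a, b1 @ L y # b2, c))"])
      show "inj_on (\<lambda>(a, b1, y, b2, c). ((a @ b1, y, b2 @ c), (a, b1 @ L y # b2, c))) Q1"
        by (auto simp: inj_on_def)
      show "(\<lambda>(a, b1, y, b2, c). ((a @ b1, y, b2 @ c), (a, b1 @ L y # b2, c))) ` Q1 = Pi"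
      proof (intro equalityI subsetI)
        fix p assume p: "p \<in> Pi"
        then obtain us ys vs a b c where p': "p = ((us, ys, vs), (a, b, c))" "us @ ys @ vs = xs" "ys \<noteq> []"
          "(a, b, c) \<in> nesplits (us @ L ys # vs)" "length a \<le> length us" "length a + length b > length us"
          by (auto simp: Pi_def P_def nesplits_def)
        then obtain b1 b2 where "b = b1 @ L ys # b2" "a @ b1 = us" "b2 @ c = vs"
          using nesplits_marker(3) by blast
        then show "p \<in> (\<lambda>(a, b1, y, b2, c). ((a @ b1, y, b2 @ c), (a, b1 @ L y # b2, c))) ` Q1"
          using p' by (intro image_eqI[of _ _ "(a, b1, ys, b2, c)"]) (auto simp: Q1_def)
      qed (auto simp: Q1_def Pi_def P_def nesplits_def)
      fix q assume "q \<in> Q1"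
      then obtain a b1 y b2 c where q: "q = (a, b1, y, b2, c)" "a @ b1 @ y @ b2 @ c = xs" "y \<noteq> []"
        by (auto simp: Q1_def)
      have "even (circ_sign (int (length y) - 2) (a @ b1) y (b2 @ c)
            + circ_sign (int (length (b1 @ L y # b2)) - 2) a (b1 @ L y # b2) c)
         \<longleftrightarrow> even (circ_sign (int (length (b1 @ y @ b2)) - 3) a (b1 @ y @ b2) c
            + circ_sign (int (length y) - 2) b1 y b2)"
        unfolding even_add circ_sign_even by (simp; blast)
      then show "(\<lambda>(t, s). u t s) ((\<lambda>(a, b1, y, b2, c). ((a @ b1, y, b2 @ c), (a, b1 @ L y # b2, c))) q)
         = (\<lambda>(a, b1, y, b2, c). nest a b1 y b2 c) q"
        unfolding q prod.case u_def nest_def by (rule ksign_cong)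
      show "(\<lambda>(a, b1, y, b2, c). nest a b1 y b2 c) q \<in> carrier (V d)" using q nestc by auto
    qed
    also have "finsum (V d) (\<lambda>(t, s). u t s) Pl = finsum (V d)
        (\<lambda>(a, y, b, z, c). u (a, y, b @ z @ c) (a @ L y # b, z, c)) Q2"
    proof (rule V.finsum_bij[of "\<lambda>(a, y, b, z, c). ((a, y, b @ z @ c), (a @ L y # b, z, c))"])
      show "inj_on (\<lambda>(a, y, b, z, c). ((a, y, b @ z @ c), (a @ L y # b, z, c))) Q2"
        by (auto simp: inj_on_def)
      show "(\<lambda>(a, y, b, z, c). ((a, y, b @ z @ c), (a @ L y # b, z, c))) ` Q2 = Pl"
      proof (intro equalityI subsetI)
        fix p assume p: "p \<in> Pl"
        then obtain us ys vs a b c where p': "p = ((us, ys, vs), (a, b, c))" "us @ ys @ vs = xs" "ys \<noteq> []"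
          "(a, b, c) \<in> nesplits (us @ L ys # vs)" "length a > length us" "b \<noteq> []"
          by (auto simp: Pl_def P_def nesplits_def)
        then obtain a2 where "a = us @ L ys # a2" "a2 @ b @ c = vs"
          using nesplits_marker(1) by blast
        then show "p \<in> (\<lambda>(a, y, b, z, c). ((a, y, b @ z @ c), (a @ L y # b, z, c))) ` Q2"
          using p' by (intro image_eqI[of _ _ "(us, ys, a2, b, c)"]) (auto simp: Q2_def)
      qed (auto simp: Q2_def Pl_def P_def nesplits_def)
    qed (auto simp: Q2_def nesplits_def intro!: uc)
    also have "finsum (V d) (\<lambda>(t, s). u t s) Pr = finsum (V d)
        (\<lambda>(a, y, b, z, c). u (a @ y @ b, z, c) (a, y, b @ L z # c)) Q2"
    proof (rule V.finsum_bij[of "\<lambda>(a, y, b, z, c). ((a @ y @ b, z, c), (a, y, b @ L z # c))"])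
      show "inj_on (\<lambda>(a, y, b, z, c). ((a @ y @ b, z, c), (a, y, b @ L z # c))) Q2"
        by (auto simp: inj_on_def)
      show "(\<lambda>(a, y, b, z, c). ((a @ y @ b, z, c), (a, y, b @ L z # c))) ` Q2 = Pr"
      proof (intro equalityI subsetI)
        fix p assume p: "p \<in> Pr"
        then obtain us ys vs a b c where p': "p = ((us, ys, vs), (a, b, c))" "us @ ys @ vs = xs" "ys \<noteq> []"
          "(a, b, c) \<in> nesplits (us @ L ys # vs)" "length a + length b \<le> length us" "b \<noteq> []"
          by (auto simp: Pr_def P_def nesplits_def)
        then obtain c1 where "c = c1 @ L ys # vs" "a @ b @ c1 = us"
          using nesplits_marker(2) by blast
        then show "p \<in> (\<lambda>(a, y, b, z, c). ((a @ y @ b, z, c), (a, y, b @ L z # c))) ` Q2"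
          using p' by (intro image_eqI[of _ _ "(a, b, c1, ys, vs)"]) (auto simp: Q2_def)
      qed (auto simp: Q2_def Pr_def P_def nesplits_def)
    qed (auto simp: Q2_def nesplits_def intro!: uc)
    also have "finsum (V d) (\<lambda>(a, y, b, z, c). u (a, y, b @ z @ c) (a @ L y # b, z, c)) Q2
      = finsum (V d) (\<lambda>q. \<ominus>\<^bsub>V d\<^esub> (\<lambda>(a, y, b, z, c). u (a @ y @ b, z, c) (a, y, b @ L z # c)) q) Q2"
    proof (rule V.M.finsum_cong'[OF refl])
      have c: "(\<lambda>(a, y, b, z, c). u (a @ y @ b, z, c) (a, y, b @ L z # c)) q \<in> carrier (V d)" if "q \<in> Q2" for q
        using that by (auto simp: Q2_def nesplits_def intro!: uc)
      then show "(\<lambda>q. \<ominus>\<^bsub>V d\<^esub> (\<lambda>(a, y, b, z, c). u (a @ y @ b, z, c) (a, y, b @ L z # c)) q) \<in> Q2 \<rightarrow> carrier (V d)"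
        by blast
      fix q assume "q \<in> Q2"
      then obtain a y b z c where q: "q = (a, y, b, z, c)" "a @ y @ b @ z @ c = xs" "y \<noteq> []" "z \<noteq> []"
        by (auto simp: Q2_def)
      have ok: "word_ok V a" "word_ok V y" "word_ok V b" "word_ok V z" "word_ok V c" using q(2) xs(1) by auto
      have Mq: "M (a @ L y # b @ L z # c) \<in> carrier (V d)"
        by (rule Mc) (use ok q(2) xs in \<open>auto simp: L d_def intro!: Lc[unfolded L]\<close>)
      have "even (circ_sign (int (length y) - 2) a y (b @ z @ c) + circ_sign (int (length z) - 2) (a @ L y # b) z c)
        \<noteq> even (circ_sign (int (length z) - 2) (a @ y @ b) z c + circ_sign (int (length y) - 2) a y (b @ L z # c))"
        unfolding even_add circ_sign_even by (simp add: L; blast)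
      then show "(\<lambda>(a, y, b, z, c). u (a, y, b @ z @ c) (a @ L y # b, z, c)) q
          = \<ominus>\<^bsub>V d\<^esub> (\<lambda>(a, y, b, z, c). u (a @ y @ b, z, c) (a, y, b @ L z # c)) q"
        unfolding q prod.case u_def using V.ksign_Suc[OF Mq] by simp
    qed
    also have "\<dots> = \<ominus>\<^bsub>V d\<^esub> finsum (V d) (\<lambda>(a, y, b, z, c). u (a @ y @ b, z, c) (a, y, b @ L z # c)) Q2"
      by (rule V.finsum_minus) (auto simp: Q2_def nesplits_def intro!: uc)
    finally have "finsum (V d) (\<lambda>(t, s). u t s) P = finsum (V d) (\<lambda>(a, b1, y, b2, c). nest a b1 y b2 c) Q1
      \<oplus>\<^bsub>V d\<^esub> (\<ominus>\<^bsub>V d\<^esub> finsum (V d) (\<lambda>(a, y, b, z, c). u (a @ y @ b, z, c) (a, y, b @ L z # c)) Q2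
        \<oplus>\<^bsub>V d\<^esub> finsum (V d) (\<lambda>(a, y, b, z, c). u (a @ y @ b, z, c) (a, y, b @ L z # c)) Q2)" .
    also have "\<dots> = finsum (V d) (\<lambda>(a, b1, y, b2, c). nest a b1 y b2 c) Q1"
    proof -
      have "finsum (V d) (\<lambda>(a, b1, y, b2, c). nest a b1 y b2 c) Q1 \<in> carrier (V d)"
        by (rule V.M.finsum_closed) (auto simp: Q1_def intro!: nestc)
      moreover have "finsum (V d) (\<lambda>(a, y, b, z, c). u (a @ y @ b, z, c) (a, y, b @ L z # c)) Q2 \<in> carrier (V d)"
        by (rule V.M.finsum_closed) (auto simp: Q2_def nesplits_def intro!: uc)
      ultimately show ?thesis by (simp add: V.M.l_neg)
    qed
    finally show "ev (family_circ R V 2 3 m D N) xs = ev (family_circ R V 3 2 D m N) xs"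
      using lhs rhs by simp
  qed
qed

end

section \<open>Truncated A-infinity relations\<close>

context dg_mod begin

lemma teval_circ_delta_left:
  assumes m1: "\<mu> \<in> carrier (E 1 (-1))" "\<forall>p. \<forall>x\<in>carrier (V p). \<mu> p (pure_tensor R V [(p, x)]) = \<delta> p x"
    and f: "f \<in> carrier (E n i)" and xs: "word_ok V xs" "length xs = n"
  shows "ev (circ R V 1 (-1) n i \<mu> f) xs = \<delta> (wdeg xs + i) (ev f xs)"
proof -
  let ?d = "wdeg xs + (-1 + i)"
  have "us = [] \<and> ys = xs \<and> vs = []" if "us @ ys @ vs = xs" "length ys = n" for us ys vs
  proof -
    have "length us + length ys + length vs = n" using arg_cong[OF that(1), of length] xs(2) by simp
    then show ?thesis using that by simp
  qed
  note split = this
  have s: "splits n xs = {([], xs, [])}"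
  proof (intro equalityI subsetI)
    fix t assume "t \<in> splits n xs"
    then obtain us ys vs where "t = (us, ys, vs)" "us @ ys @ vs = xs" "length ys = n"
      unfolding splits_def by blast
    then show "t \<in> {([], xs, [])}" using split[of us ys vs] by simp
  qed (use xs(2) in \<open>simp add: splits_def\<close>)
  have fx: "ev f xs \<in> carrier (V (wdeg xs + i))" by (rule teval_closed[OF f xs refl])
  then have c: "\<delta> (wdeg xs + i) (ev f xs) \<in> carrier (V ?d)"
    using delta_closed by (simp add: algebra_simps)
  show ?thesis
    using teval_circ[OF m1(1) f xs(1) _ order.refl refl] xs(2) fx c m1(2)
    by (simp add: s circ_sign_def teval_def)
qed

lemma teval_circ_delta_right:
  assumes m1: "\<mu> \<in> carrier (E 1 (-1))" "\<forall>p. \<forall>x\<in>carrier (V p). \<mu> p (pure_tensor R V [(p, x)]) = \<delta> p x"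
    and f: "f \<in> carrier (E n i)" and n: "1 \<le> n" and xs: "word_ok V xs" "length xs = n" "d = wdeg xs + i - 1"
  shows "ev (circ R V n i 1 (-1) f \<mu>) xs = (\<Oplus>\<^bsub>V d\<^esub>k\<in>{..<n}.
     ksign (V d) (int n - 1) (ksign (V d) (wdeg (take k xs)) (ev f (upd k (-1) \<delta> xs))))"
proof -
  have e: "length xs = n + 1 - 1" "d = wdeg xs + (i + - 1)" using xs by auto
  have c: "ev f (upd k (-1) \<delta> xs) \<in> carrier (V d)" if "k < n" for k
    by (rule teval_closed[OF f]) (use upd_ok[OF xs(1) delta_hom'] that xs in auto)
  show ?thesis unfolding teval_circ[OF f m1(1) xs(1) e(1) n e(2)]
  proof (rule V.finsum_bij[of "\<lambda>k. (take k xs, [xs ! k], drop (Suc k) xs)"])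
    show "inj_on (\<lambda>k. (take k xs, [xs ! k], drop (Suc k) xs)) {..<n}"
    proof (rule inj_onI)
      fix k l assume k: "k \<in> {..<n}" "l \<in> {..<n}" "(take k xs, [xs ! k], drop (Suc k) xs) = (take l xs, [xs ! l], drop (Suc l) xs)"
      then have "length (take k xs) = length (take l xs)" by simp
      then show "k = l" using k xs by auto
    qed
    show "(\<lambda>k. (take k xs, [xs ! k], drop (Suc k) xs)) ` {..<n} = splits 1 xs"
    proof (intro Set.set_eqI iffI)
      fix t assume "t \<in> splits 1 xs"
      then obtain us y vs where "t = (us, [y], vs)" "us @ [y] @ vs = xs"
        by (auto simp: splits_def length_Suc_conv)
      then show "t \<in> (\<lambda>k. (take k xs, [xs ! k], drop (Suc k) xs)) ` {..<n}"
        using xs by (intro image_eqI[of _ _ "length us"]) auto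
    next
      fix t assume "t \<in> (\<lambda>k. (take k xs, [xs ! k], drop (Suc k) xs)) ` {..<n}"
      then show "t \<in> splits 1 xs" using xs id_take_nth_drop by (fastforce simp: splits_def)
    qed
    fix k assume k: "k \<in> {..<n}"
    have l: "snd (xs ! k) \<in> carrier (V (fst (xs ! k)))"
      using xs k by (simp add: word_ok_def)
    then have w: "take k xs @ (wdeg [xs ! k] + - 1, ev \<mu> [xs ! k]) # drop (Suc k) xs = upd k (-1) \<delta> xs"
      using k xs m1(2)[rule_format, OF l] by (simp add: upd_def upd_conv_take_nth_drop teval_def)
    have s: "even (circ_sign (-1) (take k xs) [xs ! k] (drop (Suc k) xs)) \<longleftrightarrow> even (int n - 1 + wdeg (take k xs))"
      using k xs by (simp add: circ_sign_def of_nat_diff)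
    show "(case (take k xs, [xs ! k], drop (Suc k) xs) of (us, ys, vs) \<Rightarrow> ksign (V d) (circ_sign (- 1) us ys vs)
         (ev f (us @ (wdeg ys + - 1, ev \<mu> ys) # vs)))
       = ksign (V d) (int n - 1) (ksign (V d) (wdeg (take k xs)) (ev f (upd k (-1) \<delta> xs)))"
      using c k unfolding prod.case w ksign_cong[OF s] by simp
    show "ksign (V d) (int n - 1) (ksign (V d) (wdeg (take k xs)) (ev f (upd k (-1) \<delta> xs))) \<in> carrier (V d)"
      using c k by auto
  qed
qed

text \<open>
  The differential of \<open>End(A)\<close> is the bracket with \<open>m\<^sub>1\<close>.  For a cochain of arity \<open>n\<close> and degree \<open>i\<close>
  the sign \<open>(-1)\<^sup>n\<^sup>-\<^sup>1\<close> in \<open>f \<circ> m\<^sub>1\<close> turns the weight \<open>i + n - 1\<close> into the degree \<open>i\<close>.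
\<close>

lemma End_diff_circ:
  assumes m1: "\<mu> \<in> carrier (E 1 (-1))" "\<forall>p. \<forall>x\<in>carrier (V p). \<mu> p (pure_tensor R V [(p, x)]) = \<delta> p x"
    and f: "f \<in> carrier (E n i)" and n: "1 \<le> n"
  shows "End_diff R V \<delta> n i f = circ R V 1 (-1) n i \<mu> f \<ominus>\<^bsub>E n (i - 1)\<^esub>
    ksign (E n (i - 1)) (i + int n - 1) (circ R V n i 1 (-1) f \<mu>)"
proof (rule End_ext)
  let ?E = "E n (i - 1)"
  have 1: "circ R V 1 (-1) n i \<mu> f \<in> carrier ?E" using circ_closed[OF m1(1) f] by simp
  have 2: "circ R V n i 1 (-1) f \<mu> \<in> carrier ?E" using circ_closed[OF f m1(1)] by simp
  show "circ R V 1 (-1) n i \<mu> f \<ominus>\<^bsub>?E\<^esub> ksign ?E (i + int n - 1) (circ R V n i 1 (-1) f \<mu>) \<in> carrier ?E"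
    using 1 2 by (intro E.M.minus_closed E.ksign_closed)
  show "End_diff R V \<delta> n i f \<in> carrier ?E" by (rule End_diff_closed[OF f])
  fix xs assume xs: "word_ok V xs" "length xs = n"
  define d where "d = wdeg xs + i - 1"
  have d': "d = wdeg xs + (i - 1)" by (simp add: d_def)
  have c: "ksign (V d) e (ev f (upd k (-1) \<delta> xs)) \<in> carrier (V d)" if "k \<in> {..<n}" for k e
    by (rule V.ksign_closed, rule teval_closed[OF f]) (use upd_ok[OF xs(1) delta_hom'] that xs in \<open>auto simp: d_def\<close>)
  let ?S = "\<Oplus>\<^bsub>V d\<^esub>k\<in>{..<n}. ksign (V d) (wdeg (take k xs)) (ev f (upd k (-1) \<delta> xs))"
  have S: "?S \<in> carrier (V d)" by (rule V.M.finsum_closed) (use c in blast)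
  have "ev (circ R V n i 1 (-1) f \<mu>) xs = ksign (V d) (int n - 1) ?S"
    unfolding teval_circ_delta_right[OF m1 f n xs d_def]
    by (rule V.ksign_finsum[symmetric]) (use c in blast)
  then have "ksign (V d) (i + int n - 1) (ev (circ R V n i 1 (-1) f \<mu>) xs)
      = ksign (V d) ((i + int n - 1) + (int n - 1)) ?S"
    using S by simp
  also have "\<dots> = ksign (V d) i ?S" by (rule ksign_cong) simp
  finally show "ev (End_diff R V \<delta> n i f) xs = ev (circ R V 1 (-1) n i \<mu> f \<ominus>\<^bsub>?E\<^esub>
    ksign ?E (i + int n - 1) (circ R V n i 1 (-1) f \<mu>)) xs"
    unfolding teval_End_diff[OF f xs d_def] teval_minus[OF xs d' 1 E.ksign_closed[OF 2]]
      teval_ksign[OF xs d' 2] teval_circ_delta_left[OF m1 f xs] by simp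
qed

lemma delta_cochainE:
  obtains \<mu> where "\<mu> \<in> carrier (E 1 (-1))" "\<forall>p. \<forall>x\<in>carrier (V p). \<mu> p (pure_tensor R V [(p, x)]) = \<delta> p x"
proof -
  obtain \<mu> where m: "\<mu> \<in> carrier (E 1 (-1))"
    "\<And>xs. word_ok V xs \<Longrightarrow> length xs = 1 \<Longrightarrow> ev \<mu> xs = \<delta> (fst (hd xs)) (snd (hd xs))"
    using End_cochainE[OF letter_multilinear[OF delta_hom']] by blast
  have "\<mu> p (pure_tensor R V [(p, x)]) = \<delta> p x" if "x \<in> carrier (V p)" for p x
    using m(2)[of "[(p, x)]"] that by (simp add: teval_def)
  then show ?thesis using that m(1) by blast
qed

lemma End_diff_hom:
  assumes n: "1 \<le> n"
  shows "(\<lambda>f\<in>carrier (E n i). End_diff R V \<delta> n i f) \<in> lin_hom R (E n i) (E n (i - 1))"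
proof -
  obtain \<mu> where mu: "\<mu> \<in> carrier (E 1 (-1))" "\<forall>p. \<forall>x\<in>carrier (V p). \<mu> p (pure_tensor R V [(p, x)]) = \<delta> p x"
    by (rule delta_cochainE)
  note E = End_diff_circ[OF mu _ n]
  have l: "(\<lambda>f\<in>carrier (E n i). circ R V n i 1 (-1) f \<mu>) \<in> lin_hom R (E n i) (E n (i - 1))"
    using circ_lin_left[OF mu(1) n, of i] by simp
  have r: "(\<lambda>f\<in>carrier (E n i). circ R V 1 (-1) n i \<mu> f) \<in> lin_hom R (E n i) (E n (i - 1))"
    using circ_lin_right[OF mu(1) order.refl, of n i] by simp
  have "(\<lambda>f\<in>carrier (E n i). End_diff R V \<delta> n i f) = (\<lambda>f\<in>carrier (E n i).
      (\<lambda>f\<in>carrier (E n i). circ R V 1 (-1) n i \<mu> f) f \<ominus>\<^bsub>E n (i - 1)\<^esub>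
      (\<lambda>f\<in>carrier (E n i). ksign (E n (i - 1)) (i + int n - 1)
         ((\<lambda>f\<in>carrier (E n i). circ R V n i 1 (-1) f \<mu>) f)) f)"
    by (rule restrict_ext) (simp add: E[simplified])
  then show ?thesis
    using lin_hom_minusI[OF r lin_hom_ksignI[OF l End_module End_module] End_module End_module] by simp
qed

lemma End_diff_add:
  "1 \<le> n \<Longrightarrow> f \<in> carrier (E n i) \<Longrightarrow> g \<in> carrier (E n i) \<Longrightarrow>
   End_diff R V \<delta> n i (f \<oplus>\<^bsub>E n i\<^esub> g)
       = End_diff R V \<delta> n i f \<oplus>\<^bsub>E n (i - 1)\<^esub> End_diff R V \<delta> n i g"
  using lin_hom_add[OF End_diff_hom, of n f i g] by simp

lemma End_diff_minus:
  "1 \<le> n \<Longrightarrow> f \<in> carrier (E n i) \<Longrightarrow> g \<in> carrier (E n i) \<Longrightarrow>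
   End_diff R V \<delta> n i (f \<ominus>\<^bsub>E n i\<^esub> g)
       = End_diff R V \<delta> n i f \<ominus>\<^bsub>E n (i - 1)\<^esub> End_diff R V \<delta> n i g"
  using lin_hom_minus[OF End_diff_hom End_module End_module, of n f i g] by (simp add: E.M.minus_closed)

lemma End_diff_0: "1 \<le> n \<Longrightarrow> End_diff R V \<delta> n i \<zero>\<^bsub>E n i\<^esub> = \<zero>\<^bsub>E n (i - 1)\<^esub>"
  using lin_hom_zero[OF End_diff_hom End_module End_module, of n i] by simp

end

text \<open>
  No relation is imposed here, and the operations are indexed by all arities: a truncated structure
  is extended by zero, so that composites of families can be formed without bounds on the arities.
  The component \<open>square n\<close> is the left-hand side of the defining relation in arity \<open>n\<close>.
\<close>

locale operations = dg_mod R V \<delta> for R :: "('r, 'z) ring_scheme" and V :: "int \<Rightarrow> ('r, 'v) module" and \<delta> +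
  fixes m :: "nat \<Rightarrow> ('r, 'v) cochain"
  assumes m_closed: "\<And>i. m i \<in> carrier (E i (int i - 2))"
    and m_delta: "\<forall>p. \<forall>x\<in>carrier (V p). m 1 p (pure_tensor R V [(p, x)]) = \<delta> p x"
begin

abbreviation "square \<equiv> family_circ R V 2 2 m m"

lemma m1_closed: "m 1 \<in> carrier (E 1 (-1))" and m2_closed: "m 2 \<in> carrier (E 2 0)"
  using m_closed[of 1] m_closed[of 2] by simp_all

lemmas square_closed = family_square_closed[OF m_closed]

lemma dg_A_structure_iff: "dg_A_structure R V \<delta> r m \<longleftrightarrow> (\<forall>n\<in>{1..r}. square n = \<zero>\<^bsub>E n (int n - 3)\<^esub>)"
  using m_closed m_delta by (simp add: dg_A_structure_def A_structure_def family_circ_def)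

lemma obstruction_summand_closed:
  "i \<in> {1..r + 1} \<Longrightarrow> circ R V i (int i - 2) (r + 2 - i) (int (r + 2 - i) - 2) (m i) (m (r + 2 - i))
     \<in> carrier (E (r + 1) (int r - 2))"
  using family_summand_closed[OF m_closed m_closed, of i "r + 1"] by simp

lemma obstruction_closed: "obstruction_cochain R V r m \<in> carrier (E (r + 1) (int r - 2))"
  unfolding obstruction_cochain_def
proof (rule E.M.finsum_closed, rule Pi_I)
  fix i assume "i \<in> {2..r}"
  then have "i \<in> {1..r + 1}" by auto
  then show "circ R V i (int i - 2) (r + 2 - i) (int (r + 2 - i) - 2) (m i) (m (r + 2 - i))
     \<in> carrier (E (r + 1) (int r - 2))" by (rule obstruction_summand_closed)
qed

lemma End_diff_odd:
  assumes f: "f \<in> carrier (E n (int n - 2))" and n: "1 \<le> n"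
  shows "End_diff R V \<delta> n (int n - 2) f =
    circ R V 1 (-1) n (int n - 2) (m 1) f \<oplus>\<^bsub>E n (int n - 3)\<^esub> circ R V n (int n - 2) 1 (-1) f (m 1)"
proof -
  have "circ R V n (int n - 2) 1 (-1) f (m 1) \<in> carrier (E n (int n - 3))"
    using circ_closed[OF f m1_closed] by simp
  moreover have "ksign N (int n - 2 + int n - 1) x = \<ominus>\<^bsub>N\<^esub> x" for N :: "('r, ('r, 'v) cochain) module" and x
    by (simp add: ksign_def)
  moreover have "int n - 2 - 1 = int n - 3" by simp
  ultimately show ?thesis
    unfolding End_diff_circ[OF m1_closed m_delta f n] by (simp add: a_minus_def)
qed

text \<open>
  The relation in arity \<open>r + 1\<close>, solved for the new operation: the two summands that contain
  \<open>m\<^bsub>r+1\<^esub>\<close> form its differential, and the others form the obstruction cochain.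
\<close>

lemma square_Suc:
  assumes "1 \<le> r"
  shows "square (r + 1) = End_diff R V \<delta> (r + 1) (int r - 1) (m (r + 1))
    \<oplus>\<^bsub>E (r + 1) (int r - 2)\<^esub> obstruction_cochain R V r m"
proof -
  let ?E = "E (r + 1) (int r - 2)"
  let ?t = "\<lambda>i. circ R V i (int i - 2) (r + 2 - i) (int (r + 2 - i) - 2) (m i) (m (r + 2 - i))"
  have "square (r + 1) = (\<Oplus>\<^bsub>?E\<^esub>i\<in>{1..r + 1}. ?t i)"
    by (simp add: family_circ_def)
  also have "\<dots> = (?t 1 \<oplus>\<^bsub>?E\<^esub> ?t (r + 1)) \<oplus>\<^bsub>?E\<^esub> (\<Oplus>\<^bsub>?E\<^esub>i\<in>{1..r + 1} - {1, r + 1}. ?t i)"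
    by (rule E.finsum_pick_two) (use assms obstruction_summand_closed[of _ r] in \<open>simp_all del: One_nat_def\<close>)
  also have "{1..r + 1} - {1, r + 1} = {2..r}" by auto
  also have "?t 1 \<oplus>\<^bsub>?E\<^esub> ?t (r + 1) = End_diff R V \<delta> (r + 1) (int r - 1) (m (r + 1))"
    using End_diff_odd[OF m_closed, of "r + 1"] by simp
  finally show ?thesis by (simp add: obstruction_cochain_def)
qed

lemma obstruction_cong:
  assumes "\<And>i. i \<in> {2..r} \<Longrightarrow> m' i = m i"
  shows "obstruction_cochain R V r m' = obstruction_cochain R V r m"
  unfolding obstruction_cochain_def
proof (rule E.M.finsum_cong'[OF refl])
  show "(\<lambda>i. circ R V i (int i - 2) (r + 2 - i) (int (r + 2 - i) - 2) (m i) (m (r + 2 - i)))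
     \<in> {2..r} \<rightarrow> carrier (E (r + 1) (int r - 2))"
    by (rule Pi_I, rule obstruction_summand_closed) auto
  fix i assume "i \<in> {2..r}"
  then have "i \<in> {2..r}" "r + 2 - i \<in> {2..r}" by auto
  then show "circ R V i (int i - 2) (r + 2 - i) (int (r + 2 - i) - 2) (m' i) (m' (r + 2 - i))
     = circ R V i (int i - 2) (r + 2 - i) (int (r + 2 - i) - 2) (m i) (m (r + 2 - i))"
    using assms by simp
qed

lemma bracket_odd:
  assumes f: "f \<in> carrier (E 2 0)" and g: "g \<in> carrier (E n (int n - 2))"
  shows "bracket R V 2 0 n (int n - 2) f g = circ R V 2 0 n (int n - 2) f g \<oplus>\<^bsub>E (n + 1) (int n - 2)\<^esub>
      circ R V n (int n - 2) 2 0 g f"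
proof -
  have "circ R V n (int n - 2) 2 0 g f \<in> carrier (E (n + 1) (int n - 2))"
    using circ_closed[OF g f] by simp
  then show ?thesis by (simp add: bracket_def Let_def weight_def ksign_def a_minus_def)
qed

lemma update_operations:
  assumes r: "2 \<le> r" and d: "d \<in> carrier (E r (int r - 2))"
  shows "operations R V \<delta> (m(r := m r \<ominus>\<^bsub>E r (int r - 2)\<^esub> d))"
  using m_closed m_delta r d
  by (intro operations.intro dg_mod_axioms operations_axioms.intro) (auto intro: E.M.minus_closed)

text \<open>
  As \<open>r \<ge> 3\<close>, the operation \<open>m\<^sub>r\<close> occurs in the obstruction exactly in the two summands
  \<open>m\<^sub>2 \<circ> m\<^sub>r\<close> and \<open>m\<^sub>r \<circ> m\<^sub>2\<close>, so the obstruction depends on it in an affine way.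
\<close>

lemma obstruction_update:
  assumes r: "3 \<le> r" and d: "d \<in> carrier (E r (int r - 2))"
  shows "obstruction_cochain R V r (m(r := m r \<ominus>\<^bsub>E r (int r - 2)\<^esub> d)) =
    obstruction_cochain R V r m \<ominus>\<^bsub>E (r + 1) (int r - 2)\<^esub> bracket R V 2 0 r (int r - 2) (m 2) d"
proof -
  let ?E = "E (r + 1) (int r - 2)"
  let ?m' = "m(r := m r \<ominus>\<^bsub>E r (int r - 2)\<^esub> d)"
  let ?t = "\<lambda>m i. circ R V i (int i - 2) (r + 2 - i) (int (r + 2 - i) - 2) (m i) (m (r + 2 - i))"
  have m': "operations R V \<delta> ?m'"
    by (rule update_operations[OF _ d]) (use r in simp)
  have split: "obstruction_cochain R V r m = (?t m 2 \<oplus>\<^bsub>?E\<^esub> ?t m r) \<oplus>\<^bsub>?E\<^esub> finsum ?E (?t m) ({2..r} - {2, r})"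
    if "operations R V \<delta> m" for m
    unfolding obstruction_cochain_def
    by (rule E.finsum_pick_two) (use r operations.obstruction_summand_closed[OF that, of _ r] in auto)
  have c: "?t m i \<in> carrier ?E" "?t ?m' i \<in> carrier ?E" if "i \<in> {2..r}" for i
    using obstruction_summand_closed[of i r] operations.obstruction_summand_closed[OF m', of i r] that by auto
  have rest: "finsum ?E (?t ?m') ({2..r} - {2, r}) = finsum ?E (?t m) ({2..r} - {2, r})"
  proof (rule E.M.finsum_cong'[OF refl])
    show "?t m \<in> {2..r} - {2, r} \<rightarrow> carrier ?E" using c by blast
  qed auto
  have restc: "finsum ?E (?t m) ({2..r} - {2, r}) \<in> carrier ?E"
    by (rule E.M.finsum_closed) (use c in blast)
  have 2: "?t ?m' 2 = ?t m 2 \<ominus>\<^bsub>?E\<^esub> circ R V 2 0 r (int r - 2) (m 2) d"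
    using circ_minus_right[OF m2_closed _ m_closed d] r by simp
  have 3: "?t ?m' r = ?t m r \<ominus>\<^bsub>?E\<^esub> circ R V r (int r - 2) 2 0 d (m 2)"
    using circ_minus_left[OF m2_closed _ m_closed d] r by simp
  have dc: "circ R V 2 0 r (int r - 2) (m 2) d \<in> carrier ?E" "circ R V r (int r - 2) 2 0 d (m 2) \<in> carrier ?E"
    using circ_closed[OF m2_closed d] circ_closed[OF d m2_closed] by simp_all
  have tc: "?t m 2 \<in> carrier ?E" "?t m r \<in> carrier ?E" using c(1)[of 2] c(1)[of r] r by simp_all
  show ?thesis unfolding split[OF m'] split[OF operations_axioms] rest 2 3 bracket_odd[OF m2_closed d]
    using dc tc restc by (simp add: a_minus_def E.M.minus_add E.M.a_ac)
qed

end

text \<open>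
  An \<open>A\<^sub>r\<close>-structure says nothing about the members of the family in arity \<open>0\<close> or above \<open>r\<close>; these
  are replaced by zero.
\<close>

definition extend_zero :: "('r, 'z) ring_scheme \<Rightarrow> (int \<Rightarrow> ('r, 'v) module) \<Rightarrow> nat \<Rightarrow> (nat \<Rightarrow> ('r, 'v) cochain) \<Rightarrow>
    nat \<Rightarrow> ('r, 'v) cochain" where
  "extend_zero R V r m i = (if i \<in> {1..r} then m i else \<zero>\<^bsub>End_mod R V i (int i - 2)\<^esub>)"

lemma (in dg_mod) extend_zero_operations:
  assumes "dg_A_structure R V \<delta> r m" "1 \<le> r"
  shows "operations R V \<delta> (extend_zero R V r m)" "dg_A_structure R V \<delta> r (extend_zero R V r m)"
proof -
  show o: "operations R V \<delta> (extend_zero R V r m)"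
    by (intro operations.intro dg_mod_axioms operations_axioms.intro)
      (use assms in \<open>auto simp: extend_zero_def dg_A_structure_def A_structure_def\<close>)
  interpret o: operations R V \<delta> "extend_zero R V r m" by (rule o)
  have "o.square n = \<zero>\<^bsub>E n (int n - 3)\<^esub>" if n: "n \<in> {1..r}" for n
  proof -
    have "family_circ R V 2 2 m m n = o.square n"
      by (rule family_circ_cong[OF o.m_closed o.m_closed]) (use n in \<open>auto simp: extend_zero_def\<close>)
    moreover have "family_circ R V 2 2 m m n = \<zero>\<^bsub>E n (int n - 3)\<^esub>"
      using assms(1) n by (simp add: dg_A_structure_def A_structure_def family_circ_def)
    ultimately show ?thesis by simp
  qed
  then show "dg_A_structure R V \<delta> r (extend_zero R V r m)" by (simp add: o.dg_A_structure_iff)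
qed

text \<open>
  Setting \<open>m\<^bsub>r+1\<^esub> = 0\<close> makes the failure of the relation in arity \<open>r + 1\<close> equal to the obstruction
  cochain.
\<close>

locale trunc_ainf = operations R V \<delta> m for R :: "('r, 'z) ring_scheme" and V :: "int \<Rightarrow> ('r, 'v) module"
    and \<delta> and m :: "nat \<Rightarrow> ('r, 'v) cochain" +
  fixes r :: nat
  assumes r: "3 \<le> r" and ainf: "dg_A_structure R V \<delta> r m" and m_zero: "m (r + 1) = \<zero>\<^bsub>E (r + 1) (int r - 1)\<^esub>"
begin

abbreviation "obs \<equiv> obstruction_cochain R V r m"

lemma square_zero: "n \<le> r \<Longrightarrow> square n = \<zero>\<^bsub>E n (int n - 3)\<^esub>"
  using ainf dg_A_structure_iff by (cases "n = 0") (auto simp: family_circ_def)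

lemma square_obs: "square (r + 1) = obs"
  using square_Suc[of r] r End_diff_0[of "r + 1" "int r - 1"] obstruction_closed[of r] m_zero by simp

lemma circ_square_summand_closed:
  "i \<in> {1..N} \<Longrightarrow> circ R V i (int i - 2) (N + 1 - i) (int (N + 1 - i) - 3) (m i) (square (N + 1 - i))
     \<in> carrier (E N (int N - 4))"
  "i \<in> {1..N} \<Longrightarrow> circ R V i (int i - 3) (N + 1 - i) (int (N + 1 - i) - 2) (square i) (m (N + 1 - i))
     \<in> carrier (E N (int N - 4))"
  using family_summand_closed[OF m_closed square_closed, of i N] family_summand_closed[OF square_closed m_closed, of i N]
  by simp_all

lemma circ_square_zero:
  assumes "i \<in> {1..N}"
  shows "N + 1 - i \<le> r \<Longrightarrow> circ R V i (int i - 2) (N + 1 - i) (int (N + 1 - i) - 3) (m i) (square (N + 1 - i))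
      = \<zero>\<^bsub>E N (int N - 4)\<^esub>"
    and "i \<le> r \<Longrightarrow> circ R V i (int i - 3) (N + 1 - i) (int (N + 1 - i) - 2) (square i) (m (N + 1 - i))
      = \<zero>\<^bsub>E N (int N - 4)\<^esub>"
proof -
  have a: "i + (N + 1 - i) - 1 = N" "int i - 2 + (int (N + 1 - i) - 3) = int N - 4"
    "int i - 3 + (int (N + 1 - i) - 2) = int N - 4" "1 \<le> i" using assms by auto
  show "circ R V i (int i - 2) (N + 1 - i) (int (N + 1 - i) - 3) (m i) (square (N + 1 - i))
      = \<zero>\<^bsub>E N (int N - 4)\<^esub>" if "N + 1 - i \<le> r"
    using circ_zero_right[OF m_closed a(4), where m = "N + 1 - i" and j = "int (N + 1 - i) - 3"]
    unfolding square_zero[OF that] a by simp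
  show "circ R V i (int i - 3) (N + 1 - i) (int (N + 1 - i) - 2) (square i) (m (N + 1 - i))
      = \<zero>\<^bsub>E N (int N - 4)\<^esub>" if "i \<le> r"
    using circ_zero_left[OF m_closed a(4), where m = "N + 1 - i" and i = "int i - 3"]
    unfolding square_zero[OF that] a by simp
qed

text \<open>
  Associativity of the square in arity \<open>r + 1\<close>: the square vanishes in arities up to \<open>r\<close>, so on either side only
  the composite of \<open>m\<^sub>1\<close> with the obstruction survives.
\<close>

lemma obs_cocycle: "End_diff R V \<delta> (r + 1) (int r - 2) obs = \<zero>\<^bsub>E (r + 1) (int r - 3)\<^esub>"
proof -
  let ?N = "r + 1 :: nat"
  let ?E = "E ?N (int ?N - 4)"
  let ?l = "\<lambda>i. circ R V i (int i - 2) (?N + 1 - i) (int (?N + 1 - i :: nat) - 3) (m i) (square (?N + 1 - i))"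
  let ?r = "\<lambda>i. circ R V i (int i - 3) (?N + 1 - i) (int (?N + 1 - i :: nat) - 2) (square i) (m (?N + 1 - i))"
  have "finsum ?E ?l {1..?N} = ?l 1"
    by (rule E.finsum_pick_one, simp, simp, rule circ_square_summand_closed(1), simp, rule circ_square_zero(1)) auto
  moreover have "finsum ?E ?r {1..?N} = ?r ?N"
    by (rule E.finsum_pick_one, simp, simp, rule circ_square_summand_closed(2), simp, rule circ_square_zero(2)) auto
  moreover have "finsum ?E ?l {1..?N} = finsum ?E ?r {1..?N}"
    using family_square_assoc[OF m_closed, of ?N] by (simp add: family_circ_def)
  ultimately have eq: "circ R V 1 (-1) (r + 1) (int r - 2) (m 1) obs = circ R V (r + 1) (int r - 2) 1 (-1) obs (m 1)"
    by (simp add: square_obs[simplified])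
  have c: "circ R V (r + 1) (int r - 2) 1 (-1) obs (m 1) \<in> carrier (E (r + 1) (int r - 3))"
    using circ_closed[OF obstruction_closed m1_closed, of r] by simp
  have n: "1 \<le> r + 1" by simp
  show ?thesis
    unfolding End_diff_circ[OF m1_closed m_delta obstruction_closed n]
    using eq c by (simp add: E.minus_eq_zero_iff)
qed

text \<open>
  Associativity of the square in arity \<open>r + 2\<close>, where the components of the square in arities
  \<open>r + 1\<close> and \<open>r + 2\<close> survive.  After passing to homology, the composites with \<open>m\<^sub>1\<close> disappear and
  this becomes the Hochschild cocycle condition.
\<close>

lemma obs_hochschild:
  "circ R V 1 (-1) (r + 2) (int r - 1) (m 1) (square (r + 2)) \<oplus>\<^bsub>E (r + 2) (int r - 2)\<^esub>
     circ R V 2 0 (r + 1) (int r - 2) (m 2) obs =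
   circ R V (r + 2) (int r - 1) 1 (-1) (square (r + 2)) (m 1) \<oplus>\<^bsub>E (r + 2) (int r - 2)\<^esub>
     circ R V (r + 1) (int r - 2) 2 0 obs (m 2)"
proof -
  let ?N = "r + 2 :: nat"
  let ?E = "E ?N (int ?N - 4)"
  let ?l = "\<lambda>i. circ R V i (int i - 2) (?N + 1 - i) (int (?N + 1 - i :: nat) - 3) (m i) (square (?N + 1 - i))"
  let ?r = "\<lambda>i. circ R V i (int i - 3) (?N + 1 - i) (int (?N + 1 - i :: nat) - 2) (square i) (m (?N + 1 - i))"
  have "finsum ?E ?l {1..?N} = (?l 1 \<oplus>\<^bsub>?E\<^esub> ?l 2) \<oplus>\<^bsub>?E\<^esub> finsum ?E ?l ({1..?N} - {1, 2})"
    by (rule E.finsum_pick_two, simp, simp, simp, simp, rule circ_square_summand_closed(1))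
  also have "finsum ?E ?l ({1..?N} - {1, 2}) = \<zero>\<^bsub>?E\<^esub>"
    by (rule E.finsum_zeroI, rule circ_square_zero(1)) auto
  finally have 1: "finsum ?E ?l {1..?N} = ?l 1 \<oplus>\<^bsub>?E\<^esub> ?l 2"
    using circ_square_summand_closed(1)[of 1 ?N] circ_square_summand_closed(1)[of 2 ?N] by simp
  have "finsum ?E ?r {1..?N} = (?r ?N \<oplus>\<^bsub>?E\<^esub> ?r (r + 1)) \<oplus>\<^bsub>?E\<^esub> finsum ?E ?r ({1..?N} - {?N, r + 1})"
    by (rule E.finsum_pick_two, simp, simp, simp, simp, rule circ_square_summand_closed(2))
  also have "finsum ?E ?r ({1..?N} - {?N, r + 1}) = \<zero>\<^bsub>?E\<^esub>"
    by (rule E.finsum_zeroI, rule circ_square_zero(2)) auto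
  finally have 2: "finsum ?E ?r {1..?N} = ?r ?N \<oplus>\<^bsub>?E\<^esub> ?r (r + 1)"
    using circ_square_summand_closed(2)[of ?N ?N] circ_square_summand_closed(2)[of "r + 1" ?N] by simp
  have "finsum ?E ?l {1..?N} = finsum ?E ?r {1..?N}"
    using family_square_assoc[OF m_closed, of ?N] by (simp add: family_circ_def)
  then show ?thesis unfolding 1 2 by (simp add: square_obs[simplified] algebra_simps)
qed

end

section \<open>Homology\<close>

context dg_mod begin

abbreviation "Z \<equiv> cycles V \<delta>"
abbreviation "H \<equiv> homology V \<delta>"

lemma cycles_iff: "x \<in> carrier (Z p) \<longleftrightarrow> x \<in> carrier (V p) \<and> \<delta> p x = \<zero>\<^bsub>V (p - 1)\<^esub>"
  by (simp add: cycles_def)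

lemma cycles_ops [simp]:
  "x \<oplus>\<^bsub>Z p\<^esub> y = x \<oplus>\<^bsub>V p\<^esub> y" "a \<odot>\<^bsub>Z p\<^esub> x = a \<odot>\<^bsub>V p\<^esub> x" "\<zero>\<^bsub>Z p\<^esub> = \<zero>\<^bsub>V p\<^esub>"
  by (simp_all add: cycles_def)

lemma cycles_submodule: "submodule (carrier (Z p)) R (V p)"
  by (rule submoduleI'[OF V_module])
    (auto simp: cycles_iff delta_zero lin_hom_add[OF delta_hom] lin_hom_smult[OF delta_hom])

lemma cycles_module: "module R (Z p)"
proof -
  have "module R ((V p)\<lparr>carrier := carrier (Z p)\<rparr>)"
    by (rule submodule.submodule_is_module[OF cycles_submodule V_module])
  then show ?thesis by (simp add: cycles_def)
qed

lemma boundaries_iff: "b \<in> boundaries V \<delta> p \<longleftrightarrow> (\<exists>x\<in>carrier (V (p + 1)). b = \<delta> (p + 1) x)"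
  by (auto simp: boundaries_def)

lemma delta_boundary: "x \<in> carrier (V p) \<Longrightarrow> q = p - 1 \<Longrightarrow> \<delta> p x \<in> boundaries V \<delta> q"
  by (auto simp: boundaries_iff)

lemma boundaries_cycles: "boundaries V \<delta> p \<subseteq> carrier (Z p)"
  using lin_hom_closed[OF delta_hom[of "p + 1"]] delta_delta[of _ "p + 1" p]
  by (auto simp: boundaries_iff cycles_iff)

lemma boundaries_ops:
  "\<zero>\<^bsub>V p\<^esub> \<in> boundaries V \<delta> p"
  "x \<in> boundaries V \<delta> p \<Longrightarrow> y \<in> boundaries V \<delta> p \<Longrightarrow> x \<oplus>\<^bsub>V p\<^esub> y \<in> boundaries V \<delta> p"
  "a \<in> carrier R \<Longrightarrow> x \<in> boundaries V \<delta> p \<Longrightarrow> a \<odot>\<^bsub>V p\<^esub> x \<in> boundaries V \<delta> p"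
proof -
  show "\<zero>\<^bsub>V p\<^esub> \<in> boundaries V \<delta> p"
    using delta_zero[of "p + 1"] by (auto simp: boundaries_iff intro!: bexI[of _ "\<zero>\<^bsub>V (p + 1)\<^esub>"])
  assume "x \<in> boundaries V \<delta> p"
  then obtain x' where x: "x' \<in> carrier (V (p + 1))" "x = \<delta> (p + 1) x'" by (auto simp: boundaries_iff)
  show "x \<oplus>\<^bsub>V p\<^esub> y \<in> boundaries V \<delta> p" if "y \<in> boundaries V \<delta> p"
  proof -
    obtain y' where y: "y' \<in> carrier (V (p + 1))" "y = \<delta> (p + 1) y'" using \<open>y \<in> _\<close> by (auto simp: boundaries_iff)
    show ?thesis unfolding boundaries_iff using x y lin_hom_add[OF delta_hom x(1) y(1)]
      by (intro bexI[of _ "x' \<oplus>\<^bsub>V (p + 1)\<^esub> y'"]) auto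
  qed
  show "a \<odot>\<^bsub>V p\<^esub> x \<in> boundaries V \<delta> p" if "a \<in> carrier R"
    unfolding boundaries_iff using x that lin_hom_smult[OF delta_hom that x(1)]
    by (intro bexI[of _ "a \<odot>\<^bsub>V (p + 1)\<^esub> x'"]) auto
qed

lemma boundaries_submodule: "submodule (boundaries V \<delta> p) R (Z p)" "submodule (boundaries V \<delta> p) R (V p)"
  using boundaries_ops boundaries_cycles[of p]
  by (auto intro!: submoduleI'[OF cycles_module] submoduleI'[OF V_module] simp: cycles_iff)

lemma homology_graded: "graded_module R H"
  unfolding graded_module_def homology_def
  by (auto intro: quot_module_module[OF cycles_module boundaries_submodule(1)])

sublocale H: graded_mod R H
  by (simp add: graded_mod_def R_cring homology_graded)

lemma hclass_hom: "(\<lambda>z\<in>carrier (Z p). hclass V \<delta> p z) \<in> lin_hom R (Z p) (H p)"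
  unfolding hclass_def homology_def by (rule quot_module_proj[OF cycles_module boundaries_submodule(1)])

lemma hclass_surj: "hclass V \<delta> p ` carrier (Z p) = carrier (H p)"
  by (auto simp: hclass_def homology_def quot_module_carrier[OF cycles_module boundaries_submodule(1)])

lemma hclass_eq_diff:
  assumes "x \<in> carrier (Z p)" "y \<in> carrier (Z p)" "hclass V \<delta> p x = hclass V \<delta> p y"
  shows "x \<ominus>\<^bsub>V p\<^esub> y \<in> boundaries V \<delta> p"
proof -
  interpret Z: module R "Z p" by (rule cycles_module)
  let ?w = "x \<ominus>\<^bsub>Z p\<^esub> y"
  have w: "?w \<in> boundaries V \<delta> p"
    using assms quot_module_eq[OF cycles_module boundaries_submodule(1)] by (simp add: hclass_def)
  have "?w \<oplus>\<^bsub>Z p\<^esub> y = x" using assms by (simp add: a_minus_def Z.M.a_assoc Z.M.l_neg del: cycles_ops)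
  then have "?w \<oplus>\<^bsub>V p\<^esub> y = x" by simp
  moreover have "?w \<in> carrier (Z p)" using w boundaries_cycles by blast
  then have "?w \<in> carrier (V p)" "y \<in> carrier (V p)" using assms by (simp_all add: cycles_iff)
  moreover have "x \<ominus>\<^bsub>V p\<^esub> y = w" if "w \<oplus>\<^bsub>V p\<^esub> y = x" "w \<in> carrier (V p)" "y \<in> carrier (V p)" for w
    using that by (auto simp: a_minus_def V.M.a_assoc V.M.r_neg)
  ultimately have "x \<ominus>\<^bsub>V p\<^esub> y = ?w" by blast
  then show ?thesis using w by simp
qed

lemma hclass_boundary:
  assumes "x \<in> boundaries V \<delta> p" shows "hclass V \<delta> p x = \<zero>\<^bsub>H p\<^esub>"
proof -
  interpret Z: module R "Z p" by (rule cycles_module)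
  have "x \<in> carrier (Z p)" using assms boundaries_cycles by auto
  moreover from this have "x \<ominus>\<^bsub>Z p\<^esub> \<zero>\<^bsub>Z p\<^esub> = x" by (simp add: a_minus_def del: cycles_ops)
  ultimately show ?thesis
    using assms quot_module_eq[OF cycles_module boundaries_submodule(1), of x p "\<zero>\<^bsub>Z p\<^esub>"]
      quot_module_zero[OF cycles_module boundaries_submodule(1), of p]
    by (simp add: hclass_def homology_def del: cycles_ops)
qed

lemma lin_hom_cycles: "f \<in> lin_hom R M (Z p) \<Longrightarrow> f \<in> lin_hom R M (V p)"
  by (auto simp: lin_hom_def PiE_def Pi_def cycles_iff)

end

section \<open>Contraction onto homology\<close>

text \<open>
  A contraction of a complex onto its homology: \<open>P\<close> extends the class map from cycles to all elements,
  \<open>S\<close> selects a cycle in each class, and \<open>h\<close> is a homotopy from \<open>S P\<close> to the identity.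
  Since \<open>P\<close> is defined on all of \<open>V\<close>, it commutes with sums and signs formed in \<open>V\<close>.
\<close>

locale dg_contraction = dg_mod R V \<delta> for R :: "('r, 'z) ring_scheme" and V :: "int \<Rightarrow> ('r, 'v) module" and \<delta> +
  fixes P :: "int \<Rightarrow> 'v \<Rightarrow> 'v set" and S :: "int \<Rightarrow> 'v set \<Rightarrow> 'v" and h :: "int \<Rightarrow> 'v \<Rightarrow> 'v"
  assumes P_hom: "P p \<in> lin_hom R (V p) (H p)"
    and S_hom: "S p \<in> lin_hom R (H p) (V p)"
    and h_hom: "h p \<in> lin_hom R (V p) (V (p + 1))"
    and P_cycle: "z \<in> carrier (Z p) \<Longrightarrow> P p z = hclass V \<delta> p z"
    and P_delta: "x \<in> carrier (V p) \<Longrightarrow> q = p - 1 \<Longrightarrow> P q (\<delta> p x) = \<zero>\<^bsub>H q\<^esub>"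
    and delta_S: "X \<in> carrier (H p) \<Longrightarrow> \<delta> p (S p X) = \<zero>\<^bsub>V (p - 1)\<^esub>"
    and P_S: "X \<in> carrier (H p) \<Longrightarrow> P p (S p X) = X"
    and homotopy: "x \<in> carrier (V p) \<Longrightarrow>
      \<delta> (p + 1) (h p x) \<oplus>\<^bsub>V p\<^esub> h (p - 1) (\<delta> p x) = x \<ominus>\<^bsub>V p\<^esub> S p (P p x)"

context dg_mod begin

text \<open>
  Projectivity of homology gives a linear section \<open>s\<close> of the class map.  For a cycle \<open>z\<close> the element
  \<open>z - s[z]\<close> is a boundary, and projectivity of the cycles gives a linear choice \<open>t z\<close> of a primitive.
  As \<open>\<delta> x\<close> is a boundary, \<open>t (\<delta> x)\<close> has the same differential as \<open>x\<close>; so \<open>e x = x - t (\<delta> x)\<close> is a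
  cycle, and \<open>e\<close> is a projection onto cycles.  Then \<open>P x = [e x]\<close>, \<open>S = s\<close> and \<open>h x = t (e x)\<close> form a
  contraction.
\<close>

lemma projective_contraction:
  assumes HP: "graded_projective R H" and ZP: "graded_projective R Z"
  obtains P S h where "dg_contraction R V \<delta> P S h"
proof -
  have "\<exists>s\<in>lin_hom R (H p) (Z p). \<forall>X\<in>carrier (H p). (\<lambda>z\<in>carrier (Z p). hclass V \<delta> p z) (s X) = (\<lambda>X\<in>carrier (H p). X) X" for p
  proof (rule projective_lifting[OF _ cycles_module H.V_module hclass_hom])
    show "projective R (H p)" using HP by (simp add: graded_projective_def)
    show "(\<lambda>z\<in>carrier (Z p). hclass V \<delta> p z) ` carrier (Z p) = carrier (H p)" using hclass_surj[of p] by simp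
    show "(\<lambda>X\<in>carrier (H p). X) \<in> lin_hom R (H p) (H p)" by (rule lin_hom_restrictI[OF H.V_module]) auto
  qed
  then obtain s where s: "\<And>p. s p \<in> lin_hom R (H p) (Z p)"
    "\<And>p. \<forall>X\<in>carrier (H p). (\<lambda>z\<in>carrier (Z p). hclass V \<delta> p z) (s p X) = (\<lambda>X\<in>carrier (H p). X) X"
    by metis
  note sc = lin_hom_closed[OF s(1)]
  note sV = lin_hom_cycles[OF s(1)]
  note sVc = lin_hom_closed[OF sV]
  have hs: "hclass V \<delta> p (s p X) = X" if "X \<in> carrier (H p)" for p X
    using bspec[OF s(2)[of p] that] sc[OF that] that by simp
  have hc: "hclass V \<delta> p z \<in> carrier (H p)" if "z \<in> carrier (Z p)" for p z
    using hclass_surj that by blast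
  have ZV: "x \<in> carrier (V p)" if "x \<in> carrier (Z p)" for x p using that by (simp add: cycles_iff)
  define b where "b p = (\<lambda>z\<in>carrier (Z p). z \<ominus>\<^bsub>V p\<^esub> s p (hclass V \<delta> p z))" for p
  define BM where "BM p = (V p)\<lparr>carrier := boundaries V \<delta> p\<rparr>" for p
  have BM: "module R (BM p)" for p
    unfolding BM_def by (rule submodule.submodule_is_module[OF boundaries_submodule(2) V_module])
  have b: "b p \<in> lin_hom R (Z p) (BM p)" for p
    unfolding BM_def
  proof (rule lin_hom_into)
    have i: "(\<lambda>z\<in>carrier (Z p). z) \<in> lin_hom R (Z p) (V p)"
      by (rule lin_hom_cycles, rule lin_hom_restrictI[OF cycles_module]) (auto simp del: cycles_ops)
    have "b p = (\<lambda>z\<in>carrier (Z p). (\<lambda>z\<in>carrier (Z p). z) z \<ominus>\<^bsub>V p\<^esub>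
        compose (carrier (Z p)) (s p) (\<lambda>z\<in>carrier (Z p). hclass V \<delta> p z) z)"
      unfolding b_def by (rule restrict_ext) (simp add: compose_def)
    then show "b p \<in> lin_hom R (Z p) (V p)"
      using lin_hom_minusI[OF i lin_hom_comp[OF hclass_hom sV cycles_module] cycles_module V_module] by simp
    show "b p z \<in> boundaries V \<delta> p" if "z \<in> carrier (Z p)" for z
      using hclass_eq_diff[OF that sc[OF hc[OF that]]] hs[OF hc[OF that]] that by (simp add: b_def)
  qed
  have "\<exists>t\<in>lin_hom R (Z p) (V (p + 1)). \<forall>z\<in>carrier (Z p). \<delta> (p + 1) (t z) = b p z" for p
  proof (rule projective_lifting[OF _ V_module BM _ _ b])
    show "projective R (Z p)" using ZP by (simp add: graded_projective_def)
    have "\<delta> (p + 1) \<in> lin_hom R (V (p + 1)) (V p)" using delta_hom[of "p + 1"] by simp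
    then show "\<delta> (p + 1) \<in> lin_hom R (V (p + 1)) (BM p)"
      by (auto simp: lin_hom_def PiE_def BM_def boundaries_def)
    show "\<delta> (p + 1) ` carrier (V (p + 1)) = carrier (BM p)" by (simp add: BM_def boundaries_def)
  qed
  then have "\<exists>t. \<forall>p. t p \<in> lin_hom R (Z p) (V (p + 1)) \<and> (\<forall>z\<in>carrier (Z p). \<delta> (p + 1) (t p z) = b p z)"
    by (intro choice) blast
  then obtain t where t: "\<And>p. t p \<in> lin_hom R (Z p) (V (p + 1))"
    "\<And>p z. z \<in> carrier (Z p) \<Longrightarrow> \<delta> (p + 1) (t p z) = z \<ominus>\<^bsub>V p\<^esub> s p (hclass V \<delta> p z)"
    by (auto simp: b_def)
  have t': "t (p - 1) \<in> lin_hom R (Z (p - 1)) (V p)" for p using t(1)[of "p - 1"] by simp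
  have dZ: "\<delta> p x \<in> carrier (Z (p - 1))" if "x \<in> carrier (V p)" for p x
    using that delta_closed delta_delta[OF that refl] by (simp add: cycles_iff)
  have hd: "hclass V \<delta> (p - 1) (\<delta> p x) = \<zero>\<^bsub>H (p - 1)\<^esub>" if "x \<in> carrier (V p)" for p x
    by (rule hclass_boundary[OF delta_boundary[OF that refl]])
  have s0: "s p \<zero>\<^bsub>H p\<^esub> = \<zero>\<^bsub>V p\<^esub>" for p by (rule lin_hom_zero[OF sV H.V_module V_module])
  have td: "\<delta> p (t (p - 1) (\<delta> p x)) = \<delta> p x" if "x \<in> carrier (V p)" for p x
    using t(2)[OF dZ[OF that]] hd[OF that] s0[of "p - 1"] delta_closed[OF that] by (simp add: a_minus_def)
  define e where "e p = (\<lambda>x\<in>carrier (V p). x \<ominus>\<^bsub>V p\<^esub> t (p - 1) (\<delta> p x))" for p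
  have tc: "t (p - 1) (\<delta> p x) \<in> carrier (V p)" if "x \<in> carrier (V p)" for p x
    by (rule lin_hom_closed[OF t' dZ[OF that]])
  have e: "e p \<in> lin_hom R (V p) (Z p)" for p
    unfolding cycles_def
  proof (rule lin_hom_into)
    have i: "(\<lambda>x\<in>carrier (V p). x) \<in> lin_hom R (V p) (V p)"
      by (rule lin_hom_restrictI[OF V_module]) auto
    have d: "\<delta> p \<in> lin_hom R (V p) (Z (p - 1))"
      using lin_hom_into[OF delta_hom, of p "carrier (Z (p - 1))"] dZ by (simp add: cycles_def)
    have "e p = (\<lambda>x\<in>carrier (V p). (\<lambda>x\<in>carrier (V p). x) x \<ominus>\<^bsub>V p\<^esub> compose (carrier (V p)) (t (p - 1)) (\<delta> p) x)"
      unfolding e_def by (rule restrict_ext) (simp add: compose_def)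
    then show "e p \<in> lin_hom R (V p) (V p)"
      using lin_hom_minusI[OF i lin_hom_comp[OF d t' V_module] V_module V_module] by simp
    show "e p x \<in> {x \<in> carrier (V p). \<delta> p x = \<zero>\<^bsub>V (p - 1)\<^esub>}" if "x \<in> carrier (V p)" for x
      using that tc td delta_closed lin_hom_minus[OF delta_hom V_module V_module that tc[OF that]]
      by (simp add: e_def V.M.minus_closed V.minus_eq_zero_iff)
  qed
  note ec = lin_hom_closed[OF e]
  have t0: "t p \<zero>\<^bsub>V p\<^esub> = \<zero>\<^bsub>V (p + 1)\<^esub>" for p
    using lin_hom_zero[OF t(1) cycles_module V_module, of p] by simp
  have t0': "t (p - 1) \<zero>\<^bsub>V (p - 1)\<^esub> = \<zero>\<^bsub>V p\<^esub>" for p using t0[of "p - 1"] by simp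
  have eZ: "e p z = z" if "z \<in> carrier (Z p)" for p z
    using that t0'[of p] by (simp add: e_def cycles_iff a_minus_def)
  let ?P = "\<lambda>p. compose (carrier (V p)) (\<lambda>z\<in>carrier (Z p). hclass V \<delta> p z) (e p)"
  let ?h = "\<lambda>p. compose (carrier (V p)) (t p) (e p)"
  have P: "?P p x = hclass V \<delta> p (e p x)" if "x \<in> carrier (V p)" for p x
    using that ec by (simp add: compose_def)
  have hh: "?h p x = t p (e p x)" if "x \<in> carrier (V p)" for p x
    using that by (simp add: compose_def)
  have "dg_contraction R V \<delta> ?P s ?h"
  proof (intro dg_contraction.intro dg_mod_axioms dg_contraction_axioms.intro)
    fix p
    show "?P p \<in> lin_hom R (V p) (H p)" by (rule lin_hom_comp[OF e hclass_hom V_module])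
    show "s p \<in> lin_hom R (H p) (V p)" by (rule sV)
    show "?h p \<in> lin_hom R (V p) (V (p + 1))" by (rule lin_hom_comp[OF e t(1) V_module])
    show "?P p z = hclass V \<delta> p z" if "z \<in> carrier (Z p)" for z
      using P[OF ZV[OF that]] eZ[OF that] by simp
    show "?P q (\<delta> p x) = \<zero>\<^bsub>H q\<^esub>" if "x \<in> carrier (V p)" "q = p - 1" for q x
      using P[OF delta_closed[OF that(1)]] eZ[OF dZ[OF that(1)]] hd[OF that(1)] that(2) by simp
    show "\<delta> p (s p X) = \<zero>\<^bsub>V (p - 1)\<^esub>" if "X \<in> carrier (H p)" for X
      using sc[OF that] by (simp add: cycles_iff)
    show "?P p (s p X) = X" if "X \<in> carrier (H p)" for X
      using P[OF sVc[OF that]] eZ[OF sc[OF that]] hs[OF that] by simp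
    fix x assume x: "x \<in> carrier (V p)"
    have 1: "\<delta> (p + 1) (?h p x) = e p x \<ominus>\<^bsub>V p\<^esub> s p (?P p x)"
      using t(2)[OF ec[OF x]] P[OF x] hh[OF x] by simp
    have 2: "?h (p - 1) (\<delta> p x) = t (p - 1) (\<delta> p x)"
      using hh[OF delta_closed[OF x]] eZ[OF dZ[OF x]] by simp
    have "s p (?P p x) \<in> carrier (V p)" using sVc[OF hc[OF ec[OF x]]] P[OF x] by simp
    moreover have "(a \<ominus>\<^bsub>V p\<^esub> c \<ominus>\<^bsub>V p\<^esub> d) \<oplus>\<^bsub>V p\<^esub> c = a \<ominus>\<^bsub>V p\<^esub> d"
      if "a \<in> carrier (V p)" "c \<in> carrier (V p)" "d \<in> carrier (V p)" for a c d
      using that by (simp add: a_minus_def V.M.a_ac V.M.r_neg1 V.M.r_neg2)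
    moreover have "e p x = x \<ominus>\<^bsub>V p\<^esub> t (p - 1) (\<delta> p x)" using x by (simp add: e_def)
    ultimately show "\<delta> (p + 1) (?h p x) \<oplus>\<^bsub>V p\<^esub> ?h (p - 1) (\<delta> p x) = x \<ominus>\<^bsub>V p\<^esub> s p (?P p x)"
      unfolding 1 2 using x tc[OF x] by metis
  qed
  then show thesis by (rule that)
qed

end

section \<open>Cocycles up to homotopy\<close>

context dg_mod begin

lemma cocycle_eq:
  assumes f: "f \<in> carrier (E n i)" and c: "End_diff R V \<delta> n i f = \<zero>\<^bsub>E n (i - 1)\<^esub>"
    and xs: "word_ok V xs" "length xs = n" "d = wdeg xs + i - 1" and e: "e = wdeg xs + i"
  shows "\<delta> e (ev f xs) = ksign (V d) i (\<Oplus>\<^bsub>V d\<^esub>k\<in>{..<n}. ksign (V d) (wdeg (take k xs)) (ev f (upd k (-1) \<delta> xs)))"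
proof -
  have d': "d = wdeg xs + (i - 1)" using xs by simp
  have u: "ev f (upd k (-1) \<delta> xs) \<in> carrier (V d)" if "k < n" for k
    by (rule teval_closed[OF f]) (use upd_ok[OF xs(1) delta_hom'] that xs in auto)
  have "\<delta> e (ev f xs) \<in> carrier (V d)"
    using delta_closed[OF teval_closed[OF f xs(1,2) e]] e xs by simp
  moreover have "ksign (V d) i (\<Oplus>\<^bsub>V d\<^esub>k\<in>{..<n}. ksign (V d) (wdeg (take k xs)) (ev f (upd k (-1) \<delta> xs))) \<in> carrier (V d)"
    by (rule V.ksign_closed, rule V.M.finsum_closed) (use u in auto)
  moreover have "\<delta> e (ev f xs) \<ominus>\<^bsub>V d\<^esub> ksign (V d) i (\<Oplus>\<^bsub>V d\<^esub>k\<in>{..<n}.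
      ksign (V d) (wdeg (take k xs)) (ev f (upd k (-1) \<delta> xs))) = \<zero>\<^bsub>V d\<^esub>"
    using teval_End_diff[OF f xs] teval_zero[OF xs(1,2) d'] unfolding c e by simp
  ultimately show ?thesis by (rule V.minus_eq_zero_iff[THEN iffD1])
qed

lemma cycles_word: "word_ok Z zs \<Longrightarrow> word_ok V zs"
  by (auto simp: word_ok_def cycles_iff)

lemma teval_End_diff_zero_slots:
  assumes f: "f \<in> carrier (E n i)" and xs: "word_ok V xs" "length xs = n" "d = wdeg xs + i - 1"
    and z: "\<And>k. k < n \<Longrightarrow> ev f (upd k (-1) \<delta> xs) = \<zero>\<^bsub>V d\<^esub>"
  shows "ev (End_diff R V \<delta> n i f) xs = \<delta> (wdeg xs + i) (ev f xs)"
proof -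
  have "(\<Oplus>\<^bsub>V d\<^esub>k\<in>{..<n}. ksign (V d) (wdeg (take k xs)) (ev f (upd k (-1) \<delta> xs))) = \<zero>\<^bsub>V d\<^esub>"
    by (rule V.finsum_zeroI) (simp add: z)
  moreover have "\<delta> (wdeg xs + i) (ev f xs) \<in> carrier (V d)"
    using delta_closed[OF teval_closed[OF f xs(1,2) refl]] xs by simp
  ultimately show ?thesis unfolding teval_End_diff[OF f xs] by (simp add: a_minus_def)
qed

lemma teval_upd_cycles:
  assumes f: "f \<in> carrier (E n i)" and zs: "word_ok Z zs" "length zs = n" and k: "k < n"
  shows "ev f (upd k (-1) \<delta> zs) = \<zero>\<^bsub>V (wdeg zs + i - 1)\<^esub>"
proof -
  obtain us p x vs where e: "zs = us @ (p, x) # vs" "length us = k" using word_split zs(2) k by metis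
  have x: "\<delta> p x = \<zero>\<^bsub>V (p - 1)\<^esub>" and ok: "word_ok V us" "word_ok V vs" "length us + 1 + length vs = n"
    using zs cycles_word unfolding e(1) by (auto simp: cycles_iff)
  show ?thesis
    unfolding e(1) upd_append[OF e(2)] x using teval_zero_slot[OF f ok refl, of "p - 1"]
    by (simp add: algebra_simps)
qed

lemma teval_End_diff_cycles:
  assumes f: "f \<in> carrier (E n i)" and zs: "word_ok Z zs" "length zs = n"
  shows "ev (End_diff R V \<delta> n i f) zs = \<delta> (wdeg zs + i) (ev f zs)"
  by (rule teval_End_diff_zero_slots[OF f cycles_word[OF zs(1)] zs(2) refl teval_upd_cycles[OF f zs]])

end

context dg_contraction begin

definition pi :: "int \<Rightarrow> 'v \<Rightarrow> 'v" where
  "pi p = compose (carrier (V p)) (S p) (P p)"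

lemma pi_eq: "x \<in> carrier (V p) \<Longrightarrow> pi p x = S p (P p x)"
  by (simp add: pi_def compose_def)

lemma pi_hom: "pi p \<in> lin_hom R (V p) (V p)"
  unfolding pi_def by (rule lin_hom_comp[OF P_hom S_hom V_module])

lemma pi_hom': "pi p \<in> lin_hom R (V p) (V (p + 0))"
  using pi_hom by simp

lemmas P_closed = lin_hom_closed[OF P_hom]
lemmas S_closed = lin_hom_closed[OF S_hom]
lemmas h_closed = lin_hom_closed[OF h_hom]
lemmas pi_closed = lin_hom_closed[OF pi_hom]

lemma S_zero: "S p \<zero>\<^bsub>H p\<^esub> = \<zero>\<^bsub>V p\<^esub>"
  by (rule lin_hom_zero[OF S_hom H.V_module V_module])

lemma P_zero: "P p \<zero>\<^bsub>V p\<^esub> = \<zero>\<^bsub>H p\<^esub>"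
  by (rule lin_hom_zero[OF P_hom V_module H.V_module])

lemma delta_pi: "x \<in> carrier (V p) \<Longrightarrow> \<delta> p (pi p x) = \<zero>\<^bsub>V (p - 1)\<^esub>"
  by (simp add: pi_eq delta_S P_closed)

lemma pi_delta: "x \<in> carrier (V p) \<Longrightarrow> q = p - 1 \<Longrightarrow> pi q (\<delta> p x) = \<zero>\<^bsub>V q\<^esub>"
  using delta_closed[of x p] by (simp add: pi_eq P_delta S_zero)

text \<open>
  Replace the letter at position \<open>k\<close> by its image under \<open>\<pi> = S P\<close>.  The difference is the differential of
  \<open>g(x\<^sub>1, \<dots>, x\<^sub>n) = \<plusminus> f(x\<^sub>1, \<dots>, h x\<^sub>k, \<dots>, x\<^sub>n)\<close>: by the cocycle condition for \<open>f\<close>, the terms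
  with \<open>\<delta>\<close> at a position \<open>l \<noteq> k\<close> cancel, and position \<open>k\<close> contributes \<open>\<delta> h + h \<delta> = 1 - \<pi>\<close>.
\<close>

lemma cocycle_homotopy_step:
  assumes f: "f \<in> carrier (E n i)" and c: "End_diff R V \<delta> n i f = \<zero>\<^bsub>E n (i - 1)\<^esub>"
    and k: "k < n"
  obtains f' g where "f' \<in> carrier (E n i)" "g \<in> carrier (E n (i + 1))"
    "End_diff R V \<delta> n i f' = \<zero>\<^bsub>E n (i - 1)\<^esub>"
    "f = f' \<oplus>\<^bsub>E n i\<^esub> End_diff R V \<delta> n (i + 1) g"
    "\<And>xs. word_ok V xs \<Longrightarrow> length xs = n \<Longrightarrow> ev f' xs = ev f (upd k 0 pi xs)"
proof -
  have "multilinear R V n V i (\<lambda>xs. ev f (upd k 0 pi xs))"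
    using multilinear_upd[OF End_multilinear[OF f] pi_hom' k] by simp
  then obtain f' where f': "f' \<in> carrier (E n i)"
    "\<And>xs. word_ok V xs \<Longrightarrow> length xs = n \<Longrightarrow> ev f' xs = ev f (upd k 0 pi xs)"
    by (rule End_cochainE) blast
  \<comment> \<open>The sign is the Koszul sign for passing \<open>h\<close> over \<open>f\<close>, of degree \<open>i\<close>, and over the first \<open>k\<close> letters.\<close>
  have "multilinear R V n V (i + 1) (\<lambda>xs. ksign (V (wdeg xs + (i + 1))) ((\<lambda>ds. sum_list (take k ds) + i) (map fst xs))
      (ev f (upd k 1 h xs)))"
    by (rule multilinear_ksign[OF multilinear_upd[OF End_multilinear[OF f] h_hom k] V_graded])
  then obtain g where g: "g \<in> carrier (E n (i + 1))"
    and "\<And>xs. word_ok V xs \<Longrightarrow> length xs = n \<Longrightarrow> ev g xs =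
      ksign (V (wdeg xs + (i + 1))) ((\<lambda>ds. sum_list (take k ds) + i) (map fst xs)) (ev f (upd k 1 h xs))"
    by (rule End_cochainE) blast
  then have ge: "ev g xs = ksign (V e) (wdeg (take k xs) + i) (ev f (upd k 1 h xs))"
    if "word_ok V xs" "length xs = n" "e = wdeg xs + (i + 1)" for xs e
    using that by (simp add: wdeg_def take_map)
  have split: thesis' if xs: "word_ok V xs" "length xs = n" and *:
    "\<And>us p x vs. xs = us @ (p, x) # vs \<Longrightarrow> length us = k \<Longrightarrow> word_ok V us \<Longrightarrow> word_ok V vs \<Longrightarrow>
       x \<in> carrier (V p) \<Longrightarrow> length us + 1 + length vs = n \<Longrightarrow> thesis'" for xs thesis'
  proof -
    obtain us p x vs where "xs = us @ (p, x) # vs" "length us = k" using word_split k xs(2) by metis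
    then show ?thesis using xs * by auto
  qed
  have "End_diff R V \<delta> n i f' = \<zero>\<^bsub>E n (i - 1)\<^esub>"
  proof (rule End_ext[OF End_diff_closed[OF f'(1)] E.M.zero_closed])
    fix xs assume xs: "word_ok V xs" "length xs = n"
    define d where "d = wdeg xs + i - 1"
    have d': "d = wdeg xs + (i - 1)" by (simp add: d_def)
    obtain us p x vs where e: "xs = us @ (p, x) # vs" "length us = k" and ok: "word_ok V us" "word_ok V vs"
        "x \<in> carrier (V p)" "length us + 1 + length vs = n"
      using split[OF xs] by blast
    let ?y = "upd k 0 pi xs"
    have y: "word_ok V ?y" "wdeg ?y = wdeg xs" "length ?y = n"
      using upd_ok[OF xs(1) pi_hom'] k xs(2) by simp_all
    have z: "ev f (us @ (p - 1, \<zero>\<^bsub>V (p - 1)\<^esub>) # vs) = \<zero>\<^bsub>V d\<^esub>"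
      by (rule teval_zero_slot[OF f ok(1,2,4)]) (simp add: d_def e)
    have same: "ev f' (upd l (-1) \<delta> xs) = ev f (upd l (-1) \<delta> ?y)" if "l < n" for l
    proof -
      have w: "word_ok V (upd l (-1) \<delta> xs)" "length (upd l (-1) \<delta> xs) = n"
        using upd_ok[OF xs(1) delta_hom'] that xs(2) by simp_all
      show ?thesis
      proof (cases "l = k")
        case True
        have "upd k 0 pi (upd k (-1) \<delta> xs) = us @ (p - 1, \<zero>\<^bsub>V (p - 1)\<^esub>) # vs"
          unfolding e(1) upd_append[OF e(2)] using ok pi_delta[OF ok(3) refl] by simp
        moreover have "upd k (-1) \<delta> ?y = us @ (p - 1, \<zero>\<^bsub>V (p - 1)\<^esub>) # vs"
          unfolding e(1) upd_append[OF e(2)] using ok delta_pi[OF ok(3)] by simp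
        ultimately show ?thesis unfolding f'(2)[OF w] by (simp add: True z)
      next
        case False
        then show ?thesis unfolding f'(2)[OF w] by (simp add: upd_swap[of k l])
      qed
    qed
    have tk: "wdeg (take l ?y) = wdeg (take l xs)" for l using wdeg_take_upd[of k xs l 0 pi] k xs(2) by simp
    have u: "ev f (upd l (-1) \<delta> ?y) \<in> carrier (V d)" if "l < n" for l
      by (rule teval_closed[OF f]) (use upd_ok[OF y(1) delta_hom'] that y in \<open>auto simp: d_def\<close>)
    have "(\<Oplus>\<^bsub>V d\<^esub>l\<in>{..<n}. ksign (V d) (wdeg (take l xs)) (ev f' (upd l (-1) \<delta> xs)))
        = (\<Oplus>\<^bsub>V d\<^esub>l\<in>{..<n}. ksign (V d) (wdeg (take l ?y)) (ev f (upd l (-1) \<delta> ?y)))"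
      by (rule V.M.finsum_cong') (use same tk u in auto)
    moreover have "\<delta> (wdeg xs + i) (ev f' xs) = ksign (V d) i
       (\<Oplus>\<^bsub>V d\<^esub>l\<in>{..<n}. ksign (V d) (wdeg (take l ?y)) (ev f (upd l (-1) \<delta> ?y)))"
      unfolding f'(2)[OF xs] by (rule cocycle_eq[OF f c y(1,3)]) (simp_all add: y(2) d_def)
    moreover have "\<delta> (wdeg xs + i) (ev f' xs) \<in> carrier (V d)"
      using delta_closed[OF teval_closed[OF f'(1) xs refl]] by (simp add: d_def)
    ultimately show "ev (End_diff R V \<delta> n i f') xs = ev \<zero>\<^bsub>E n (i - 1)\<^esub> xs"
      unfolding teval_End_diff[OF f'(1) xs d_def] teval_zero[OF xs d'] by (simp add: V.minus_eq_zero_iff)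
  qed
  moreover have "f = f' \<oplus>\<^bsub>E n i\<^esub> End_diff R V \<delta> n (i + 1) g"
  proof (rule End_ext[OF f])
    have gd: "End_diff R V \<delta> n (i + 1) g \<in> carrier (E n i)" using End_diff_closed[OF g] by simp
    then show "f' \<oplus>\<^bsub>E n i\<^esub> End_diff R V \<delta> n (i + 1) g \<in> carrier (E n i)"
      using f'(1) by simp
    fix xs assume xs: "word_ok V xs" "length xs = n"
    define d where "d = wdeg xs + i"
    have d1: "d = wdeg xs + (i + 1) - 1" by (simp add: d_def)
    obtain us p x vs where e: "xs = us @ (p, x) # vs" "length us = k" and ok: "word_ok V us" "word_ok V vs"
        "x \<in> carrier (V p)" "length us + 1 + length vs = n"
      using split[OF xs] by blast
    define U where "U l = wdeg (take l xs)" for l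
    define y where "y = upd k 1 h xs"
    have y: "word_ok V y" "wdeg y = wdeg xs + 1" "length y = n"
      using upd_ok[OF xs(1) h_hom] k xs(2) by (simp_all add: y_def)
    define F where "F l = ev f (upd l (-1) \<delta> y)" for l
    define G where "G l = ev f (upd k 1 h (upd l (-1) \<delta> xs))" for l
    have Fc: "F l \<in> carrier (V d)" if "l < n" for l
      unfolding F_def by (rule teval_closed[OF f]) (use upd_ok[OF y(1) delta_hom'] that y in \<open>auto simp: d_def\<close>)
    have w: "word_ok V (upd l (-1) \<delta> xs)" "length (upd l (-1) \<delta> xs) = n" "d = wdeg (upd l (-1) \<delta> xs) + (i + 1)" if "l < n" for l
      using upd_ok[OF xs(1) delta_hom'] that xs(2) by (simp_all add: d_def)
    have Gc: "G l \<in> carrier (V d)" if "l < n" for l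
      unfolding G_def by (rule teval_closed[OF f]) (use upd_ok[OF w(1)[OF that] h_hom] w[OF that] k in auto)
    have yf: "ev f y \<in> carrier (V (d + 1))"
      by (rule teval_closed[OF f y(1,3)]) (simp add: y d_def)
    have dh: "\<delta> (d + 1) \<in> lin_hom R (V (d + 1)) (V d)" using delta_hom[of "d + 1"] by simp
    have "\<delta> (d + 1) (ev g xs) = ksign (V d) (U k + i) (\<delta> (d + 1) (ev f y))"
      using ge[OF xs, of "d + 1"] lin_hom_ksign[OF dh V_module V_module yf] by (simp add: d_def U_def y_def)
    also have "\<delta> (d + 1) (ev f y) = ksign (V d) i (\<Oplus>\<^bsub>V d\<^esub>l\<in>{..<n}. ksign (V d) (wdeg (take l y)) (F l))"
      unfolding F_def by (rule cocycle_eq[OF f c y(1,3)]) (simp_all add: y d_def)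
    also have "ksign (V d) (U k + i) \<dots> = (\<Oplus>\<^bsub>V d\<^esub>l\<in>{..<n}. ksign (V d) (U k + i + i + wdeg (take l y)) (F l))"
      using Fc by (simp add: V.ksign_finsum Pi_def V.M.finsum_closed add.assoc cong: V.M.finsum_cong)
    finally have A: "\<delta> (wdeg xs + (i + 1)) (ev g xs) = \<dots>" by (simp add: d_def add.assoc)
    have "(\<Oplus>\<^bsub>V d\<^esub>l\<in>{..<n}. ksign (V d) (wdeg (take l xs)) (ev g (upd l (-1) \<delta> xs)))
      = (\<Oplus>\<^bsub>V d\<^esub>l\<in>{..<n}. ksign (V d) (U l + (wdeg (take k (upd l (-1) \<delta> xs)) + i)) (G l))"
      by (rule V.M.finsum_cong') (use Gc ge[OF w] in \<open>auto simp: U_def G_def\<close>)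
    then have B: "ksign (V d) (i + 1) (\<Oplus>\<^bsub>V d\<^esub>l\<in>{..<n}. ksign (V d) (wdeg (take l xs)) (ev g (upd l (-1) \<delta> xs)))
      = (\<Oplus>\<^bsub>V d\<^esub>l\<in>{..<n}. ksign (V d) (i + 1 + (U l + (wdeg (take k (upd l (-1) \<delta> xs)) + i))) (G l))"
      using Gc by (simp add: V.ksign_finsum Pi_def cong: V.M.finsum_cong)
    let ?t = "\<lambda>l. ksign (V d) (U k + i + i + wdeg (take l y)) (F l) \<ominus>\<^bsub>V d\<^esub>
       ksign (V d) (i + 1 + (U l + (wdeg (take k (upd l (-1) \<delta> xs)) + i))) (G l)"
    have "ev (End_diff R V \<delta> n (i + 1) g) xs = (\<Oplus>\<^bsub>V d\<^esub>l\<in>{..<n}. ?t l)"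
      unfolding teval_End_diff[OF g xs d1] A B by (rule V.finsum_minusf) (use Fc Gc in auto)
    also have "\<dots> = ?t k"
    proof (rule V.finsum_pick_one)
      fix l assume l: "l \<in> {..<n}" "l \<noteq> k"
      have FG: "G l = F l" using l by (simp add: F_def G_def y_def upd_swap)
      have "even (U k + i + i + wdeg (take l y)) = even (i + 1 + (U l + (wdeg (take k (upd l (-1) \<delta> xs)) + i)))"
        using l k wdeg_take_upd[of k xs l 1 h] wdeg_take_upd[of l xs k "-1" \<delta>] xs(2) by (simp add: y_def U_def) blast
      then have "?t l = ksign (V d) (U k + i + i + wdeg (take l y)) (F l) \<ominus>\<^bsub>V d\<^esub> ksign (V d) (U k + i + i + wdeg (take l y)) (F l)"
        using ksign_cong FG by metis
      then show "?t l = \<zero>\<^bsub>V d\<^esub>" using Fc l by (simp add: V.minus_eq_zero_iff)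
    qed (use k Fc Gc in \<open>auto intro: V.M.minus_closed\<close>)
    also have "?t k = F k \<oplus>\<^bsub>V d\<^esub> G k"
    proof -
      \<comment> \<open>At position \<open>k\<close> the two summands have opposite signs, so their difference is a sum.\<close>
      have a: "even (U k + i + i + wdeg (take k y))" "odd (i + 1 + (U k + (wdeg (take k (upd k (-1) \<delta> xs)) + i)))"
        using k wdeg_take_upd[of k xs k 1 h] wdeg_take_upd[of k xs k "-1" \<delta>] xs(2) by (simp_all add: y_def U_def)
      then show ?thesis using Fc[OF k] Gc[OF k] by (simp add: ksign_def a_minus_def)
    qed
    also have "\<dots> = ev f xs \<ominus>\<^bsub>V d\<^esub> ev f' xs"
    proof -
      have slot: "(\<lambda>x\<in>carrier (V p). ev f (us @ (p, x) # vs)) \<in> lin_hom R (V p) (V d)"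
        by (rule teval_slot[OF f ok(1,2,4)]) (simp add: d_def e)
      have c1: "\<delta> (p + 1) (h p x) \<in> carrier (V p)" using delta_closed[OF h_closed[OF ok(3)]] by simp
      have c2: "h (p - 1) (\<delta> p x) \<in> carrier (V p)" using h_closed[OF delta_closed[OF ok(3)]] by simp
      have "F k = ev f (us @ (p, \<delta> (p + 1) (h p x)) # vs)"
        unfolding F_def y_def e(1) upd_append[OF e(2)] by simp
      moreover have "G k = ev f (us @ (p, h (p - 1) (\<delta> p x)) # vs)"
        unfolding G_def e(1) upd_append[OF e(2)] by simp
      ultimately have "F k \<oplus>\<^bsub>V d\<^esub> G k = ev f (us @ (p, x \<ominus>\<^bsub>V p\<^esub> pi p x) # vs)"
        using lin_hom_add[OF slot c1 c2] c1 c2 V.M.a_closed[OF c1 c2] homotopy[OF ok(3)] pi_eq[OF ok(3)] by simp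
      also have "\<dots> = ev f xs \<ominus>\<^bsub>V d\<^esub> ev f (us @ (p, pi p x) # vs)"
        using lin_hom_minus[OF slot V_module V_module ok(3) pi_closed[OF ok(3)]] ok(3) pi_closed[OF ok(3)] e
        by (simp add: V.M.minus_closed)
      finally show ?thesis using f'(2)[OF xs] by (simp add: e upd_append)
    qed
    finally have D: "ev (End_diff R V \<delta> n (i + 1) g) xs = \<dots>" .
    have "ev f xs \<in> carrier (V d)" "ev f' xs \<in> carrier (V d)"
      using teval_closed[OF f xs d_def] teval_closed[OF f'(1) xs d_def] by auto
    then show "ev f xs = ev (f' \<oplus>\<^bsub>E n i\<^esub> End_diff R V \<delta> n (i + 1) g) xs"
      unfolding teval_add[OF xs d_def f'(1) gd] D by (simp add: a_minus_def V.M.a_ac V.M.r_neg)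
  qed
  ultimately show ?thesis using that f' g by blast
qed

text \<open>
  Working on one letter at a time avoids the explicit homotopy on the tensor power.
\<close>

lemma cocycle_homotopy_iter:
  assumes f: "f \<in> carrier (E n i)" and c: "End_diff R V \<delta> n i f = \<zero>\<^bsub>E n (i - 1)\<^esub>"
    and n: "1 \<le> n"
  shows "k \<le> n \<Longrightarrow> \<exists>f' g. f' \<in> carrier (E n i) \<and> g \<in> carrier (E n (i + 1)) \<and>
    End_diff R V \<delta> n i f' = \<zero>\<^bsub>E n (i - 1)\<^esub> \<and>
    f = f' \<oplus>\<^bsub>E n i\<^esub> End_diff R V \<delta> n (i + 1) g \<and>
    (\<forall>xs. word_ok V xs \<and> length xs = n \<longrightarrow> ev f' xs = ev f (map_letters pi (take k xs) @ drop k xs))"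
proof (induction k)
  case 0
  show ?case
    by (rule exI[of _ f], rule exI[of _ "\<zero>\<^bsub>E n (i + 1)\<^esub>"])
      (use f c End_diff_0[OF n, of "i + 1"] in simp)
next
  case (Suc k)
  then obtain f' g where f': "f' \<in> carrier (E n i)" and g: "g \<in> carrier (E n (i + 1))"
    and c': "End_diff R V \<delta> n i f' = \<zero>\<^bsub>E n (i - 1)\<^esub>"
    and ff': "f = f' \<oplus>\<^bsub>E n i\<^esub> End_diff R V \<delta> n (i + 1) g"
    and e: "\<forall>xs. word_ok V xs \<and> length xs = n \<longrightarrow> ev f' xs = ev f (map_letters pi (take k xs) @ drop k xs)"
    by auto
  have k: "k < n" using Suc by simp
  obtain f2 g2 where f2: "f2 \<in> carrier (E n i)" and g2: "g2 \<in> carrier (E n (i + 1))"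
    and c2: "End_diff R V \<delta> n i f2 = \<zero>\<^bsub>E n (i - 1)\<^esub>"
    and ff2: "f' = f2 \<oplus>\<^bsub>E n i\<^esub> End_diff R V \<delta> n (i + 1) g2"
    and e2: "\<And>xs. word_ok V xs \<Longrightarrow> length xs = n \<Longrightarrow> ev f2 xs = ev f' (upd k 0 pi xs)"
    using cocycle_homotopy_step[OF f' c' k] by blast
  have dc: "End_diff R V \<delta> n (i + 1) g \<in> carrier (E n i)" "End_diff R V \<delta> n (i + 1) g2 \<in> carrier (E n i)"
    using End_diff_closed[OF g] End_diff_closed[OF g2] by simp_all
  have "f = f2 \<oplus>\<^bsub>E n i\<^esub> End_diff R V \<delta> n (i + 1) (g2 \<oplus>\<^bsub>E n (i + 1)\<^esub> g)"
    using ff' ff2 End_diff_add[OF n g2 g] f2 dc by (simp add: E.M.a_assoc)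
  moreover have "ev f2 xs = ev f (map_letters pi (take (Suc k) xs) @ drop (Suc k) xs)"
    if xs: "word_ok V xs" "length xs = n" for xs
  proof -
    obtain us p x vs where w: "xs = us @ (p, x) # vs" "length us = k" using word_split k xs(2) by metis
    have y: "word_ok V (upd k 0 pi xs)" "length (upd k 0 pi xs) = n" using upd_ok[OF xs(1) pi_hom'] k xs(2) by simp_all
    have "map_letters pi (take k (upd k 0 pi xs)) @ drop k (upd k 0 pi xs)
        = map_letters pi (take (Suc k) xs) @ drop (Suc k) xs"
      using w by (simp add: upd_append)
    then show ?thesis using e2[OF xs] e y by simp
  qed
  ultimately show ?case using f2 g2 g c2 by (intro exI[of _ f2] exI[of _ "g2 \<oplus>\<^bsub>E n (i + 1)\<^esub> g"]) auto
qed

lemma cocycle_homotopy: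
  assumes f: "f \<in> carrier (E n i)" and c: "End_diff R V \<delta> n i f = \<zero>\<^bsub>E n (i - 1)\<^esub>"
    and n: "1 \<le> n"
  obtains f' g where "f' \<in> carrier (E n i)" "g \<in> carrier (E n (i + 1))"
    "f = f' \<oplus>\<^bsub>E n i\<^esub> End_diff R V \<delta> n (i + 1) g"
    "\<And>xs. word_ok V xs \<Longrightarrow> length xs = n \<Longrightarrow> ev f' xs = ev f (map_letters pi xs)"
  using cocycle_homotopy_iter[OF f c n order.refl] by auto

end

section \<open>Cochains induced on homology\<close>

context dg_contraction begin

text \<open>
  That \<open>f\<close> induces \<open>F\<close> on homology.  The condition concerns values on words of cycles only, so its
  compatibility with composites can be checked word by word.
\<close>

definition induces :: "nat \<Rightarrow> int \<Rightarrow> ('r, 'v) cochain \<Rightarrow> ('r, 'v set) cochain \<Rightarrow> bool" where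
  "induces n i f F \<longleftrightarrow> f \<in> carrier (E n i) \<and> F \<in> carrier (H.E n i) \<and>
     (\<forall>zs. word_ok Z zs \<and> length zs = n \<longrightarrow> ev f zs \<in> carrier (Z (wdeg zs + i)) \<and>
        H.ev F (map_letters P zs) = P (wdeg zs + i) (ev f zs))"

lemma inducesD:
  assumes "induces n i f F"
  shows "f \<in> carrier (E n i)" "F \<in> carrier (H.E n i)"
    "\<And>zs d. word_ok Z zs \<Longrightarrow> length zs = n \<Longrightarrow> d = wdeg zs + i \<Longrightarrow> ev f zs \<in> carrier (Z d)"
    "\<And>zs d. word_ok Z zs \<Longrightarrow> length zs = n \<Longrightarrow> d = wdeg zs + i \<Longrightarrow>
       H.ev F (map_letters P zs) = P d (ev f zs)"
  using assms by (auto simp: induces_def)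

lemma S_word: "word_ok H Xs \<Longrightarrow> word_ok Z (map_letters S Xs)"
  by (rule map_letters_ok) (auto simp: cycles_iff S_closed delta_S)

lemma P_word: "word_ok V xs \<Longrightarrow> word_ok H (map_letters P xs)"
  by (rule map_letters_ok) (auto simp: P_closed)

lemma P_S_word: "word_ok H Xs \<Longrightarrow> map_letters P (map_letters S Xs) = Xs"
  by (induction Xs) (auto simp: P_S)

lemma S_P_word: "word_ok V xs \<Longrightarrow> map_letters S (map_letters P xs) = map_letters pi xs"
  by (induction xs) (auto simp: pi_eq)

lemma hclass_word: "word_ok Z zs \<Longrightarrow> map (\<lambda>(p, z). (p, hclass V \<delta> p z)) zs = map_letters P zs"
  by (induction zs) (auto simp: P_cycle)

text \<open>
  Every word of homology classes is the image of a word of cycles.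
\<close>

lemma induces_unique:
  assumes "induces n i f F" "induces n i f G" shows "F = G"
proof (rule H.End_ext)
  show "F \<in> carrier (H.E n i)" "G \<in> carrier (H.E n i)" using inducesD assms by auto
  fix Xs assume X: "word_ok H Xs" "length Xs = n"
  have "H.ev F (map_letters P (map_letters S Xs)) = H.ev G (map_letters P (map_letters S Xs))"
    using inducesD(4)[OF assms(1) S_word[OF X(1)] _ refl] inducesD(4)[OF assms(2) S_word[OF X(1)] _ refl] X(2) by simp
  then show "H.ev F Xs = H.ev G Xs" by (simp add: P_S_word[OF X(1)])
qed

lemma induced_eq:
  assumes "induces n i f F" shows "induced R V \<delta> n i f = F"
  unfolding induced_def
proof (rule the_equality)
  have key: "hclass V \<delta> (wdeg zs + i) (f (wdeg zs) (pure_tensor R V zs)) = P (wdeg zs + i) (ev f zs)"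
    if "zs \<in> words Z n" for zs
    using that inducesD(3)[OF assms _ _ refl, of zs] P_cycle by (simp add: words_iff teval_def)
  have eq: "G (wdeg zs) (pure_tensor R H (map (\<lambda>(p, z). (p, hclass V \<delta> p z)) zs)) = H.ev G (map_letters P zs)"
    if "zs \<in> words Z n" for G :: "('r, 'v set) cochain" and zs
    using that hclass_word[of zs] by (simp add: words_iff teval_def)
  show "F \<in> carrier (H.E n i) \<and> (\<forall>zs\<in>words Z n.
      F (wdeg zs) (pure_tensor R H (map (\<lambda>(p, z). (p, hclass V \<delta> p z)) zs))
      = hclass V \<delta> (wdeg zs + i) (f (wdeg zs) (pure_tensor R V zs)))"
    using inducesD(2)[OF assms] inducesD(4)[OF assms _ _ refl] by (simp add: eq key words_iff)
  fix G assume G: "G \<in> carrier (H.E n i) \<and> (\<forall>zs\<in>words Z n.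
      G (wdeg zs) (pure_tensor R H (map (\<lambda>(p, z). (p, hclass V \<delta> p z)) zs))
      = hclass V \<delta> (wdeg zs + i) (f (wdeg zs) (pure_tensor R V zs)))"
  then have "induces n i f G"
    using inducesD(1,3)[OF assms] by (auto simp: induces_def eq key words_iff)
  then show "G = F" using induces_unique assms by blast
qed

lemma cocycle_on_cycles:
  assumes f: "f \<in> carrier (E n i)" and c: "End_diff R V \<delta> n i f = \<zero>\<^bsub>E n (i - 1)\<^esub>"
    and zs: "word_ok Z zs" "length zs = n" "d = wdeg zs + i"
  shows "ev f zs \<in> carrier (Z d)"
proof -
  have "\<delta> d (ev f zs) = ev \<zero>\<^bsub>E n (i - 1)\<^esub> zs"
    using teval_End_diff_cycles[OF f zs(1,2)] c zs(3) by simp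
  also have "\<dots> = \<zero>\<^bsub>V (d - 1)\<^esub>"
    by (rule teval_zero[OF cycles_word[OF zs(1)] zs(2)]) (simp add: zs(3))
  finally show ?thesis using teval_closed[OF f cycles_word[OF zs(1)] zs(2,3)] by (simp add: cycles_iff)
qed

text \<open>
  The induced map sends classes \<open>X\<^sub>1, \<dots>, X\<^sub>n\<close> to the class of \<open>f(S X\<^sub>1, \<dots>, S X\<^sub>n)\<close>.  Independence of
  the chosen cycles is the case of cycles in \<open>cocycle_homotopy\<close>: there the coboundary takes a boundary
  as its value.
\<close>

lemma induces_exists:
  assumes f: "f \<in> carrier (E n i)" and c: "End_diff R V \<delta> n i f = \<zero>\<^bsub>E n (i - 1)\<^esub>"
    and n: "1 \<le> n"
  obtains F where "induces n i f F"
proof -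
  have "multilinear R H n H (i + 0) (\<lambda>Xs. P (wdeg Xs + i) (ev f (map_letters S Xs)))"
    by (rule multilinear_map_letters[OF graded_mod_axioms H.graded_mod_axioms End_multilinear[OF f] S_hom])
      (simp add: P_hom)
  then obtain F where F: "F \<in> carrier (H.E n i)"
    "\<And>Xs. word_ok H Xs \<Longrightarrow> length Xs = n \<Longrightarrow> H.ev F Xs = P (wdeg Xs + i) (ev f (map_letters S Xs))"
    using H.End_cochainE[of n "i + 0"] by auto
  obtain f' g where f': "f' \<in> carrier (E n i)" and g: "g \<in> carrier (E n (i + 1))"
    and ff': "f = f' \<oplus>\<^bsub>E n i\<^esub> End_diff R V \<delta> n (i + 1) g"
    and e: "\<And>xs. word_ok V xs \<Longrightarrow> length xs = n \<Longrightarrow> ev f' xs = ev f (map_letters pi xs)"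
    using cocycle_homotopy[OF f c n] by blast
  have gd: "End_diff R V \<delta> n (i + 1) g \<in> carrier (E n i)" using End_diff_closed[OF g] by simp
  have "H.ev F (map_letters P zs) = P (wdeg zs + i) (ev f zs)"
    if zs: "word_ok Z zs" "length zs = n" for zs
  proof -
    note ok = cycles_word[OF zs(1)]
    let ?d = "wdeg zs + i"
    have gc: "ev g zs \<in> carrier (V (?d + 1))" by (rule teval_closed[OF g ok zs(2)]) simp
    have "ev f zs = ev f' zs \<oplus>\<^bsub>V ?d\<^esub> \<delta> (?d + 1) (ev g zs)"
      using teval_add[OF ok zs(2) refl f' gd] teval_End_diff_cycles[OF g zs] ff' by (simp add: add.assoc)
    moreover have "\<delta> (?d + 1) (ev g zs) \<in> carrier (V ?d)" "ev f' zs \<in> carrier (V ?d)"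
      using delta_closed[OF gc] teval_closed[OF f' ok zs(2) refl] by simp_all
    ultimately have "P ?d (ev f zs) = P ?d (ev f' zs)"
      using P_delta[OF gc, of ?d] by (simp add: lin_hom_add[OF P_hom] P_closed)
    then show ?thesis using F(2)[OF P_word[OF ok]] zs(2) S_P_word[OF ok] e[OF ok zs(2)] by simp
  qed
  then have "induces n i f F" using f F(1) cocycle_on_cycles[OF f c _ _ refl] by (simp add: induces_def)
  then show ?thesis by (rule that)
qed

text \<open>
  The lift is \<open>S F(P x\<^sub>1, \<dots>, P x\<^sub>n)\<close>; it is a cocycle because \<open>\<delta> S = 0\<close> and \<open>P \<delta> = 0\<close>.
\<close>

lemma induces_lift:
  assumes F: "F \<in> carrier (H.E n i)"
  obtains f where "induces n i f F" "End_diff R V \<delta> n i f = \<zero>\<^bsub>E n (i - 1)\<^esub>"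
proof -
  have "multilinear R V n V (i + 0) (\<lambda>xs. S (wdeg xs + i) (H.ev F (map_letters P xs)))"
    by (rule multilinear_map_letters[OF H.graded_mod_axioms graded_mod_axioms H.End_multilinear[OF F] P_hom])
      (simp add: S_hom)
  then obtain f where f: "f \<in> carrier (E n i)"
    and e: "\<And>xs. word_ok V xs \<Longrightarrow> length xs = n \<Longrightarrow> ev f xs = S (wdeg xs + i) (H.ev F (map_letters P xs))"
    using End_cochainE[of n "i + 0"] by auto
  have Fc: "H.ev F (map_letters P xs) \<in> carrier (H (wdeg xs + i))" if "word_ok V xs" "length xs = n" for xs
    by (rule H.teval_closed[OF F P_word[OF that(1)]]) (simp_all add: that)
  have "End_diff R V \<delta> n i f = \<zero>\<^bsub>E n (i - 1)\<^esub>"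
  proof (rule End_ext[OF End_diff_closed[OF f] E.M.zero_closed])
    fix xs assume xs: "word_ok V xs" "length xs = n"
    have "ev (End_diff R V \<delta> n i f) xs = \<delta> (wdeg xs + i) (ev f xs)"
    proof (rule teval_End_diff_zero_slots[OF f xs refl])
      fix k assume k: "k < n"
      then obtain us p x vs where w: "xs = us @ (p, x) # vs" "length us = k" using word_split xs(2) by metis
      have ok: "word_ok V us" "word_ok V vs" "x \<in> carrier (V p)" "length us + 1 + length vs = n"
        using xs unfolding w(1) by auto
      have y: "word_ok V (upd k (-1) \<delta> xs)" "length (upd k (-1) \<delta> xs) = n" "wdeg (upd k (-1) \<delta> xs) = wdeg xs - 1"
        using upd_ok[OF xs(1) delta_hom'] k xs(2) by simp_all
      have "H.ev F (map_letters P us @ (p - 1, \<zero>\<^bsub>H (p - 1)\<^esub>) # map_letters P vs) = \<zero>\<^bsub>H (wdeg xs + i - 1)\<^esub>"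
        by (rule H.teval_zero_slot[OF F]) (use ok P_word w in auto)
      moreover have "map_letters P (upd k (-1) \<delta> xs) = map_letters P us @ (p - 1, \<zero>\<^bsub>H (p - 1)\<^esub>) # map_letters P vs"
        unfolding w(1) upd_append[OF w(2)] using P_delta[OF ok(3)] by simp
      ultimately show "ev f (upd k (-1) \<delta> xs) = \<zero>\<^bsub>V (wdeg xs + i - 1)\<^esub>"
        unfolding e[OF y(1,2)] y(3) using S_zero[of "wdeg xs + i - 1"] by (simp add: algebra_simps)
    qed
    also have "\<dots> = \<zero>\<^bsub>V (wdeg xs + i - 1)\<^esub>" unfolding e[OF xs] by (rule delta_S[OF Fc[OF xs]])
    also have "\<dots> = ev \<zero>\<^bsub>E n (i - 1)\<^esub> xs"
      by (rule teval_zero[OF xs, symmetric]) simp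
    finally show "ev (End_diff R V \<delta> n i f) xs = ev \<zero>\<^bsub>E n (i - 1)\<^esub> xs" .
  qed
  moreover have "induces n i f F"
    unfolding induces_def
    using f F e cycles_word Fc by (auto simp: cycles_iff S_closed delta_S P_S)
  ultimately show ?thesis using that by blast
qed

text \<open>
  Up to a coboundary \<open>f\<close> is \<open>f(\<pi> x\<^sub>1, \<dots>, \<pi> x\<^sub>n)\<close>, whose values are boundaries because \<open>f\<close> induces zero.
  On boundaries \<open>\<delta> h\<close> is the identity, so \<open>h f(\<pi> x\<^sub>1, \<dots>, \<pi> x\<^sub>n)\<close> is a primitive of this cocycle.
\<close>

lemma induces_zero_boundary:
  assumes f0: "induces n i f \<zero>\<^bsub>H.E n i\<^esub>" and c: "End_diff R V \<delta> n i f = \<zero>\<^bsub>E n (i - 1)\<^esub>" and n: "1 \<le> n"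
  obtains g where "g \<in> carrier (E n (i + 1))" "f = End_diff R V \<delta> n (i + 1) g"
proof -
  note f = inducesD(1)[OF f0]
  obtain f' g1 where f': "f' \<in> carrier (E n i)" and g1: "g1 \<in> carrier (E n (i + 1))"
    and ff': "f = f' \<oplus>\<^bsub>E n i\<^esub> End_diff R V \<delta> n (i + 1) g1"
    and e: "\<And>xs. word_ok V xs \<Longrightarrow> length xs = n \<Longrightarrow> ev f' xs = ev f (map_letters pi xs)"
    using cocycle_homotopy[OF f c n] by blast
  have "multilinear R V n V (i + 1) (\<lambda>xs. h (wdeg xs + i) (ev f (map_letters pi xs)))"
    by (rule multilinear_map_letters[OF graded_mod_axioms graded_mod_axioms End_multilinear[OF f] pi_hom h_hom])
  then obtain g2 where g2: "g2 \<in> carrier (E n (i + 1))"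
    and e2: "\<And>xs. word_ok V xs \<Longrightarrow> length xs = n \<Longrightarrow> ev g2 xs = h (wdeg xs + i) (ev f (map_letters pi xs))"
    by (rule End_cochainE) blast
  have dg2: "End_diff R V \<delta> n (i + 1) g2 \<in> carrier (E n i)" using End_diff_closed[OF g2] by simp
  have pi_Z: "word_ok Z (map_letters pi xs)" if "word_ok V xs" for xs
    using S_word[OF P_word[OF that]] S_P_word[OF that] by simp
  have "f' = End_diff R V \<delta> n (i + 1) g2"
  proof (rule End_ext[OF f' dg2])
    fix xs assume xs: "word_ok V xs" "length xs = n"
    let ?d = "wdeg xs + i" and ?w = "ev f (map_letters pi xs)"
    have w: "?w \<in> carrier (Z ?d)" by (rule inducesD(3)[OF f0 pi_Z[OF xs(1)]]) (simp_all add: xs)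
    have Pw: "P ?d ?w = \<zero>\<^bsub>H ?d\<^esub>"
    proof -
      have "P ?d ?w = H.ev \<zero>\<^bsub>H.E n i\<^esub> (map_letters P (map_letters pi xs))"
        by (rule inducesD(4)[OF f0 pi_Z[OF xs(1)], symmetric]) (simp_all add: xs)
      also have "\<dots> = \<zero>\<^bsub>H ?d\<^esub>"
        by (rule H.teval_zero[OF P_word[OF cycles_word[OF pi_Z[OF xs(1)]]]]) (simp_all add: xs)
      finally show ?thesis .
    qed
    have wV: "?w \<in> carrier (V ?d)" "\<delta> ?d ?w = \<zero>\<^bsub>V (?d - 1)\<^esub>" using w by (auto simp: cycles_iff)
    have h0: "h (?d - 1) \<zero>\<^bsub>V (?d - 1)\<^esub> = \<zero>\<^bsub>V ?d\<^esub>"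
      using lin_hom_zero[OF h_hom V_module V_module, of "?d - 1"] by simp
    have hw: "\<delta> (?d + 1) (h ?d ?w) \<in> carrier (V ?d)" using delta_closed[OF h_closed[OF wV(1)]] by simp
    have "\<delta> (?d + 1) (h ?d ?w) = ?w"
      using homotopy[OF wV(1)] wV hw by (simp add: h0 Pw S_zero a_minus_def)
    moreover have "ev (End_diff R V \<delta> n (i + 1) g2) xs = \<delta> (wdeg xs + (i + 1)) (ev g2 xs)"
    proof (rule teval_End_diff_zero_slots[OF g2 xs refl])
      fix k assume k: "k < n"
      then obtain us p x vs where u: "xs = us @ (p, x) # vs" "length us = k" using word_split xs(2) by metis
      have ok: "word_ok V us" "word_ok V vs" "x \<in> carrier (V p)" "length us + 1 + length vs = n"
        using xs unfolding u(1) by auto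
      have y: "word_ok V (upd k (-1) \<delta> xs)" "length (upd k (-1) \<delta> xs) = n" "wdeg (upd k (-1) \<delta> xs) + i = ?d - 1"
        using upd_ok[OF xs(1) delta_hom'] k xs(2) by simp_all
      have "ev f (map_letters pi us @ (p - 1, \<zero>\<^bsub>V (p - 1)\<^esub>) # map_letters pi vs) = \<zero>\<^bsub>V (?d - 1)\<^esub>"
        by (rule teval_zero_slot[OF f]) (use ok cycles_word[OF pi_Z] u in auto)
      moreover have "map_letters pi (upd k (-1) \<delta> xs) = map_letters pi us @ (p - 1, \<zero>\<^bsub>V (p - 1)\<^esub>) # map_letters pi vs"
        unfolding u(1) upd_append[OF u(2)] using pi_delta[OF ok(3) refl] by simp
      ultimately show "ev g2 (upd k (-1) \<delta> xs) = \<zero>\<^bsub>V (wdeg xs + (i + 1) - 1)\<^esub>"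
        unfolding e2[OF y(1,2)] y(3) using h0 by simp
    qed
    ultimately show "ev f' xs = ev (End_diff R V \<delta> n (i + 1) g2) xs"
      using e[OF xs] e2[OF xs] by (simp add: add.assoc)
  qed
  then have "f = End_diff R V \<delta> n (i + 1) (g2 \<oplus>\<^bsub>E n (i + 1)\<^esub> g1)"
    using ff' End_diff_add[OF n g2 g1] by simp
  then show ?thesis using that g1 g2 by blast
qed

lemma induces_zero: "induces n i \<zero>\<^bsub>E n i\<^esub> \<zero>\<^bsub>H.E n i\<^esub>"
  unfolding induces_def
proof (intro conjI allI impI)
  fix zs assume zs: "word_ok Z zs \<and> length zs = n"
  then have ok: "word_ok V zs" "length zs = n" "word_ok H (map_letters P zs)" "length (map_letters P zs) = n"
    using cycles_word P_word by auto
  show "ev \<zero>\<^bsub>E n i\<^esub> zs \<in> carrier (Z (wdeg zs + i))"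
    by (simp add: teval_zero[OF ok(1,2) refl] cycles_iff delta_zero)
  show "H.ev \<zero>\<^bsub>H.E n i\<^esub> (map_letters P zs) = P (wdeg zs + i) (ev \<zero>\<^bsub>E n i\<^esub> zs)"
    by (simp add: teval_zero[OF ok(1,2) refl] H.teval_zero[OF ok(3,4) refl] P_zero)
qed auto

lemma induces_minus:
  assumes f: "induces n i f F" and g: "induces n i g G"
  shows "induces n i (f \<ominus>\<^bsub>E n i\<^esub> g) (F \<ominus>\<^bsub>H.E n i\<^esub> G)"
  unfolding induces_def
proof (intro conjI allI impI)
  show "f \<ominus>\<^bsub>E n i\<^esub> g \<in> carrier (E n i)" "F \<ominus>\<^bsub>H.E n i\<^esub> G \<in> carrier (H.E n i)"
    using inducesD[OF f] inducesD[OF g] by (auto intro: E.M.minus_closed H.E.M.minus_closed)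
  fix zs assume zs: "word_ok Z zs \<and> length zs = n"
  then have ok: "word_ok V zs" "length zs = n" "word_ok H (map_letters P zs)" "length (map_letters P zs) = n"
    using cycles_word P_word by auto
  let ?d = "wdeg zs + i"
  have a: "ev f zs \<in> carrier (Z ?d)" and b: "ev g zs \<in> carrier (Z ?d)"
    using inducesD(3)[OF f _ _ refl] inducesD(3)[OF g _ _ refl] zs by auto
  have aV: "ev f zs \<in> carrier (V ?d)" and bV: "ev g zs \<in> carrier (V ?d)"
    using a b by (auto simp: cycles_iff)
  note e = teval_minus[OF ok(1,2) refl inducesD(1)[OF f] inducesD(1)[OF g]]
  note e' = H.teval_minus[OF ok(3,4) refl inducesD(2)[OF f] inducesD(2)[OF g], simplified]
  show "ev (f \<ominus>\<^bsub>E n i\<^esub> g) zs \<in> carrier (Z ?d)"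
    unfolding e using a b lin_hom_minus[OF delta_hom V_module V_module aV bV]
    by (simp add: cycles_iff V.M.minus_closed V.minus_eq_zero_iff)
  show "H.ev (F \<ominus>\<^bsub>H.E n i\<^esub> G) (map_letters P zs) = P ?d (ev (f \<ominus>\<^bsub>E n i\<^esub> g) zs)"
    unfolding e e' lin_hom_minus[OF P_hom V_module H.V_module aV bV]
    using inducesD(4)[OF f _ _ refl] inducesD(4)[OF g _ _ refl] zs by simp
qed

lemma induces_uminus:
  assumes f: "induces n i f F"
  shows "induces n i (\<ominus>\<^bsub>E n i\<^esub> f) (\<ominus>\<^bsub>H.E n i\<^esub> F)"
  using induces_minus[OF induces_zero f] inducesD[OF f] by (simp add: a_minus_def)

lemma induces_add:
  assumes f: "induces n i f F" and g: "induces n i g G"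
  shows "induces n i (f \<oplus>\<^bsub>E n i\<^esub> g) (F \<oplus>\<^bsub>H.E n i\<^esub> G)"
  using induces_minus[OF f induces_uminus[OF g]] inducesD[OF f] inducesD[OF g] by (simp add: a_minus_def)

lemma induces_ksign:
  "induces n i f F \<Longrightarrow> induces n i (ksign (E n i) k f) (ksign (H.E n i) k F)"
  by (auto simp: ksign_def induces_uminus)

lemma induces_boundary:
  assumes f: "f \<in> carrier (E n i)"
    and b: "\<And>zs. word_ok Z zs \<Longrightarrow> length zs = n \<Longrightarrow>
       \<exists>x\<in>carrier (V (wdeg zs + i + 1)). ev f zs = \<delta> (wdeg zs + i + 1) x"
  shows "induces n i f \<zero>\<^bsub>H.E n i\<^esub>"
  unfolding induces_def
proof (intro conjI allI impI)
  fix zs assume zs: "word_ok Z zs \<and> length zs = n"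
  let ?d = "wdeg zs + i"
  obtain x where x: "x \<in> carrier (V (?d + 1))" "ev f zs = \<delta> (?d + 1) x" using b zs by blast
  show "ev f zs \<in> carrier (Z ?d)"
    using x(1) boundaries_cycles[of ?d] unfolding x(2) by (auto simp: boundaries_def)
  have "H.ev \<zero>\<^bsub>H.E n i\<^esub> (map_letters P zs) = \<zero>\<^bsub>H ?d\<^esub>"
    by (rule H.teval_zero) (use zs P_word cycles_word in auto)
  then show "H.ev \<zero>\<^bsub>H.E n i\<^esub> (map_letters P zs) = P ?d (ev f zs)"
    using P_delta[OF x(1), of ?d] x(2) by simp
qed (use f in auto)

lemma induces_End_diff:
  assumes g: "g \<in> carrier (E n (i + 1))"
  shows "induces n i (End_diff R V \<delta> n (i + 1) g) \<zero>\<^bsub>H.E n i\<^esub>"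
proof (rule induces_boundary)
  show "End_diff R V \<delta> n (i + 1) g \<in> carrier (E n i)" using End_diff_closed[OF g] by simp
  fix zs assume zs: "word_ok Z zs" "length zs = n"
  show "\<exists>x\<in>carrier (V (wdeg zs + i + 1)). ev (End_diff R V \<delta> n (i + 1) g) zs = \<delta> (wdeg zs + i + 1) x"
    using teval_End_diff_cycles[OF g zs] teval_closed[OF g cycles_word[OF zs(1)] zs(2) refl] by (auto simp: add.assoc)
qed

lemma map_letters_append_conv:
  "map_letters \<alpha> zs = a @ b \<Longrightarrow> \<exists>us ws. zs = us @ ws \<and> map_letters \<alpha> us = a \<and> map_letters \<alpha> ws = b"
  by (simp add: map_letters_def map_eq_append_conv) blast

lemma splits_map_letters:
  "inj_on (\<lambda>(us, ys, vs). (map_letters P us, map_letters P ys, map_letters P vs)) (splits m zs)"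
  "(\<lambda>(us, ys, vs). (map_letters P us, map_letters P ys, map_letters P vs)) ` splits m zs = splits m (map_letters P zs)"
proof -
  show "inj_on (\<lambda>(us, ys, vs). (map_letters P us, map_letters P ys, map_letters P vs)) (splits m zs)"
  proof (rule inj_onI)
    fix s t assume s: "s \<in> splits m zs" and t: "t \<in> splits m zs" and
      e: "(\<lambda>(us, ys, vs). (map_letters P us, map_letters P ys, map_letters P vs)) s
        = (\<lambda>(us, ys, vs). (map_letters P us, map_letters P ys, map_letters P vs)) t"
    obtain us ys vs us' ys' vs' where st: "s = (us, ys, vs)" "t = (us', ys', vs')" by (cases s, cases t) auto
    have "map_letters P us = map_letters P us'" using e by (simp add: st)
    then have "length us = length us'" by (metis map_letters_simps(5))
    moreover have "us @ ys @ vs = us' @ ys' @ vs'" "length ys = length ys'" using s t by (auto simp: st splits_def)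
    ultimately show "s = t" by (simp add: st)
  qed
  show "(\<lambda>(us, ys, vs). (map_letters P us, map_letters P ys, map_letters P vs)) ` splits m zs = splits m (map_letters P zs)"
  proof (intro Set.set_eqI iffI)
    fix t assume "t \<in> splits m (map_letters P zs)"
    then obtain a b c where t: "t = (a, b, c)" "map_letters P zs = a @ b @ c" "length b = m" by (auto simp: splits_def)
    then obtain us w where w: "zs = us @ w" "map_letters P us = a" "map_letters P w = b @ c"
      using map_letters_append_conv by blast
    then obtain ys vs where "w = ys @ vs" "map_letters P ys = b" "map_letters P vs = c"
      using map_letters_append_conv by blast
    with w(1,2)
    show "t \<in> (\<lambda>(us, ys, vs). (map_letters P us, map_letters P ys, map_letters P vs)) ` splits m zs"
      using t(1,3) by (intro image_eqI[of _ _ "(us, ys, vs)"]) (auto simp: splits_def)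
  qed (auto simp: splits_def)
qed

lemma induces_circ:
  assumes f: "induces n i f F" and g: "induces m j g G" and n: "1 \<le> n"
  shows "induces (n + m - 1) (i + j) (circ R V n i m j f g) (circ R H n i m j F G)"
  unfolding induces_def
proof (intro conjI allI impI)
  note fg = inducesD(1)[OF f] inducesD(1)[OF g] and FG = inducesD(2)[OF f] inducesD(2)[OF g]
  show "circ R V n i m j f g \<in> carrier (E (n + m - 1) (i + j))" by (rule circ_closed[OF fg])
  show "circ R H n i m j F G \<in> carrier (H.E (n + m - 1) (i + j))" by (rule H.circ_closed[OF FG])
  fix zs assume zs': "word_ok Z zs \<and> length zs = n + m - 1"
  then have zs: "word_ok V zs" "length zs = n + m - 1" "word_ok H (map_letters P zs)" "length (map_letters P zs) = n + m - 1"
    using cycles_word P_word by auto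
  define d where "d = wdeg zs + (i + j)"
  let ?t = "\<lambda>(us, ys, vs). ksign (V d) (circ_sign j us ys vs) (ev f (us @ (wdeg ys + j, ev g ys) # vs))"
  let ?T = "\<lambda>(us, ys, vs). ksign (H d) (circ_sign j us ys vs) (H.ev F (us @ (wdeg ys + j, H.ev G ys) # vs))"
  have w: "ev f (us @ (wdeg ys + j, ev g ys) # vs) \<in> carrier (Z d)"
    "H.ev F (map_letters P us @ (wdeg ys + j, H.ev G (map_letters P ys)) # map_letters P vs)
     = P d (ev f (us @ (wdeg ys + j, ev g ys) # vs))"
    if "(us, ys, vs) \<in> splits m zs" for us ys vs
  proof -
    have s: "us @ ys @ vs = zs" "length ys = m" using that by (auto simp: splits_def)
    then have ok: "word_ok Z us" "word_ok Z ys" "word_ok Z vs" "length us + 1 + length vs = n"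
      using zs' n by auto
    note gy = inducesD(3)[OF g ok(2) s(2) refl] inducesD(4)[OF g ok(2) s(2) refl]
    let ?u = "us @ (wdeg ys + j, ev g ys) # vs"
    have u: "word_ok Z ?u" "length ?u = n" "d = wdeg ?u + i" using ok gy(1) s by (auto simp: d_def)
    show "ev f ?u \<in> carrier (Z d)" by (rule inducesD(3)[OF f u])
    show "H.ev F (map_letters P us @ (wdeg ys + j, H.ev G (map_letters P ys)) # map_letters P vs)
      = P d (ev f ?u)"
      using inducesD(4)[OF f u] by (simp add: gy(2))
  qed
  have wV: "ev f (us @ (wdeg ys + j, ev g ys) # vs) \<in> carrier (V d)"
    if "(us, ys, vs) \<in> splits m zs" for us ys vs using w(1)[OF that] by (simp add: cycles_iff)
  have tc: "?t t \<in> carrier (V d)" if "t \<in> splits m zs" for t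
    using that wV by (cases t) auto
  have e: "ev (circ R V n i m j f g) zs = finsum (V d) ?t (splits m zs)"
    by (rule teval_circ[OF fg zs(1,2) n d_def])
  have "\<delta> d (finsum (V d) ?t (splits m zs)) = (\<Oplus>\<^bsub>V (d - 1)\<^esub>t\<in>splits m zs. \<delta> d (?t t))"
    by (rule lin_hom_finsum[OF delta_hom V_module V_module tc])
  also have "\<dots> = \<zero>\<^bsub>V (d - 1)\<^esub>"
  proof (rule V.finsum_zeroI)
    fix t assume t: "t \<in> splits m zs"
    obtain us ys vs where t': "t = (us, ys, vs)" by (cases t) auto
    show "\<delta> d (?t t) = \<zero>\<^bsub>V (d - 1)\<^esub>"
      using w(1)[OF t[unfolded t']] lin_hom_ksign[OF delta_hom V_module V_module wV[OF t[unfolded t']]]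
      by (simp add: t' cycles_iff)
  qed
  moreover have "finsum (V d) ?t (splits m zs) \<in> carrier (V d)"
    by (rule V.M.finsum_closed) (use tc in blast)
  ultimately show "ev (circ R V n i m j f g) zs \<in> carrier (Z (wdeg zs + (i + j)))"
    unfolding e d_def[symmetric] by (simp add: cycles_iff)
  have "H.ev (circ R H n i m j F G) (map_letters P zs) = finsum (H d) ?T (splits m (map_letters P zs))"
    by (rule H.teval_circ[OF FG zs(3,4) n]) (simp add: d_def)
  also have "\<dots> = (\<Oplus>\<^bsub>H d\<^esub>t\<in>splits m zs. P d (?t t))"
  proof (rule H.V.finsum_bij[OF splits_map_letters])
    fix t assume t: "t \<in> splits m zs"
    obtain us ys vs where t': "t = (us, ys, vs)" by (cases t) auto
    show "?T ((\<lambda>(us, ys, vs). (map_letters P us, map_letters P ys, map_letters P vs)) t) = P d (?t t)"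
      using w(2)[OF t[unfolded t']] lin_hom_ksign[OF P_hom V_module H.V_module wV[OF t[unfolded t']]]
      by (simp add: t' circ_sign_def)
    show "P d (?t t) \<in> carrier (H d)" by (rule P_closed[OF tc[OF t]])
  qed
  also have "\<dots> = P d (finsum (V d) ?t (splits m zs))"
    by (rule lin_hom_finsum[OF P_hom V_module H.V_module tc, symmetric])
  finally show "H.ev (circ R H n i m j F G) (map_letters P zs) = P (wdeg zs + (i + j)) (ev (circ R V n i m j f g) zs)"
    unfolding e d_def[symmetric] .
qed

lemma induces_bracket:
  assumes f: "induces n i f F" and g: "induces m j g G" and n: "1 \<le> n" and m: "1 \<le> m"
  shows "induces (n + m - 1) (i + j) (bracket R V n i m j f g) (bracket R H n i m j F G)"
proof -
  have "m + n - 1 = n + m - 1" "j + i = i + j" by simp_all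
  then have "induces (n + m - 1) (i + j) (circ R V m j n i g f) (circ R H m j n i G F)"
    using induces_circ[OF g f m] by metis
  from induces_minus[OF induces_circ[OF f g n] induces_ksign[OF this]]
  show ?thesis unfolding bracket_def Let_def .
qed

end

section \<open>Hochschild cohomology and the obstruction\<close>

context graded_mod begin

lemma HH_diff_hom:
  assumes mu: "\<mu> \<in> carrier (E 2 0)" and n: "1 \<le> n"
  shows "(\<lambda>f\<in>carrier (E n i). HH_diff R V \<mu> n i f) \<in> lin_hom R (E n i) (E (n + 1) i)"
proof -
  let ?E = "E n i" and ?E' = "E (n + 1) i"
  let ?k = "weight 2 0 * weight n i"
  have l: "(\<lambda>f\<in>carrier ?E. circ R V n i 2 0 f \<mu>) \<in> lin_hom R ?E ?E'"
    using circ_lin_left[OF mu n, of i] by simp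
  have r: "(\<lambda>f\<in>carrier ?E. circ R V 2 0 n i \<mu> f) \<in> lin_hom R ?E ?E'"
    using circ_lin_right[OF mu, of n i] by simp
  have "(\<lambda>f\<in>carrier ?E. HH_diff R V \<mu> n i f) = (\<lambda>f\<in>carrier ?E.
      (\<lambda>f\<in>carrier ?E. circ R V 2 0 n i \<mu> f) f \<ominus>\<^bsub>?E'\<^esub>
      (\<lambda>f\<in>carrier ?E. ksign ?E' ?k ((\<lambda>f\<in>carrier ?E. circ R V n i 2 0 f \<mu>) f)) f)"
    by (rule restrict_ext) (simp add: HH_diff_def bracket_def Let_def)
  then show ?thesis
    using lin_hom_minusI[OF r lin_hom_ksignI[OF l End_module End_module] End_module End_module] by simp
qed

lemma HH_class_closed:
  "F \<in> carrier (HH_cocycles R V \<mu> n i) \<Longrightarrow> HH_class R V \<mu> n i F \<in> carrier (HH R V \<mu> n i)"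
  by (auto simp: HH_def HH_class_def quot_module_def A_RCOSETS_def')

text \<open>
  The coboundaries are the image of a linear map, hence closed under addition and subtraction; so the
  coset of \<open>F\<close> is the coset of zero iff \<open>F\<close> is a coboundary.
\<close>

lemma HH_class_zero_iff:
  assumes mu: "\<mu> \<in> carrier (E 2 0)" and n: "1 \<le> n" and F: "F \<in> carrier (E (n + 1) i)"
  shows "HH_class R V \<mu> (n + 1) i F = \<zero>\<^bsub>HH R V \<mu> (n + 1) i\<^esub> \<longleftrightarrow>
    (\<exists>e\<in>carrier (E n i). F = HH_diff R V \<mu> n i e)"
proof -
  let ?E = "E n i" and ?E' = "E (n + 1) i"
  let ?N = "HH_diff R V \<mu> n i ` carrier ?E"
  note D = HH_diff_hom[OF mu n, of i]
  have N: "HH_coboundaries R V \<mu> (n + 1) i = ?N" by (simp add: HH_coboundaries_def)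
  have coset: "HH_class R V \<mu> (n + 1) i F = (\<Union>x\<in>?N. {x \<oplus>\<^bsub>?E'\<^esub> F})"
    unfolding HH_class_def N a_r_coset_def' by (simp add: HH_cocycles_def)
  have z: "\<zero>\<^bsub>HH R V \<mu> (n + 1) i\<^esub> = ?N" by (simp add: HH_def quot_module_def N[simplified])
  have Dc: "HH_diff R V \<mu> n i e \<in> carrier ?E'" if "e \<in> carrier ?E" for e
    using lin_hom_closed[OF D that] that by simp
  have D0: "HH_diff R V \<mu> n i \<zero>\<^bsub>?E\<^esub> = \<zero>\<^bsub>?E'\<^esub>" using lin_hom_zero[OF D End_module End_module] by simp
  show ?thesis
  proof
    assume "HH_class R V \<mu> (n + 1) i F = \<zero>\<^bsub>HH R V \<mu> (n + 1) i\<^esub>"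
    then have "(\<Union>x\<in>?N. {x \<oplus>\<^bsub>?E'\<^esub> F}) = ?N" using coset z by simp
    moreover have "\<zero>\<^bsub>?E'\<^esub> \<in> ?N" by (rule image_eqI[of _ _ "\<zero>\<^bsub>?E\<^esub>"]) (simp_all add: D0)
    ultimately have "\<zero>\<^bsub>?E'\<^esub> \<oplus>\<^bsub>?E'\<^esub> F \<in> ?N" by blast
    then show "\<exists>e\<in>carrier ?E. F = HH_diff R V \<mu> n i e" using F by auto
  next
    assume "\<exists>e\<in>carrier ?E. F = HH_diff R V \<mu> n i e"
    then obtain e where e: "e \<in> carrier ?E" "F = HH_diff R V \<mu> n i e" by blast
    have "(\<Union>x\<in>?N. {x \<oplus>\<^bsub>?E'\<^esub> F}) = ?N"
    proof (intro equalityI subsetI)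
      fix y assume "y \<in> (\<Union>x\<in>?N. {x \<oplus>\<^bsub>?E'\<^esub> F})"
      then obtain f where f: "f \<in> carrier ?E" "y = HH_diff R V \<mu> n i f \<oplus>\<^bsub>?E'\<^esub> F" by blast
      have "y = HH_diff R V \<mu> n i (f \<oplus>\<^bsub>?E\<^esub> e)"
        using lin_hom_add[OF D f(1) e(1)] f e by simp
      then show "y \<in> ?N" using f e by blast
    next
      fix y assume "y \<in> ?N"
      then obtain f where f: "f \<in> carrier ?E" "y = HH_diff R V \<mu> n i f" by blast
      have fe: "f \<ominus>\<^bsub>?E\<^esub> e \<in> carrier ?E" using f e by (intro E.M.minus_closed)
      have "HH_diff R V \<mu> n i (f \<ominus>\<^bsub>?E\<^esub> e) = y \<ominus>\<^bsub>?E'\<^esub> F"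
        using lin_hom_minus[OF D End_module End_module f(1) e(1)] f e fe by simp
      then have "y = HH_diff R V \<mu> n i (f \<ominus>\<^bsub>?E\<^esub> e) \<oplus>\<^bsub>?E'\<^esub> F"
        using Dc[OF f(1)] F f(2) by (simp add: a_minus_def E.M.a_assoc E.M.l_neg)
      then show "y \<in> (\<Union>x\<in>?N. {x \<oplus>\<^bsub>?E'\<^esub> F})" using fe by blast
    qed
    then show "HH_class R V \<mu> (n + 1) i F = \<zero>\<^bsub>HH R V \<mu> (n + 1) i\<^esub>" using coset z by simp
  qed
qed

end

locale ainf_contraction = dg_contraction R V \<delta> P S h + trunc_ainf R V \<delta> m r
  for R :: "('r, 'z) ring_scheme" and V :: "int \<Rightarrow> ('r, 'v) module" and \<delta> P S h m r
begin

abbreviation "\<mu> \<equiv> induced R V \<delta> 2 0 (m 2)"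
abbreviation "ob \<equiv> induced R V \<delta> (r + 1) (int r - 2) obs"

text \<open>
  The relation in arity two says that \<open>m\<^sub>2\<close> is a cocycle.
\<close>

lemma m2_induces: "induces 2 0 (m 2) \<mu>"
proof -
  have "obstruction_cochain R V 1 m = \<zero>\<^bsub>E 2 (-1)\<^esub>"
    by (simp add: obstruction_cochain_def numeral_2_eq_2)
  then have "End_diff R V \<delta> 2 0 (m 2) = \<zero>\<^bsub>E 2 (0 - 1)\<^esub>"
    using square_Suc[of 1, unfolded one_add_one] square_zero[of 2] r End_diff_closed[OF m2_closed] by simp
  then obtain F where "induces 2 0 (m 2) F" using induces_exists[OF m2_closed] by auto
  then show ?thesis using induced_eq by simp
qed

lemma obs_induces: "induces (r + 1) (int r - 2) obs ob"
proof -
  obtain F where "induces (r + 1) (int r - 2) obs F"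
    using induces_exists[OF obstruction_closed, of r] obs_cocycle by auto
  then show ?thesis using induced_eq by simp
qed

text \<open>
  The relation in arity three exhibits \<open>m\<^sub>2 \<circ> m\<^sub>2\<close> as the negative of the differential of \<open>m\<^sub>3\<close>.
\<close>

lemma assoc: "graded_assoc_algebra R H \<mu>"
proof -
  have o: "obstruction_cochain R V 2 m = circ R V 2 0 2 0 (m 2) (m 2)"
    using circ_closed[OF m2_closed m2_closed] by (simp add: obstruction_cochain_def)
  have "square 3 = \<zero>\<^bsub>E 3 0\<^esub>" using square_zero[of 3] r by simp
  then have eq: "End_diff R V \<delta> 3 (0 + 1) (m 3) \<oplus>\<^bsub>E 3 0\<^esub> circ R V 2 0 2 0 (m 2) (m 2) = \<zero>\<^bsub>E 3 0\<^esub>"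
    using square_Suc[of 2] by (simp add: o)
  have d: "induces 3 0 (End_diff R V \<delta> 3 (0 + 1) (m 3)) \<zero>\<^bsub>H.E 3 0\<^esub>"
    by (rule induces_End_diff) (use m_closed[of 3] in simp)
  have c: "induces 3 0 (circ R V 2 0 2 0 (m 2) (m 2)) (circ R H 2 0 2 0 \<mu> \<mu>)"
    using induces_circ[OF m2_induces m2_induces] by simp
  have "\<zero>\<^bsub>H.E 3 0\<^esub> \<oplus>\<^bsub>H.E 3 0\<^esub> circ R H 2 0 2 0 \<mu> \<mu> = \<zero>\<^bsub>H.E 3 0\<^esub>"
    using induces_unique induces_add[OF d c] induces_zero unfolding eq by blast
  then show ?thesis
    using inducesD(2)[OF c] inducesD(2)[OF m2_induces] homology_graded by (simp add: graded_assoc_algebra_def)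
qed

text \<open>
  On cycles \<open>m\<^sub>1 \<circ> f\<close> takes boundaries as values and \<open>f \<circ> m\<^sub>1\<close> vanishes.
\<close>

lemma circ_delta_induces:
  assumes f: "f \<in> carrier (E n i)" and n: "1 \<le> n"
  shows "induces n (i - 1) (circ R V 1 (-1) n i (m 1) f) \<zero>\<^bsub>H.E n (i - 1)\<^esub>"
    and "induces n (i - 1) (circ R V n i 1 (-1) f (m 1)) \<zero>\<^bsub>H.E n (i - 1)\<^esub>"
proof -
  show "induces n (i - 1) (circ R V 1 (-1) n i (m 1) f) \<zero>\<^bsub>H.E n (i - 1)\<^esub>"
  proof (rule induces_boundary)
    show "circ R V 1 (-1) n i (m 1) f \<in> carrier (E n (i - 1))" using circ_closed[OF m1_closed f] by simp
    fix zs assume "word_ok Z zs" "length zs = n"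
    then show "\<exists>x\<in>carrier (V (wdeg zs + (i - 1) + 1)).
      ev (circ R V 1 (-1) n i (m 1) f) zs = \<delta> (wdeg zs + (i - 1) + 1) x"
      using teval_circ_delta_left[OF m1_closed m_delta f] teval_closed[OF f _ _ refl] cycles_word by auto
  qed
  show "induces n (i - 1) (circ R V n i 1 (-1) f (m 1)) \<zero>\<^bsub>H.E n (i - 1)\<^esub>"
  proof (rule induces_boundary)
    show "circ R V n i 1 (-1) f (m 1) \<in> carrier (E n (i - 1))" using circ_closed[OF f m1_closed] by simp
    fix zs assume zs: "word_ok Z zs" "length zs = n"
    let ?d = "wdeg zs + i - 1"
    have "ev f (upd k (-1) \<delta> zs) = \<zero>\<^bsub>V ?d\<^esub>" if "k < n" for k
      by (rule teval_upd_cycles[OF f zs that])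
    then have "ev (circ R V n i 1 (-1) f (m 1)) zs = \<zero>\<^bsub>V ?d\<^esub>"
      unfolding teval_circ_delta_right[OF m1_closed m_delta f n cycles_word[OF zs(1)] zs(2) refl]
      by (intro V.finsum_zeroI) simp
    also have "\<dots> = \<delta> (wdeg zs + (i - 1) + 1) \<zero>\<^bsub>V (wdeg zs + (i - 1) + 1)\<^esub>"
      unfolding delta_zero by (simp add: algebra_simps)
    finally show "\<exists>x\<in>carrier (V (wdeg zs + (i - 1) + 1)).
      ev (circ R V n i 1 (-1) f (m 1)) zs = \<delta> (wdeg zs + (i - 1) + 1) x" by blast
  qed
qed

lemma ob_cocycle: "ob \<in> carrier (HH_cocycles R H \<mu> (r + 1) (int r - 2))"
proof -
  let ?EV = "E (r + 2) (int r - 2)" and ?EH = "H.E (r + 2) (int r - 2)"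
  let ?l = "circ R H 2 0 (r + 1) (int r - 2) \<mu> ob" and ?r = "circ R H (r + 1) (int r - 2) 2 0 ob \<mu>"
  have sq: "square (r + 2) \<in> carrier (E (r + 2) (int r - 1))"
    using square_closed[of "r + 2"] by (simp add: algebra_simps)
  have l: "induces (r + 2) (int r - 2) (circ R V 2 0 (r + 1) (int r - 2) (m 2) obs) ?l"
    using induces_circ[OF m2_induces obs_induces] by (simp add: algebra_simps)
  have rr: "induces (r + 2) (int r - 2) (circ R V (r + 1) (int r - 2) 2 0 obs (m 2)) ?r"
    using induces_circ[OF obs_induces m2_induces] by (simp add: algebra_simps)
  have dl: "induces (r + 2) (int r - 2) (circ R V 1 (-1) (r + 2) (int r - 1) (m 1) (square (r + 2))) \<zero>\<^bsub>?EH\<^esub>"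
    using circ_delta_induces(1)[OF sq] by simp
  have dr: "induces (r + 2) (int r - 2) (circ R V (r + 2) (int r - 1) 1 (-1) (square (r + 2)) (m 1)) \<zero>\<^bsub>?EH\<^esub>"
    using circ_delta_induces(2)[OF sq] by simp
  have "\<zero>\<^bsub>?EH\<^esub> \<oplus>\<^bsub>?EH\<^esub> ?l = \<zero>\<^bsub>?EH\<^esub> \<oplus>\<^bsub>?EH\<^esub> ?r"
    using induces_add[OF dl l] induces_add[OF dr rr] unfolding obs_hochschild by (rule induces_unique)
  then have "?l = ?r" using inducesD(2)[OF l] inducesD(2)[OF rr] by simp
  moreover have "even (weight 2 0 * weight (r + 1) (int r - 2))" by (simp add: weight_def)
  ultimately have "HH_diff R H \<mu> (r + 1) (int r - 2) ob = \<zero>\<^bsub>?EH\<^esub>"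
    using inducesD(2)[OF l] by (simp add: HH_diff_def bracket_def Let_def H.E.minus_eq_zero_iff)
  then show ?thesis using inducesD(2)[OF obs_induces] by (simp add: HH_cocycles_def)
qed

lemma ob_class_closed: "obstruction_class R V \<delta> r m \<in> carrier (HH R H \<mu> (r + 1) (int r - 2))"
  unfolding obstruction_class_def by (rule H.HH_class_closed[OF ob_cocycle])

lemma ob_class_zero_iff:
  "obstruction_class R V \<delta> r m = \<zero>\<^bsub>HH R H \<mu> (r + 1) (int r - 2)\<^esub> \<longleftrightarrow>
    (\<exists>e\<in>carrier (H.E r (int r - 2)). ob = HH_diff R H \<mu> r (int r - 2) e)"
  unfolding obstruction_class_def
  by (rule H.HH_class_zero_iff) (use r inducesD(2)[OF m2_induces] inducesD(2)[OF obs_induces] in auto)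

text \<open>
  The operation \<open>m\<^sub>r\<close> enters the relations in arities up to \<open>r\<close> only through its differential in
  arity \<open>r\<close>, so it may be changed by a cocycle.
\<close>

lemma update_ainf:
  assumes d: "d \<in> carrier (E r (int r - 2))" and c: "End_diff R V \<delta> r (int r - 2) d = \<zero>\<^bsub>E r (int r - 3)\<^esub>"
  shows "trunc_ainf R V \<delta> (m(r := m r \<ominus>\<^bsub>E r (int r - 2)\<^esub> d)) r"
proof -
  let ?m = "m(r := m r \<ominus>\<^bsub>E r (int r - 2)\<^esub> d)"
  interpret o: operations R V \<delta> ?m by (rule update_operations[OF _ d]) (use r in simp)
  have "o.square n = \<zero>\<^bsub>E n (int n - 3)\<^esub>" if n: "n \<in> {1..r}" for n
  proof (cases "n = r")
    case False
    have "o.square n = square n"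
      by (rule family_circ_cong[OF m_closed m_closed]) (use n False in auto)
    then show ?thesis using square_zero n by simp
  next
    case True
    have ob: "obstruction_cochain R V (r - 1) ?m = obstruction_cochain R V (r - 1) m"
      by (rule obstruction_cong) auto
    have m_r: "m r \<in> carrier (E r (int r - 2))" by (rule m_closed)
    have "End_diff R V \<delta> r (int r - 2) (m r \<ominus>\<^bsub>E r (int r - 2)\<^esub> d) = End_diff R V \<delta> r (int r - 2) (m r)"
      using End_diff_minus[OF _ m_r d] r c End_diff_closed[OF m_r] by (simp add: a_minus_def)
    then have "o.square r = square r"
      using o.square_Suc[of "r - 1"] square_Suc[of "r - 1"] r ob by (simp add: of_nat_diff algebra_simps)
    then show ?thesis using square_zero[of r] True by simp
  qed
  then show ?thesis
    by (intro trunc_ainf.intro o.operations_axioms trunc_ainf_axioms.intro)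
      (use r m_zero in \<open>auto simp: o.dg_A_structure_iff\<close>)
qed

text \<open>
  If the class vanishes, the induced map is \<open>[\<mu>, e]\<close>; for a cocycle \<open>d\<close> that induces \<open>e\<close>, the structure
  with \<open>m\<^sub>r - d\<close> has an obstruction cochain that induces zero, hence equals \<open>\<partial>g\<close>, and \<open>-g\<close> serves as the
  operation of arity \<open>r + 1\<close>.  Conversely, if \<open>m'\<close> is a lift, then \<open>d = m\<^sub>r - m'\<^sub>r\<close> is a cocycle by the
  relation in arity \<open>r\<close>, and the relation in arity \<open>r + 1\<close> says that \<open>O - [m\<^sub>2, d]\<close> is a coboundary.
\<close>

theorem ob_class_zero_iff_lift:
  "obstruction_class R V \<delta> r m = \<zero>\<^bsub>HH R H \<mu> (r + 1) (int r - 2)\<^esub> \<longleftrightarrow>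
    (\<exists>m'. dg_A_structure R V \<delta> (r + 1) m' \<and> (\<forall>i\<in>{1..r - 1}. m' i = m i))"
proof
  assume "obstruction_class R V \<delta> r m = \<zero>\<^bsub>HH R H \<mu> (r + 1) (int r - 2)\<^esub>"
  then obtain e where e: "e \<in> carrier (H.E r (int r - 2))" "ob = HH_diff R H \<mu> r (int r - 2) e"
    using ob_class_zero_iff by blast
  obtain d where d: "induces r (int r - 2) d e" "End_diff R V \<delta> r (int r - 2) d = \<zero>\<^bsub>E r (int r - 2 - 1)\<^esub>"
    by (rule induces_lift[OF e(1)])
  note dc = inducesD(1)[OF d(1)]
  let ?m = "m(r := m r \<ominus>\<^bsub>E r (int r - 2)\<^esub> d)"
  interpret o: trunc_ainf R V \<delta> ?m r by (rule update_ainf[OF dc]) (use d(2) in simp)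
  have br: "induces (r + 1) (int r - 2) (bracket R V 2 0 r (int r - 2) (m 2) d) (HH_diff R H \<mu> r (int r - 2) e)"
    using induces_bracket[OF m2_induces d(1)] r by (simp add: HH_diff_def)
  have "induces (r + 1) (int r - 2) o.obs (ob \<ominus>\<^bsub>H.E (r + 1) (int r - 2)\<^esub> ob)"
    unfolding obstruction_update[OF r dc] using induces_minus[OF obs_induces br] e(2) by simp
  moreover have "ob \<ominus>\<^bsub>H.E (r + 1) (int r - 2)\<^esub> ob = \<zero>\<^bsub>H.E (r + 1) (int r - 2)\<^esub>"
    using inducesD(2)[OF obs_induces] by (simp add: H.E.minus_eq_zero_iff)
  ultimately obtain g where g: "g \<in> carrier (E (r + 1) (int r - 2 + 1))"
    "o.obs = End_diff R V \<delta> (r + 1) (int r - 2 + 1) g"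
    using induces_zero_boundary[of "r + 1" "int r - 2" o.obs] o.obs_cocycle by auto
  have g1: "g \<in> carrier (E (r + 1) (int r - 1))" "o.obs = End_diff R V \<delta> (r + 1) (int r - 1) g"
    using g by simp_all
  define m' where "m' = ?m(r + 1 := \<ominus>\<^bsub>E (r + 1) (int r - 1)\<^esub> g)"
  interpret o': operations R V \<delta> m'
    by (intro operations.intro dg_mod_axioms operations_axioms.intro)
      (use o.m_closed o.m_delta r g1 in \<open>auto simp: m'_def\<close>)
  have "o'.square n = \<zero>\<^bsub>E n (int n - 3)\<^esub>" if n: "n \<in> {1..r + 1}" for n
  proof (cases "n = r + 1")
    case False
    have "o'.square n = o.square n"
      by (rule family_circ_cong[OF o.m_closed o.m_closed]) (use n False in \<open>auto simp: m'_def\<close>)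
    then show ?thesis using o.square_zero n False by simp
  next
    case True
    have "obstruction_cochain R V r m' = o.obs" by (rule o.obstruction_cong) (auto simp: m'_def)
    moreover have "End_diff R V \<delta> (r + 1) (int r - 1) (\<ominus>\<^bsub>E (r + 1) (int r - 1)\<^esub> g)
       = \<ominus>\<^bsub>E (r + 1) (int r - 2)\<^esub> o.obs"
      using lin_hom_uminus[OF End_diff_hom End_module End_module g1(1)] g1 by simp
    moreover have "m' (r + 1) = \<ominus>\<^bsub>E (r + 1) (int r - 1)\<^esub> g" by (simp add: m'_def)
    ultimately show ?thesis
      using o'.square_Suc[of r] r True o.obstruction_closed[of r] by (simp add: E.M.l_neg)
  qed
  then have "dg_A_structure R V \<delta> (r + 1) m'" by (simp add: o'.dg_A_structure_iff)
  moreover have "\<forall>i\<in>{1..r - 1}. m' i = m i" using r by (auto simp: m'_def)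
  ultimately show "\<exists>m'. dg_A_structure R V \<delta> (r + 1) m' \<and> (\<forall>i\<in>{1..r - 1}. m' i = m i)" by blast
next
  assume "\<exists>m'. dg_A_structure R V \<delta> (r + 1) m' \<and> (\<forall>i\<in>{1..r - 1}. m' i = m i)"
  then obtain m0 where m0: "dg_A_structure R V \<delta> (r + 1) m0" "\<forall>i\<in>{1..r - 1}. m0 i = m i" by blast
  define m' where "m' = extend_zero R V (r + 1) m0"
  interpret o: operations R V \<delta> m' unfolding m'_def by (rule extend_zero_operations[OF m0(1)]) simp
  have m': "dg_A_structure R V \<delta> (r + 1) m'" unfolding m'_def by (rule extend_zero_operations[OF m0(1)]) simp
  have same: "m' i = m i" if "i \<in> {1..r - 1}" for i using m0(2) that by (auto simp: m'_def extend_zero_def)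
  have c: "m r \<in> carrier (E r (int r - 2))" "m' r \<in> carrier (E r (int r - 2))"
    using m_closed o.m_closed by auto
  let ?E = "E r (int r - 2)"
  define d where "d = m r \<ominus>\<^bsub>?E\<^esub> m' r"
  have d: "d \<in> carrier ?E" unfolding d_def using c by (intro E.M.minus_closed)
  let ?X = "obstruction_cochain R V (r - 1) m"
  have X: "?X \<in> carrier (E r (int r - 3))" using obstruction_closed[of "r - 1"] r by (simp add: of_nat_diff algebra_simps)
  have "obstruction_cochain R V (r - 1) m' = ?X" by (rule obstruction_cong) (use same in auto)
  then have "End_diff R V \<delta> r (int r - 2) (m' r) \<oplus>\<^bsub>E r (int r - 3)\<^esub> ?X = \<zero>\<^bsub>E r (int r - 3)\<^esub>"
    using o.square_Suc[of "r - 1"] m' r by (simp add: o.dg_A_structure_iff of_nat_diff algebra_simps)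
  moreover have "End_diff R V \<delta> r (int r - 2) (m r) \<oplus>\<^bsub>E r (int r - 3)\<^esub> ?X = \<zero>\<^bsub>E r (int r - 3)\<^esub>"
    using square_Suc[of "r - 1"] square_zero[of r] r by (simp add: of_nat_diff algebra_simps)
  moreover have Ec: "End_diff R V \<delta> r (int r - 2) (m r) \<in> carrier (E r (int r - 3))"
     "End_diff R V \<delta> r (int r - 2) (m' r) \<in> carrier (E r (int r - 3))"
    using End_diff_closed[OF c(1)] End_diff_closed[OF c(2)] by simp_all
  ultimately have "End_diff R V \<delta> r (int r - 2) (m r) = End_diff R V \<delta> r (int r - 2) (m' r)"
    using X E.M.add.right_cancel by metis
  then have dz: "End_diff R V \<delta> r (int r - 2) d = \<zero>\<^bsub>E r (int r - 3)\<^esub>"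
    unfolding d_def using End_diff_minus[OF _ c] r Ec by (simp add: E.minus_eq_zero_iff)
  obtain e where e: "induces r (int r - 2) d e"
    by (rule induces_exists[OF d]) (use dz r in auto)
  let ?E' = "E (r + 1) (int r - 2)" and ?F' = "H.E (r + 1) (int r - 2)"
  have "m r \<ominus>\<^bsub>?E\<^esub> d = m' r" unfolding d_def using c
    by (simp add: a_minus_def E.M.minus_add E.M.a_assoc[symmetric] E.M.r_neg)
  then have "obstruction_cochain R V r m' = obstruction_cochain R V r (m(r := m r \<ominus>\<^bsub>?E\<^esub> d))"
    by (intro operations.obstruction_cong[OF update_operations[OF _ d]]) (use same r in auto)
  then have ob': "obstruction_cochain R V r m' = obs \<ominus>\<^bsub>?E'\<^esub> bracket R V 2 0 r (int r - 2) (m 2) d"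
    using obstruction_update[OF r d] by simp
  have br: "induces (r + 1) (int r - 2) (bracket R V 2 0 r (int r - 2) (m 2) d) (HH_diff R H \<mu> r (int r - 2) e)"
    using induces_bracket[OF m2_induces e] r by (simp add: HH_diff_def)
  have m1: "m' (r + 1) \<in> carrier (E (r + 1) (int r - 2 + 1))" using o.m_closed[of "r + 1"] by simp
  have "End_diff R V \<delta> (r + 1) (int r - 2 + 1) (m' (r + 1)) \<oplus>\<^bsub>?E'\<^esub> obstruction_cochain R V r m' = \<zero>\<^bsub>?E'\<^esub>"
    using o.square_Suc[of r] m' r by (simp add: o.dg_A_structure_iff)
  then have "\<zero>\<^bsub>?F'\<^esub> \<oplus>\<^bsub>?F'\<^esub> (ob \<ominus>\<^bsub>?F'\<^esub> HH_diff R H \<mu> r (int r - 2) e) = \<zero>\<^bsub>?F'\<^esub>"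
    using induces_add[OF induces_End_diff[OF m1] induces_minus[OF obs_induces br]] induces_zero induces_unique
    unfolding ob' by metis
  then have "ob = HH_diff R H \<mu> r (int r - 2) e"
    using inducesD(2)[OF obs_induces] inducesD(2)[OF br] by (simp add: H.E.minus_eq_zero_iff H.E.M.minus_closed)
  then show "obstruction_class R V \<delta> r m = \<zero>\<^bsub>HH R H \<mu> (r + 1) (int r - 2)\<^esub>"
    unfolding ob_class_zero_iff using inducesD(2)[OF e] by blast
qed

end

theorem theorem3p8:
  fixes R :: "('r, 'z) ring_scheme"
    and A :: "int \<Rightarrow> ('r, 'a) module"
    and \<delta> :: "int \<Rightarrow> 'a \<Rightarrow> 'a"
    and m :: "nat \<Rightarrow> ('r, 'a) cochain"
    and r :: nat
  assumes "cring R"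
    and "r \<ge> 3"
    and "dgmodule R A \<delta>"
    and "graded_projective R (homology A \<delta>)"
    and "graded_projective R (cycles A \<delta>)"
    and "dg_A_structure R A \<delta> r m"
  shows "graded_assoc_algebra R (homology A \<delta>) (induced R A \<delta> 2 0 (m 2)) \<and>
    obstruction_cochain R A r m \<in> carrier (End_mod R A (r + 1) (int r - 2)) \<and>
    End_diff R A \<delta> (r + 1) (int r - 2) (obstruction_cochain R A r m) =
           \<zero>\<^bsub>End_mod R A (r + 1) (int r - 3)\<^esub> \<and>
    obstruction_class R A \<delta> r m
           \<in> carrier (HH R (homology A \<delta>) (induced R A \<delta> 2 0 (m 2)) (r + 1) (int r - 2)) \<and>
    (obstruction_class R A \<delta> r m
           = \<zero>\<^bsub>HH R (homology A \<delta>) (induced R A \<delta> 2 0 (m 2)) (r + 1) (int r - 2)\<^esub> \<longleftrightarrow>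
         (\<exists>m'. dg_A_structure R A \<delta> (r + 1) m' \<and> (\<forall>i\<in>{1..r - 1}. m' i = m i)))"
proof -
  interpret dg_mod R A \<delta>
    by (intro dg_mod.intro graded_mod.intro dg_mod_axioms.intro) (use assms(1,3) in \<open>simp_all add: dgmodule_def\<close>)
  obtain P S h where "dg_contraction R A \<delta> P S h" by (rule projective_contraction[OF assms(4,5)])
  then interpret dg_contraction R A \<delta> P S h .
  let ?m = "extend_zero R A r m"
  have r: "1 \<le> r" using assms(2) by simp
  interpret o: operations R A \<delta> ?m by (rule extend_zero_operations[OF assms(6) r])
  interpret o: ainf_contraction R A \<delta> P S h ?m r
    by (intro ainf_contraction.intro dg_contraction_axioms trunc_ainf.intro o.operations_axioms trunc_ainf_axioms.intro)
      (use assms(2) extend_zero_operations(2)[OF assms(6) r] in \<open>auto simp: extend_zero_def\<close>)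
  have m: "?m i = m i" if "i \<in> {1..r}" for i using that by (simp add: extend_zero_def)
  have ob: "obstruction_cochain R A r m = obstruction_cochain R A r ?m"
    by (rule o.obstruction_cong) (auto simp: m)
  have m2: "?m 2 = m 2" using assms(2) by (simp add: m)
  have cl: "obstruction_class R A \<delta> r m = obstruction_class R A \<delta> r ?m"
    by (simp add: obstruction_class_def ob m2)
  have lift: "(\<exists>m'. dg_A_structure R A \<delta> (r + 1) m' \<and> (\<forall>i\<in>{1..r - 1}. m' i = m i)) \<longleftrightarrow>
    (\<exists>m'. dg_A_structure R A \<delta> (r + 1) m' \<and> (\<forall>i\<in>{1..r - 1}. m' i = ?m i))"
  proof -
    have "(\<forall>i\<in>{1..r - 1}. m' i = m i) \<longleftrightarrow> (\<forall>i\<in>{1..r - 1}. m' i = ?m i)" for m'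
      by (rule ball_cong[OF refl]) (use m in auto)
    then show ?thesis by simp
  qed
  show ?thesis
    unfolding ob cl lift
    using o.assoc o.obstruction_closed o.obs_cocycle o.ob_class_closed o.ob_class_zero_iff_lift
    unfolding m2 by blast
qed

end
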